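(* Let $p>1$ and let $\hat{\pi}=\frac{2\pi}{p\sin(\pi/p)}$. For $\rho\in L^{1}(0,\hat{\pi})$ with $\rho>0$ a.e., let $\mu_1<\mu_2<\cdots$ denote the eigenvalues of the Dirichlet problem $$(|y'|^{p-2}y')'=-(p-1)\mu\,\rho(x)|y|^{p-2}y\ \text{ on } (0,\hat{\pi}),\qquad y(0)=y(\hat{\pi})=0 .$$ (a) If $\rho$ is single-barrier with transition point $\frac{\hat{\pi}}{2}$, then $$\frac{\mu_2}{\mu_1}\ge 2^{p},$$ and equality holds if and only if $\rho$ is constant (a.e.). Furthermore, for every $a\in[0,\hat{\pi}]$ with $a\ne\frac{\hat{\pi}}{2}$, there exists a single-barrier density $\rho$ with transition point $a$ such that $\frac{\mu_2}{\mu_1}<2^{p}$. (b) If $\rho$ is a symmetric single-well density with transition point $\frac{\hat{\pi}}{2}$, then $$\frac{\mu_2}{\mu_1}\le 2^{p},$$ and equality holds if and only if $\rho$ is constant a.e.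
   Context: A function $V$ on $[0,\hat{\pi}]$ is called single-well with transition point $a\in[0,\hat{\pi}]$ if $V$ is decreasing (in the weak sense) on $[0,a]$ and increasing (in the weak sense) on $[a,\hat{\pi}]$. $V$ is called single-barrier with transition point $a$ if $-V$ is single-well with transition point $a$. $V$ is symmetric if $V(x)=V(\hat{\pi}-x)$. A density is a function $\rho\in L^1(0,\hat{\pi})$ with $\rho>0$ a.e. An eigenvalue is a real number $\mu$ for which the boundary value problem has a nontrivial solution $y$ (with $y$ and $|y'|^{p-2}y'$ absolutely continuous and the equation holding a.e.). The eigenvalues form a strictly increasing sequence $\mu_1<\mu_2<\cdots$ tending to $\infty$, and an eigenfunction for $\mu_n$ has exactly $n-1$ zeros in $(0,\hat{\pi})$. *)

theory Defs
  imports "HOL-Analysis.Analysis"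
begin

definition pi_hat :: "real \<Rightarrow> real" where
  "pi_hat p = 2 * pi / (p * sin (pi / p))"

definition single_well :: "real \<Rightarrow> real \<Rightarrow> (real \<Rightarrow> real) \<Rightarrow> bool" where
  "single_well p a V \<longleftrightarrow>
     a \<in> {0..pi_hat p} \<and> antimono_on {0..a} V \<and> mono_on {a..pi_hat p} V"

definition single_barrier :: "real \<Rightarrow> real \<Rightarrow> (real \<Rightarrow> real) \<Rightarrow> bool" where
  "single_barrier p a V \<longleftrightarrow> single_well p a (\<lambda>x. - V x)"

definition symmetric :: "real \<Rightarrow> (real \<Rightarrow> real) \<Rightarrow> bool" where
  "symmetric p V \<longleftrightarrow> (\<forall>x\<in>{0..pi_hat p}. V x = V (pi_hat p - x))"

definition is_density :: "real \<Rightarrow> (real \<Rightarrow> real) \<Rightarrow> bool" where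
  "is_density p \<rho> \<longleftrightarrow>
     \<rho> absolutely_integrable_on {0<..<pi_hat p} \<and> (AE x\<in>{0<..<pi_hat p} in lebesgue. \<rho> x > 0)"

definition ae_constant :: "real \<Rightarrow> (real \<Rightarrow> real) \<Rightarrow> bool" where
  "ae_constant p \<rho> \<longleftrightarrow> (\<exists>c. AE x\<in>{0<..<pi_hat p} in lebesgue. \<rho> x = c)"

text \<open>
  Absolute continuity of a function on an interval. (The constant \<^const>\<open>absolutely_continuous\<close>
  is about measures.)
\<close>

definition abs_continuous_on :: "real set \<Rightarrow> (real \<Rightarrow> real) \<Rightarrow> bool" where
  "abs_continuous_on S f \<longleftrightarrow>
     (\<forall>\<epsilon>>0. \<exists>\<delta>>0. \<forall>(n::nat) a b.
        (\<forall>i<n. a i \<le> b i \<and> {a i..b i} \<subseteq> S) \<and>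
        disjoint_family_on (\<lambda>i. {a i<..<b i}) {..<n} \<and>
        (\<Sum>i<n. b i - a i) < \<delta> \<longrightarrow>
        (\<Sum>i<n. \<bar>f (b i) - f (a i)\<bar>) < \<epsilon>)"

text \<open>The map $s \mapsto |s|^{p-2}s$; its value at $0$ is $0$ for every $p > 1$.\<close>

definition signed_pow :: "real \<Rightarrow> real \<Rightarrow> real" where
  "signed_pow p s = \<bar>s\<bar> powr (p - 2) * s"

text \<open>
  Here \<open>dy\<close> is the derivative $y'$, one-sided at the end points; it has to exist at every
  point, since $|y'|^{p-2}y'$ is required to be an absolutely continuous function.
\<close>

definition dirichlet_solution ::
    "real \<Rightarrow> (real \<Rightarrow> real) \<Rightarrow> real \<Rightarrow> (real \<Rightarrow> real) \<Rightarrow> bool" where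
  "dirichlet_solution p \<rho> \<mu> y \<longleftrightarrow>
     abs_continuous_on {0..pi_hat p} y \<and>
     (\<exists>dy. (\<forall>x\<in>{0..pi_hat p}. (y has_real_derivative dy x) (at x within {0..pi_hat p})) \<and>
           abs_continuous_on {0..pi_hat p} (\<lambda>x. signed_pow p (dy x)) \<and>
           (AE x\<in>{0<..<pi_hat p} in lebesgue.
              ((\<lambda>t. signed_pow p (dy t)) has_real_derivative
                 - (p - 1) * \<mu> * \<rho> x * signed_pow p (y x)) (at x))) \<and>
     y 0 = 0 \<and> y (pi_hat p) = 0"

definition is_eigenvalue :: "real \<Rightarrow> (real \<Rightarrow> real) \<Rightarrow> real \<Rightarrow> bool" where
  "is_eigenvalue p \<rho> \<mu> \<longleftrightarrow>
     (\<exists>y. dirichlet_solution p \<rho> \<mu> y \<and> (\<exists>x\<in>{0..pi_hat p}. y x \<noteq> 0))"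

text \<open>
  The \<open>n\<close>-th eigenvalue $\mu_n$ in increasing order, counted from \<open>n = 1\<close>: the eigenvalue
  that has exactly \<open>n - 1\<close> eigenvalues below it.
\<close>

definition eigenvalue :: "real \<Rightarrow> (real \<Rightarrow> real) \<Rightarrow> nat \<Rightarrow> real" where
  "eigenvalue p \<rho> n =
     (THE \<mu>. is_eigenvalue p \<rho> \<mu> \<and>
        finite {\<nu>. is_eigenvalue p \<rho> \<nu> \<and> \<nu> < \<mu>} \<and>
        Suc (card {\<nu>. is_eigenvalue p \<rho> \<nu> \<and> \<nu> < \<mu>}) = n)"

text \<open>Any strictly increasing enumeration of the eigenvalues agrees with \<^const>\<open>eigenvalue\<close>.\<close>

lemma eigenvalue_enumeration:
  assumes mono: "strict_mono m" and range: "range m = {\<mu>. is_eigenvalue p \<rho> \<mu>}"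
  shows "eigenvalue p \<rho> (Suc n) = m n"
proof -
  have below: "{\<nu>. is_eigenvalue p \<rho> \<nu> \<and> \<nu> < m k} = m ` {..<k}" for k
  proof -
    have "{\<nu>. is_eigenvalue p \<rho> \<nu> \<and> \<nu> < m k} = {\<nu> \<in> range m. \<nu> < m k}"
      using range by auto
    also have "\<dots> = m ` {..<k}"
      using strict_mono_less[OF mono] by auto
    finally show ?thesis .
  qed
  have card: "card (m ` {..<k}) = k" for k
    using card_image[OF inj_on_subset[OF strict_mono_on_imp_inj_on[OF mono] subset_UNIV]] by simp
  show ?thesis
    unfolding eigenvalue_def
  proof (rule the_equality)
    show "is_eigenvalue p \<rho> (m n) \<and> finite {\<nu>. is_eigenvalue p \<rho> \<nu> \<and> \<nu> < m n} \<and>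
        Suc (card {\<nu>. is_eigenvalue p \<rho> \<nu> \<and> \<nu> < m n}) = Suc n"
      using range by (auto simp: below card)
  next
    fix \<mu>
    assume \<mu>: "is_eigenvalue p \<rho> \<mu> \<and> finite {\<nu>. is_eigenvalue p \<rho> \<nu> \<and> \<nu> < \<mu>} \<and>
        Suc (card {\<nu>. is_eigenvalue p \<rho> \<nu> \<and> \<nu> < \<mu>}) = Suc n"
    then obtain k where "\<mu> = m k"
      using range by auto
    with \<mu> show "\<mu> = m n"
      by (simp add: below card)
  qed
qed

end

theory Submission
  imports Defs
begin

text \<open>
  Where a solution \<open>y\<close> does not vanish, \<open>W = \<bar>y'\<bar> powr (p - 2) * y' / (\<bar>y\<bar> powr (p - 2) * y)\<close> solves the
  Riccati equation \<open>W' = - (p - 1) (\<mu> \<rho> + \<bar>W\<bar> powr q)\<close> with \<open>q = p / (p - 1)\<close>, and at a zero \<open>c\<close> of \<open>y\<close> the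
  difference between \<open>W\<close> and \<open>(x - c) powr (1 - p)\<close> tends to \<open>0\<close>; so Sturm comparison becomes a linear
  differential inequality for the difference of two such functions.

  Let \<open>(a, b)\<close> be a nodal interval of the second eigenfunction and \<open>L\<close> the constant density that has \<open>(a, b)\<close>
  as a nodal interval at the same eigenvalue \<open>\<mu>\<^sub>2\<close>. Let \<open>B\<^sub>2\<close> be its Riccati function and \<open>B\<^sub>1\<close> the one on the
  doubled interval, so that \<open>B\<^sub>1 b = 0\<close>; let \<open>A\<^sub>1\<close>, \<open>A\<^sub>2\<close> belong to the first two eigenfunctions of \<open>\<rho>\<close>. If \<open>\<rho>\<close>
  crosses \<open>L\<close> upwards once, then \<open>A\<^sub>2 \<ge> B\<^sub>2\<close>, and convexity of \<open>\<bar>w\<bar> powr q\<close> yields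
  \<open>A\<^sub>1 - B\<^sub>1 \<le> (\<mu>\<^sub>1 / \<mu>\<^sub>2) (A\<^sub>2 - B\<^sub>2)\<close> as soon as \<open>\<mu>\<^sub>2 \<le> 2 powr p * \<mu>\<^sub>1\<close>. The right-hand side tends to \<open>0\<close> at
  \<open>b\<close>, so \<open>A\<^sub>1 b \<le> 0\<close>, with equality only for \<open>\<rho> = L\<close> almost everywhere. For a barrier this applies to both
  nodal intervals (on the right one after a reflection) and forces equality; downward crossings reverse
  all inequalities, which gives the well and the counterexamples.

  Monotone densities are continuous off a countable set, so all differential equations hold off
  countable sets and no Lebesgue points are needed. Existence of the eigenvalues comes from a Pruefer
  angle along the boundary of a square, for which the right-hand side is Lipschitz also when \<open>p \<noteq> 2\<close>.
\<close>

section \<open>Derivatives off a countable set\<close>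

text \<open>The linear inequality for a difference \<open>D\<close> has the secant slope as
  coefficient, and this slope is unbounded at a singular end, so plain Gronwall fails there.
  One-sided bounds suffice: a lower bound of the slope at the left end carries
  \<open>D \<le> 0\<close> into the interval, an upper bound at the right end carries
  \<open>D = 0\<close> back from a vanishing limit. The factor \<open>2 powr p\<close> is what
  doubling an interval takes off the eigenvalue of a constant density. The weight
  \<open>\<mu>1 / \<mu>2\<close> is the one for which \<rho> cancels from the difference of the
  potentials; what remains, \<open>\<mu>1 * L - \<mu>2 * L / 2 powr p\<close>, has a sign exactly
  when the ratio is on one side of \<open>2 powr p\<close>. Hence each estimate assumes the unwanted
  or the equality case and derives equality and rigidity. The other obstacle is the unknown node
  \<open>z\<close>. For a barrier the longer nodal interval contains the peak, so the single
  crossing there must be proved; for a well, symmetry puts \<open>z\<close> at the midpoint; for a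
  step density the size of the jump is chosen so that the jump stays inside the first nodal
  interval.\<close>

lemma nonneg_deriv_off_countable_imp_le:
  fixes f :: "real \<Rightarrow> real"
  assumes "a \<le> b" "countable S" "continuous_on {a..b} f"
    and deriv: "\<And>x. x \<in> {a<..<b} - S \<Longrightarrow> \<exists>d\<ge>0. (f has_real_derivative d) (at x)"
  shows "f a \<le> f b"
proof (rule ccontr)
  assume "\<not> f a \<le> f b"
  then have ab: "f b < f a" and "a < b"
    using \<open>a \<le> b\<close> by (auto simp: not_le order_less_le)
  \<comment> \<open>Half the mean rate of fall: adding this slope makes the derivative strictly
    positive, while \<open>g\<close> still falls from \<open>a\<close> to \<open>b\<close>.\<close>
  define e where "e = (f a - f b) / (2 * (b - a))"
  define g where "g x = f x + e * (x - a)" for x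
  have e: "e > 0"
    using ab \<open>a < b\<close> by (simp add: e_def)
  have "g b < g a"
  proof -
    have "e * (b - a) = (f a - f b) / 2"
      using \<open>a < b\<close> unfolding e_def by (simp add: divide_simps)
    then show ?thesis using ab by (simp add: g_def)
  qed
  have contg: "continuous_on {a..b} g"
    unfolding g_def by (intro continuous_intros assms)
  \<comment> \<open>The countable image of \<open>S\<close> misses some level \<open>v\<close> in
    the gap. The last point \<open>t\<close> at which \<open>g\<close> reaches \<open>v\<close>
    therefore lies off \<open>S\<close>, and the positive derivative there contradicts
    \<open>g < v\<close> to the right of \<open>t\<close>.\<close>
  have "uncountable {g b<..<g a}"
    using \<open>g b < g a\<close> by (simp add: uncountable_open_interval)
  then obtain v where v: "v \<in> {g b<..<g a}" "v \<notin> g ` S"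
    using countable_image[OF \<open>countable S\<close>, of g] by (meson countable_subset subsetI)
  define T where "T = {x \<in> {a..b}. v \<le> g x}"
  define t where "t = Sup T"
  have "closed T"
    unfolding T_def using continuous_closed_preimage[OF contg, of "{v..}"]
    by (simp add: vimage_def Int_def conj_commute)
  moreover have "a \<in> T" "bdd_above T"
    using v \<open>a < b\<close> by (auto simp: T_def bdd_above_def)
  ultimately have tT: "t \<in> T"
    unfolding t_def using closed_contains_Sup by blast
  have above: "g x < v" if "x \<in> {t<..b}" for x
  proof -
    have "x \<notin> T" using that cSup_upper[OF _ \<open>bdd_above T\<close>, of x] by (auto simp: t_def)
    then show ?thesis using that tT by (auto simp: T_def)
  qed
  have "t < b" using tT v by (auto simp: T_def order_less_le)
  have "g t \<le> v"
  proof (rule tendsto_upperbound)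
    show "(g \<longlongrightarrow> g t) (at_right t)"
      using tT \<open>t < b\<close>
      by (intro continuous_on_Icc_at_rightD[of _ b] continuous_on_subset[OF contg]) (auto simp: T_def)
    show "eventually (\<lambda>x. g x \<le> v) (at_right t)"
      using above \<open>t < b\<close> by (auto simp: eventually_at_right intro!: exI[of _ b] less_imp_le)
  qed simp
  then have gt: "g t = v" using tT by (auto simp: T_def)
  then have "t \<notin> S" "a < t"
    using v tT by (auto simp: T_def order_less_le)
  then obtain d where "d \<ge> 0" "(f has_real_derivative d) (at t)"
    using deriv[of t] \<open>t < b\<close> by auto
  then have "(g has_real_derivative (d + e)) (at t)"
    unfolding g_def by (auto intro!: derivative_eq_intros)
  then obtain \<delta> where "\<delta> > 0" and inc: "\<And>h. h > 0 \<Longrightarrow> h < \<delta> \<Longrightarrow> g t < g (t + h)"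
    using DERIV_pos_inc_right[of g "d + e" t] e \<open>d \<ge> 0\<close> by auto
  define h where "h = min (\<delta> / 2) (b - t)"
  have "h > 0" "h < \<delta>" "t + h \<in> {t<..b}"
    using \<open>\<delta> > 0\<close> \<open>t < b\<close> by (auto simp: h_def min_def)
  then show False
    using inc[of h] above[of "t + h"] gt by auto
qed

lemma gronwall_off_countable:
  fixes f :: "real \<Rightarrow> real"
  assumes "a \<le> b" "countable S" "continuous_on {a..b} f"
    and deriv: "\<And>x. x \<in> {a<..<b} - S \<Longrightarrow> \<exists>d\<le>M * f x. (f has_real_derivative d) (at x)"
  shows "f b \<le> exp (M * (b - a)) * f a"
proof -
  define g where "g x = - exp (- (M * x)) * f x" for x
  have "g a \<le> g b"
  proof (rule nonneg_deriv_off_countable_imp_le[OF assms(1,2)])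
    show "continuous_on {a..b} g"
      unfolding g_def by (intro continuous_intros assms)
    fix x assume "x \<in> {a<..<b} - S"
    then obtain d where d: "d \<le> M * f x" "(f has_real_derivative d) (at x)"
      using deriv by blast
    have "(g has_real_derivative (exp (- (M * x)) * (M * f x - d))) (at x)"
      unfolding g_def using d(2) by (auto intro!: derivative_eq_intros simp: algebra_simps)
    then show "\<exists>d\<ge>0. (g has_real_derivative d) (at x)"
      using d(1) by (intro exI[of _ "exp (- (M * x)) * (M * f x - d)"]) auto
  qed
  then have "exp (M * b) * (exp (- (M * b)) * f b) \<le> exp (M * b) * (exp (- (M * a)) * f a)"
    unfolding g_def by (intro mult_left_mono) auto
  moreover have "exp (M * b) * (exp (- (M * b)) * f b) = f b"
    by (simp add: exp_minus)
  moreover have "exp (M * b) * (exp (- (M * a)) * f a) = exp (M * (b - a)) * f a"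
    by (simp add: exp_diff exp_minus right_diff_distrib divide_inverse)
  ultimately show ?thesis by simp
qed

text \<open>Subtracting the indefinite integral of \<open>g\<close> leaves zero derivative off
  \<open>S\<close>, hence a constant. The derivative thus reaches the exceptional points and,
  one-sidedly, the end points, where \<open>dirichlet_solution\<close> requires it.\<close>

lemma has_derivative_of_continuous_off_countable:
  fixes f :: "real \<Rightarrow> real"
  assumes "countable S" "continuous_on {a..b} f" "continuous_on {a..b} g"
    and deriv: "\<And>x. x \<in> {a<..<b} - S \<Longrightarrow> (f has_real_derivative g x) (at x)"
    and x: "x \<in> {a..b}"
  shows "(f has_real_derivative g x) (at x within {a..b})"
proof -
  let ?G = "\<lambda>x. integral {a..x} g"
  have G: "(?G has_real_derivative g x) (at x within {a..b})" if "x \<in> {a..b}" for x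
    using integral_has_real_derivative[OF assms(3) that] .
  have contG: "continuous_on {a..b} ?G"
    using G by (meson DERIV_continuous continuous_on_eq_continuous_within)
  have eq: "f x - ?G x = f a - ?G a" if "x \<in> {a..b}" for x
  proof -
    have sub: "{a..x} \<subseteq> {a..b}" using that by auto
    have d: "((\<lambda>x. f x - ?G x) has_real_derivative 0) (at y)" if "y \<in> {a<..<x} - S" for y
    proof -
      have y: "y \<in> {a<..<b} - S" using that \<open>x \<in> {a..b}\<close> by auto
      then have "(?G has_real_derivative g y) (at y)"
        using G[of y] at_within_Icc_at[of a y b] by auto
      with deriv[OF y] show ?thesis by (auto intro!: derivative_eq_intros)
    qed
    have cont: "continuous_on {a..x} (\<lambda>x. f x - ?G x)"
      by (intro continuous_on_diff continuous_on_subset[OF assms(2) sub] continuous_on_subset[OF contG sub])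
    have "f a - ?G a \<le> f x - ?G x"
      by (rule nonneg_deriv_off_countable_imp_le[OF _ \<open>countable S\<close> cont]) (use that d in auto)
    moreover have "- (f a - ?G a) \<le> - (f x - ?G x)"
    proof (rule nonneg_deriv_off_countable_imp_le[OF _ \<open>countable S\<close> continuous_on_minus[OF cont]])
      show "\<exists>d\<ge>0. ((\<lambda>x. - (f x - ?G x)) has_real_derivative d) (at y)" if "y \<in> {a<..<x} - S" for y
        using DERIV_minus[OF d[OF that]] by auto
    qed (use that in auto)
    ultimately show ?thesis by simp
  qed
  have "((\<lambda>x. f a - ?G a + ?G x) has_real_derivative g x) (at x within {a..b})"
    using G[OF x] by (auto intro!: derivative_eq_intros)
  then show ?thesis
    unfolding has_field_derivative_def
    by (rule has_derivative_transform[OF x, rotated]) (use eq in force)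
qed

lemma lipschitz_off_countable:
  fixes f :: "real \<Rightarrow> real"
  assumes "countable S" "continuous_on {a..b} f" "x \<in> {a..b}" "y \<in> {a..b}"
    and deriv: "\<And>x. x \<in> {a<..<b} - S \<Longrightarrow> \<exists>d. \<bar>d\<bar> \<le> M \<and> (f has_real_derivative d) (at x)"
  shows "\<bar>f x - f y\<bar> \<le> M * \<bar>x - y\<bar>"
proof -
  have *: "\<bar>f y - f x\<bar> \<le> M * (y - x)" if "x \<le> y" "x \<in> {a..b}" "y \<in> {a..b}" for x y
  proof -
    have "s * f x + M * x \<le> s * f y + M * y" if "s = 1 \<or> s = -1" for s
    proof (rule nonneg_deriv_off_countable_imp_le[OF \<open>x \<le> y\<close> assms(1)])
      show "continuous_on {x..y} (\<lambda>t. s * f t + M * t)"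
        using \<open>x \<in> {a..b}\<close> \<open>y \<in> {a..b}\<close>
        by (intro continuous_intros continuous_on_subset[OF assms(2)]) auto
      fix t assume "t \<in> {x<..<y} - S"
      then obtain d where "\<bar>d\<bar> \<le> M" "(f has_real_derivative d) (at t)"
        using deriv[of t] \<open>x \<in> {a..b}\<close> \<open>y \<in> {a..b}\<close> by auto
      then show "\<exists>d\<ge>0. ((\<lambda>t. s * f t + M * t) has_real_derivative d) (at t)"
        using that by (intro exI[of _ "s * d + M"]) (auto intro!: derivative_eq_intros)
    qed
    from this[of 1] this[of "-1"] show ?thesis by (auto simp: algebra_simps abs_le_iff)
  qed
  show ?thesis
    using *[of x y] *[of y x] assms(3,4) by (cases "x \<le> y") (auto simp: abs_minus_commute)
qed

section \<open>The signed power and its secants\<close>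

lemma signed_pow_eq_sgn: "signed_pow r x = sgn x * \<bar>x\<bar> powr (r - 1)"
proof (cases "x = 0")
  case False
  then have "\<bar>x\<bar> powr (r - 1) = \<bar>x\<bar> powr (r - 2) * \<bar>x\<bar>"
    using powr_add[of "\<bar>x\<bar>" "r - 2" 1] by simp
  then show ?thesis
    by (simp add: signed_pow_def sgn_mult_abs mult.commute mult.left_commute abs_mult_sgn[of x])
qed (simp add: signed_pow_def)

lemma signed_pow_zero [simp]: "signed_pow r 0 = 0"
  by (simp add: signed_pow_def)

lemma signed_pow_minus [simp]: "signed_pow r (- x) = - signed_pow r x"
  by (simp add: signed_pow_def)

lemma signed_pow_eq_0_iff [simp]: "signed_pow r x = 0 \<longleftrightarrow> x = 0"
  by (auto simp: signed_pow_def)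

lemma signed_pow_of_nonneg: "x \<ge> 0 \<Longrightarrow> signed_pow r x = x powr (r - 1)"
  by (cases "x = 0") (auto simp: signed_pow_eq_sgn)

lemma abs_signed_pow: "\<bar>signed_pow r x\<bar> = \<bar>x\<bar> powr (r - 1)"
  by (cases "x = 0") (auto simp: signed_pow_eq_sgn abs_mult abs_sgn_eq)

lemma sgn_signed_pow [simp]: "sgn (signed_pow r x) = sgn x"
  by (cases "x = 0") (auto simp: signed_pow_eq_sgn sgn_mult)

lemma signed_pow_pos_iff [simp]: "signed_pow r x > 0 \<longleftrightarrow> x > 0"
  by (metis sgn_signed_pow sgn_greater)

lemma signed_pow_neg_iff [simp]: "signed_pow r x < 0 \<longleftrightarrow> x < 0"
  by (metis sgn_signed_pow sgn_less)

lemma signed_pow_mult: "signed_pow r (x * y) = signed_pow r x * signed_pow r y"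
  by (simp add: signed_pow_def abs_mult powr_mult)

lemma mult_signed_pow: "x * signed_pow r x = \<bar>x\<bar> powr r"
proof (cases "x = 0")
  case False
  have "\<bar>x\<bar> powr r = \<bar>x\<bar> powr (r - 1) * \<bar>x\<bar>"
    using powr_add[of "\<bar>x\<bar>" "r - 1" 1] False by simp
  then show ?thesis
    by (simp add: signed_pow_eq_sgn abs_sgn)
qed simp

text \<open>The hypothesis says that the exponents are conjugate. With \<open>p\<close> and
  \<open>p / (p - 1)\<close> this recovers the derivative of \<open>y\<close> from its signed
  power.\<close>

lemma signed_pow_signed_pow:
  assumes "(r - 1) * (r' - 1) = 1"
  shows "signed_pow r' (signed_pow r x) = x"
proof (cases "x = 0")
  case False
  have "\<bar>signed_pow r x\<bar> powr (r' - 1) = \<bar>x\<bar>"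
    using False assms by (simp add: abs_signed_pow powr_powr)
  then show ?thesis
    by (subst signed_pow_eq_sgn) (simp add: sgn_mult_abs)
qed simp

lemma abs_signed_pow_powr:
  assumes "(r - 1) * r' = r"
  shows "\<bar>signed_pow r x\<bar> powr r' = \<bar>x\<bar> powr r"
  using assms by (simp add: abs_signed_pow powr_powr)

lemma signed_pow_strict_mono:
  assumes "r > 1" "x < y"
  shows "signed_pow r x < signed_pow r y"
proof -
  have *: "signed_pow r x < signed_pow r y" if "0 \<le> x" "x < y" for x y
    using that assms(1) by (simp add: signed_pow_of_nonneg powr_less_mono2)
  consider "0 \<le> x" | "x < 0" "0 \<le> y" | "y < 0" by linarith
  then show ?thesis
  proof cases
    case 2
    then have "signed_pow r x < 0" "signed_pow r y \<ge> 0"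
      by (simp_all only: signed_pow_neg_iff signed_pow_of_nonneg powr_ge_zero)
    then show ?thesis by (rule less_le_trans)
  next
    case 3
    then show ?thesis using *[of "- y" "- x"] assms by simp
  qed (use * assms in auto)
qed

lemma signed_pow_mono:
  assumes "r > 1" "x \<le> y"
  shows "signed_pow r x \<le> signed_pow r y"
  using signed_pow_strict_mono[OF assms(1), of x y] assms(2) by (cases "x = y") auto

lemma has_real_derivative_abs:
  assumes "x \<noteq> 0"
  shows "(abs has_real_derivative sgn x) (at (x::real))"
proof -
  have lin: "((\<lambda>y. sgn x * y) has_real_derivative sgn x) (at x)"
    by (auto intro!: derivative_eq_intros)
  show ?thesis
    by (rule has_field_derivative_transform_within_open[OF lin,
          of "if x > 0 then {0<..} else {..<0}"])
      (use assms in \<open>auto simp: sgn_if split: if_splits\<close>)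
qed

text \<open>At \<open>0\<close> the difference quotient is \<open>signed_pow r\<close> itself, which
  tends to \<open>0\<close> because \<open>r > 1\<close>.\<close>

lemma has_real_derivative_abs_powr:
  assumes "r > 1"
  shows "((\<lambda>x. \<bar>x\<bar> powr r) has_real_derivative r * signed_pow r x) (at x)"
proof (cases "x = 0")
  case True
  have "((\<lambda>x. \<bar>x\<bar> powr r) has_real_derivative 0) (at 0)"
    unfolding has_field_derivative_iff
  proof (rule Lim_transform_eventually)
    have "((\<lambda>x. \<bar>signed_pow r x\<bar>) \<longlongrightarrow> \<bar>0\<bar> powr (r - 1)) (at 0)"
      unfolding abs_signed_pow using assms
      by (intro tendsto_powr' tendsto_intros) auto
    then show "(signed_pow r \<longlongrightarrow> 0) (at 0)"
      using assms by (simp add: tendsto_rabs_zero_iff)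
    show "eventually (\<lambda>x. signed_pow r x = (\<bar>x\<bar> powr r - \<bar>0\<bar> powr r) / (x - 0)) (at 0)"
      using assms by (auto simp: eventually_at_filter mult_signed_pow[symmetric])
  qed
  then show ?thesis using True by simp
next
  case False
  then have "((\<lambda>x. \<bar>x\<bar> powr r) has_real_derivative (r * \<bar>x\<bar> powr (r - 1) * sgn x)) (at x)"
    by (auto intro!: derivative_eq_intros has_real_derivative_abs)
  then show ?thesis by (simp add: signed_pow_eq_sgn mult_ac)
qed

lemma has_real_derivative_signed_pow:
  assumes "x \<noteq> 0"
  shows "(signed_pow r has_real_derivative (r - 1) * \<bar>x\<bar> powr (r - 2)) (at x)"
proof -
  have "((\<lambda>x. \<bar>x\<bar> powr (r - 2) * x) has_real_derivative
      ((r - 2) * \<bar>x\<bar> powr (r - 2 - 1) * sgn x) * x + \<bar>x\<bar> powr (r - 2)) (at x)"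
    using assms by (auto intro!: derivative_eq_intros has_real_derivative_abs simp: algebra_simps)
  moreover have "\<bar>x\<bar> powr (r - 2) = \<bar>x\<bar> powr (r - 2 - 1) * (sgn x * x)"
    using assms powr_add[of "\<bar>x\<bar>" "r - 3" 1] by (simp add: sgn_mult_self_eq sgn_if split: if_splits)
  ultimately show ?thesis
    unfolding signed_pow_def [abs_def] by (simp add: algebra_simps)
qed

lemma continuous_on_signed_pow [continuous_intros]:
  assumes "r > 1" "continuous_on S f"
  shows "continuous_on S (\<lambda>x. signed_pow r (f x))"
proof -
  have "isCont (signed_pow r) x" for x
  proof (cases "x = 0")
    case True
    have "((\<lambda>x. \<bar>signed_pow r x\<bar>) \<longlongrightarrow> \<bar>0\<bar> powr (r - 1)) (at 0)"
      unfolding abs_signed_pow using assms by (intro tendsto_powr' tendsto_intros) auto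
    then show ?thesis
      using assms True by (simp add: tendsto_rabs_zero_iff isCont_def)
  qed (use has_real_derivative_signed_pow DERIV_isCont in blast)
  then have "continuous_on UNIV (signed_pow r)"
    by (simp add: continuous_at_imp_continuous_on)
  then show ?thesis
    by (rule continuous_on_compose2[OF _ assms(2)]) auto
qed

text \<open>The slope of the chord of \<open>\<bar>x\<bar> powr r\<close> between \<open>a\<close>
  and \<open>b\<close>, written as the mean of the derivative. In this form \<open>a = b\<close> is
  no special case, and monotonicity in both arguments follows from that of the integrand.\<close>

definition abs_powr_secant :: "real \<Rightarrow> real \<Rightarrow> real \<Rightarrow> real" where
  "abs_powr_secant r a b = integral {0..1} (\<lambda>t. r * signed_pow r (b + t * (a - b)))"

lemma abs_powr_diff:
  assumes "r > 1"
  shows "\<bar>a\<bar> powr r - \<bar>b\<bar> powr r = abs_powr_secant r a b * (a - b)"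
proof -
  have "((\<lambda>t. r * signed_pow r (b + t * (a - b)) * (a - b)) has_integral
      \<bar>b + 1 * (a - b)\<bar> powr r - \<bar>b + 0 * (a - b)\<bar> powr r) {0..1}"
  proof (rule fundamental_theorem_of_calculus)
    fix t :: real
    have "((\<lambda>t. \<bar>b + t * (a - b)\<bar> powr r) has_real_derivative
        (r * signed_pow r (b + t * (a - b)) * (a - b))) (at t within {0..1})"
      by (rule DERIV_chain2[OF has_real_derivative_abs_powr[OF assms]])
        (auto intro!: derivative_eq_intros)
    then show "((\<lambda>t. \<bar>b + t * (a - b)\<bar> powr r) has_vector_derivative
        (r * signed_pow r (b + t * (a - b)) * (a - b))) (at t within {0..1})"
      by (simp add: has_real_derivative_iff_has_vector_derivative)
  qed simp
  from integral_unique[OF this] show ?thesis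
    unfolding abs_powr_secant_def by (simp only: integral_mult_left) simp
qed

lemma continuous_on_secant_integrand:
  assumes "r > 1"
  shows "continuous_on {0..1} (\<lambda>t. r * signed_pow r (b + t * (a - b)))"
  using assms by (intro continuous_intros)

lemma abs_powr_secant_self: "abs_powr_secant r a a = r * signed_pow r a"
  by (simp add: abs_powr_secant_def)

lemma convex_comb_mono:
  assumes "a2 \<le> a1" "b2 \<le> b1" "t \<in> {0..1::real}"
  shows "b2 + t * (a2 - b2) \<le> b1 + t * (a1 - b1)"
proof -
  have "(1 - t) * b2 + t * a2 \<le> (1 - t) * b1 + t * a1"
    using assms by (intro add_mono mult_left_mono) auto
  then show ?thesis by (simp add: algebra_simps)
qed

lemma abs_powr_secant_mono:
  assumes "r > 1" "a2 \<le> a1" "b2 \<le> b1"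
  shows "abs_powr_secant r a2 b2 \<le> abs_powr_secant r a1 b1"
  unfolding abs_powr_secant_def
  using assms
  by (intro integral_le integrable_continuous_real continuous_on_secant_integrand mult_left_mono
      signed_pow_mono convex_comb_mono) auto

text \<open>Strictness in one argument is enough: for every \<open>t\<close> inside the unit
  interval the convex combination already increases strictly.\<close>

lemma abs_powr_secant_strict_mono:
  assumes "r > 1" "a2 \<le> a1" "b2 < b1"
  shows "abs_powr_secant r a2 b2 < abs_powr_secant r a1 b1"
proof -
  let ?f = "\<lambda>a b t. r * signed_pow r (b + t * (a - b))"
  have "?f a2 b2 t < ?f a1 b1 t" if "t \<in> box 0 1" for t
  proof -
    have "(1 - t) * b2 + t * a2 < (1 - t) * b1 + t * a1"
      using assms that by (intro add_less_le_mono mult_strict_left_mono mult_left_mono) auto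
    then show ?thesis
      using assms(1) by (intro mult_strict_left_mono signed_pow_strict_mono) (auto simp: algebra_simps)
  qed
  then have "integral (cbox 0 1) (?f a2 b2) < integral (cbox 0 1) (?f a1 b1)"
    using assms(1) continuous_on_secant_integrand[OF assms(1)] by (intro integral_less) auto
  then show ?thesis by (simp add: abs_powr_secant_def)
qed

lemma abs_powr_secant_ge:
  assumes "r > 1" "m \<le> a" "m \<le> b"
  shows "r * signed_pow r m \<le> abs_powr_secant r a b"
  using abs_powr_secant_mono[OF assms] by (simp add: abs_powr_secant_self)

lemma abs_powr_secant_le:
  assumes "r > 1" "a \<le> m" "b \<le> m"
  shows "abs_powr_secant r a b \<le> r * signed_pow r m"
  using abs_powr_secant_mono[OF assms] by (simp add: abs_powr_secant_self)

text \<open>Countable exceptional sets stand in for null sets: a continuous function with derivative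
  \<open>0\<close> off a null set may still increase, as the Cantor function does. The end points
  are left free, so two adjacent intervals can be joined at the cost of one point.\<close>

definition co_countable :: "real \<Rightarrow> real \<Rightarrow> (real \<Rightarrow> bool) \<Rightarrow> bool" where
  "co_countable c d P \<longleftrightarrow> (\<exists>S. countable S \<and> (\<forall>x\<in>{c<..<d} - S. P x))"

lemma co_countableI [intro?]: "(\<And>x. x \<in> {c<..<d} \<Longrightarrow> P x) \<Longrightarrow> co_countable c d P"
  unfolding co_countable_def by (intro exI[of _ "{}"]) auto

lemma co_countable_mono:
  assumes "co_countable c d P" "c \<le> c'" "d' \<le> d" "\<And>x. x \<in> {c'<..<d'} \<Longrightarrow> P x \<Longrightarrow> Q x"
  shows "co_countable c' d' Q"
proof -
  obtain S where "countable S" "\<forall>x\<in>{c<..<d} - S. P x"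
    using assms(1) by (auto simp: co_countable_def)
  then show ?thesis
    using assms(2-) unfolding co_countable_def by (intro exI[of _ S]) auto
qed

lemma co_countable_conj:
  assumes "co_countable c d P" "co_countable c d Q"
  shows "co_countable c d (\<lambda>x. P x \<and> Q x)"
proof -
  obtain S T where "countable S" "\<forall>x\<in>{c<..<d} - S. P x" "countable T" "\<forall>x\<in>{c<..<d} - T. Q x"
    using assms by (auto simp: co_countable_def)
  then show ?thesis
    unfolding co_countable_def by (intro exI[of _ "S \<union> T"]) auto
qed

lemma co_countable_elim:
  assumes "co_countable c d P" "co_countable c d Q" "\<And>x. x \<in> {c<..<d} \<Longrightarrow> P x \<Longrightarrow> Q x \<Longrightarrow> R x"
  shows "co_countable c d R"
  using co_countable_mono[OF co_countable_conj[OF assms(1,2)], of c d R] assms(3) by auto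

lemma co_countable_split:
  assumes "co_countable c e P" "co_countable e d P"
  shows "co_countable c d P"
proof -
  obtain S T where "countable S" "\<forall>x\<in>{c<..<e} - S. P x" "countable T" "\<forall>x\<in>{e<..<d} - T. P x"
    using assms by (auto simp: co_countable_def)
  then show ?thesis
    unfolding co_countable_def
    by (intro exI[of _ "insert e (S \<union> T)"]) (auto simp: linorder_neq_iff Ball_def)
qed

lemma co_countable_ex:
  assumes "co_countable c d P" "c < d"
  obtains x where "x \<in> {c<..<d}" "P x"
proof -
  obtain S where "countable S" "\<forall>x\<in>{c<..<d} - S. P x"
    using assms by (auto simp: co_countable_def)
  moreover have "\<not> {c<..<d} \<subseteq> S"
    using uncountable_open_interval[of c d] assms(2) \<open>countable S\<close> countable_subset by blast
  ultimately show thesis using that by blast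
qed

lemma co_countable_reflect:
  assumes "co_countable c d P"
  shows "co_countable (r - d) (r - c) (\<lambda>x. P (r - x))"
proof -
  obtain S where S: "countable S" "\<forall>x\<in>{c<..<d} - S. P x"
    using assms by (auto simp: co_countable_def)
  have "P (r - x)" if "x \<in> {r - d<..<r - c} - (\<lambda>x. r - x) ` S" for x
  proof -
    have "r - x \<notin> S"
    proof
      assume "r - x \<in> S"
      then have "r - (r - x) \<in> (\<lambda>x. r - x) ` S" by blast
      then show False using that by simp
    qed
    then show ?thesis using S(2) that by auto
  qed
  then show ?thesis
    using S(1) unfolding co_countable_def by (intro exI[of _ "(\<lambda>x. r - x) ` S"]) auto
qed

lemma co_countable_eq_imp_eq:
  fixes f g :: "real \<Rightarrow> real"
  assumes "co_countable c d (\<lambda>x. f x = g x)"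
    and "continuous_on {c<..<d} f" "continuous_on {c<..<d} g" "x \<in> {c<..<d}"
  shows "f x = g x"
proof (rule ccontr)
  assume "f x \<noteq> g x"
  have op: "open {x \<in> {c<..<d}. f x - g x \<in> - {0}}"
    using continuous_open_preimage[OF continuous_on_diff[OF assms(2,3)], of "- {0}"]
    by (simp add: Int_def vimage_def open_Compl)
  have "x \<in> {x \<in> {c<..<d}. f x - g x \<in> - {0}}"
    using \<open>f x \<noteq> g x\<close> assms(4) by simp
  from openE[OF op this] obtain e where e: "e > 0" "ball x e \<subseteq> {x \<in> {c<..<d}. f x - g x \<in> - {0}}" .
  have sub: "{x - e<..<x + e} \<subseteq> {x \<in> {c<..<d}. f x \<noteq> g x}"
    using e(2) by (auto simp: ball_eq_greaterThanLessThan)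
  obtain S where S: "countable S" "\<forall>x\<in>{c<..<d} - S. f x = g x"
    using assms(1) by (auto simp: co_countable_def)
  then have "{x - e<..<x + e} \<subseteq> S" using sub by blast
  then show False
    using uncountable_open_interval[of "x - e" "x + e"] S(1) e(1) countable_subset[of _ S] by auto
qed

text \<open>The square of the positive part is differentiable also where \<open>f\<close> changes
  sign, so Gronwall can be applied to the positive part of a difference.\<close>

lemma has_real_derivative_max_sq:
  fixes f :: "real \<Rightarrow> real"
  assumes "(f has_real_derivative d) (at x)"
  shows "((\<lambda>x. (max 0 (f x))\<^sup>2) has_real_derivative 2 * max 0 (f x) * d) (at x)"
proof -
  have abs: "((\<lambda>u. u * \<bar>u\<bar>) has_real_derivative 2 * \<bar>u\<bar>) (at u)" for u :: real
  proof (cases "u = 0")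
    case True
    have "((\<lambda>u::real. u * \<bar>u\<bar>) has_real_derivative 0) (at 0)"
      unfolding has_field_derivative_iff
    proof (rule Lim_transform_eventually)
      show "((\<lambda>u::real. \<bar>u\<bar>) \<longlongrightarrow> 0) (at 0)"
        by (rule tendsto_eq_intros refl | simp)+
      show "eventually (\<lambda>u::real. \<bar>u\<bar> = (u * \<bar>u\<bar> - 0 * \<bar>0\<bar>) / (u - 0)) (at 0)"
        by (auto simp: eventually_at_filter)
    qed
    then show ?thesis using True by simp
  next
    case False
    then show ?thesis
      by (auto intro!: derivative_eq_intros has_real_derivative_abs simp: sgn_if)
  qed
  have sq: "(max 0 u)\<^sup>2 = (u\<^sup>2 + u * \<bar>u\<bar>) / 2" and max: "2 * max 0 u = u + \<bar>u\<bar>" for u :: real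
    by (auto simp: max_def power2_eq_square)
  show ?thesis
    unfolding sq max
    using DERIV_cdivide[OF DERIV_add[OF DERIV_power[OF assms, of 2] DERIV_chain2[OF abs assms]], of 2]
    by (simp add: algebra_simps add_divide_distrib)
qed

lemma continuous_on_Icc_abs_bounded:
  fixes f :: "real \<Rightarrow> real"
  assumes "continuous_on {a..b} f"
  shows "\<exists>m. \<forall>x\<in>{a..b}. \<bar>f x\<bar> \<le> m"
proof -
  have "bounded (f ` {a..b})"
    by (intro compact_imp_bounded compact_continuous_image assms compact_Icc)
  then show ?thesis unfolding bounded_iff by auto
qed

text \<open>Where \<open>D > 0\<close>, a large secant slope only speeds up the decay, so a lower
  bound of the slope suffices for Gronwall, even if the slope is unbounded at \<open>c\<close>.
  Applied from points \<open>t\<close> close to \<open>c\<close>, where \<open>D\<close> is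
  arbitrarily small, it leaves no room for a positive value at \<open>x\<close>. In
  \<open>near\<close> the alternative \<open>D x \<le> 0\<close> serves the case that only
  \<open>B\<close> is singular at \<open>c\<close>.\<close>

lemma decay_nonpos:
  fixes A B D :: "real \<Rightarrow> real"
  assumes "r > 1" "\<kappa> \<ge> 0"
    and cont: "continuous_on {c<..<d} D" "continuous_on {c<..<d} A" "continuous_on {c<..<d} B"
    and deriv: "co_countable c d (\<lambda>x. \<exists>D'\<le>- \<kappa> * abs_powr_secant r (A x) (B x) * D x.
                  (D has_real_derivative D') (at x))"
    and near: "eventually (\<lambda>x. D x \<le> 0 \<or> m \<le> A x \<and> m \<le> B x) (at_right c)"
    and lim: "\<And>e. e > 0 \<Longrightarrow> eventually (\<lambda>x. D x < e) (at_right c)"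
    and x: "x \<in> {c<..<d}"
  shows "D x \<le> 0"
proof (rule ccontr)
  assume "\<not> D x \<le> 0"
  then have Dx: "D x > 0" by simp
  obtain b where b: "b > c" "\<And>y. y > c \<Longrightarrow> y < b \<Longrightarrow> D y \<le> 0 \<or> m \<le> A y \<and> m \<le> B y"
    using near unfolding eventually_at_right_field by blast
  define c0 where "c0 = min ((b + c) / 2) x"
  have c0: "c < c0" "c0 \<le> x" "c0 < b" using b(1) x by (auto simp: c0_def min_def)
  \<comment> \<open>Compactness gives a lower bound away from \<open>c\<close>; together with
    \<open>near\<close> it yields one bound \<open>m2\<close> on all of
    \<open>{c<..x}\<close>.\<close>
  have "continuous_on {c0..x} (\<lambda>y. min (A y) (B y))"
    using c0 x by (intro continuous_on_min continuous_on_subset[OF cont(2)]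
        continuous_on_subset[OF cont(3)]) auto
  then obtain m1' where "\<forall>y\<in>{c0..x}. \<bar>min (A y) (B y)\<bar> \<le> m1'"
    using continuous_on_Icc_abs_bounded by blast
  then obtain m1 where m1: "\<And>y. y \<in> {c0..x} \<Longrightarrow> m1 \<le> min (A y) (B y)"
    by (meson abs_le_D2 minus_le_iff)
  define m2 where "m2 = min m m1"
  have lower: "D y \<le> 0 \<or> m2 \<le> A y \<and> m2 \<le> B y" if "y \<in> {c<..x}" for y
    using b(2)[of y] m1[of y] that c0 by (cases "y < c0") (auto simp: m2_def)
  define G where "G y = (max 0 (D y))\<^sup>2" for y
  define M where "M = - 2 * \<kappa> * (r * signed_pow r m2)"
  \<comment> \<open>The absolute value and the full length make the Gronwall factor independent of
    the starting point \<open>t\<close>.\<close>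
  define K where "K = exp (\<bar>M\<bar> * (x - c))"
  have K: "K > 0" by (simp add: K_def)
  have G: "G x \<le> K * G t" if t: "t \<in> {c<..<x}" for t
  proof -
    obtain S where S: "countable S" "\<And>x. x \<in> {c<..<d} - S \<Longrightarrow>
        \<exists>D'\<le>- \<kappa> * abs_powr_secant r (A x) (B x) * D x. (D has_real_derivative D') (at x)"
      using deriv unfolding co_countable_def by metis
    have "G x \<le> exp (M * (x - t)) * G t"
    proof (rule gronwall_off_countable[OF _ S(1)])
      show "continuous_on {t..x} G"
        unfolding G_def using t x by (intro continuous_intros continuous_on_subset[OF cont(1)]) auto
      fix y assume y: "y \<in> {t<..<x} - S"
      then obtain D' where D': "D' \<le> - \<kappa> * abs_powr_secant r (A y) (B y) * D y"
        "(D has_real_derivative D') (at y)"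
        using S(2)[of y] t x by auto
      have "2 * max 0 (D y) * D' \<le> M * G y"
      proof (cases "D y \<le> 0")
        case False
        then have ge: "r * signed_pow r m2 \<le> abs_powr_secant r (A y) (B y)"
          using lower[of y] y t by (intro abs_powr_secant_ge assms) auto
        have "D' \<le> - \<kappa> * abs_powr_secant r (A y) (B y) * D y" by (fact D')
        also have "\<dots> \<le> - \<kappa> * (r * signed_pow r m2) * D y"
          using False assms(2) ge by (intro mult_right_mono mult_left_mono_neg) auto
        finally have "2 * D y * D' \<le> 2 * D y * (- \<kappa> * (r * signed_pow r m2) * D y)"
          using False by (intro mult_left_mono) auto
        then show ?thesis
          using False by (simp add: G_def M_def max_def power2_eq_square mult_ac)
      qed (simp add: G_def max_def)
      then show "\<exists>d\<le>M * G y. (G has_real_derivative d) (at y)"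
        using has_real_derivative_max_sq[OF D'(2)] unfolding G_def by blast
    qed (use t in auto)
    also have "\<dots> \<le> K * G t"
    proof (rule mult_right_mono)
      have "M * (x - t) \<le> \<bar>M\<bar> * (x - t)" using t by (intro mult_right_mono) auto
      also have "\<dots> \<le> \<bar>M\<bar> * (x - c)" using t by (intro mult_left_mono) auto
      finally show "exp (M * (x - t)) \<le> K" by (simp add: K_def)
    qed (simp add: G_def)
    finally show ?thesis .
  qed
  \<comment> \<open>With this bound on \<open>D t\<close>, Gronwall would give
    \<open>(K + 1)\<^sup>2 * e\<^sup>2 \<le> K * e\<^sup>2\<close>.\<close>
  define e where "e = D x / (K + 1)"
  have e: "e > 0" using Dx K by (simp add: e_def)
  obtain b' where b': "b' > c" "\<And>y. y > c \<Longrightarrow> y < b' \<Longrightarrow> D y < e"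
    using lim[OF e] by (auto simp: eventually_at_right_field)
  define t where "t = min ((b' + c) / 2) ((x + c) / 2)"
  have t: "t \<in> {c<..<x}" "t < b'" using b'(1) x by (auto simp: t_def min_def)
  have "G t \<le> e\<^sup>2"
    using b'(2)[of t] t e unfolding G_def by (intro power_mono) auto
  then have "K * G t \<le> K * e\<^sup>2"
    using K by simp
  then have "(D x)\<^sup>2 \<le> K * e\<^sup>2"
    using order_trans[OF G[OF t(1)]] Dx by (simp add: G_def)
  moreover have "(D x)\<^sup>2 = (K + 1)\<^sup>2 * e\<^sup>2"
    using K by (simp add: e_def power_divide)
  ultimately have "((K + 1)\<^sup>2 - K) * e\<^sup>2 \<le> 0" by (simp add: left_diff_distrib)
  moreover have "((K + 1)\<^sup>2 - K) * e\<^sup>2 > 0"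
    using K e by (intro mult_pos_pos) (auto simp: power2_eq_square algebra_simps add_pos_pos)
  ultimately show False by simp
qed

text \<open>For \<open>D \<le> 0\<close> an upper bound of the secant slope bounds how fast
  \<open>D\<close> can return to \<open>0\<close>: \<open>exp (M * (y - x)) * D y\<close> is
  nonincreasing in \<open>y\<close>. So \<open>- D x\<close> is at most a bounded multiple of
  \<open>- D t\<close>, and the latter vanishes as \<open>t\<close> tends to
  \<open>d\<close>.\<close>

lemma decay_rigid:
  fixes A B D :: "real \<Rightarrow> real"
  assumes "r > 1" "\<kappa> \<ge> 0"
    and cont: "continuous_on {c<..<d} D" "continuous_on {c<..<d} A" "continuous_on {c<..<d} B"
    and deriv: "co_countable c d (\<lambda>x. \<exists>D'\<le>- \<kappa> * abs_powr_secant r (A x) (B x) * D x.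
                  (D has_real_derivative D') (at x))"
    and nonpos: "\<And>x. x \<in> {c<..<d} \<Longrightarrow> D x \<le> 0"
    and near: "eventually (\<lambda>x. A x \<le> m \<and> B x \<le> m) (at_left d)"
    and lim: "(D \<longlongrightarrow> 0) (at_left d)"
    and x: "x \<in> {c<..<d}"
  shows "D x = 0"
proof -
  obtain b where b: "b < d" "\<And>y. y > b \<Longrightarrow> y < d \<Longrightarrow> A y \<le> m \<and> B y \<le> m"
    using near by (auto simp: eventually_at_left_field)
  define d0 where "d0 = max ((b + d) / 2) x"
  have d0: "d0 < d" "x \<le> d0" "b < d0" using b(1) x by (auto simp: d0_def max_def)
  have "continuous_on {x..d0} (\<lambda>y. max (A y) (B y))"
    using d0 x by (intro continuous_on_max continuous_on_subset[OF cont(2)]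
        continuous_on_subset[OF cont(3)]) auto
  then obtain m1' where "\<forall>y\<in>{x..d0}. \<bar>max (A y) (B y)\<bar> \<le> m1'"
    using continuous_on_Icc_abs_bounded by blast
  then obtain m1 where m1: "\<And>y. y \<in> {x..d0} \<Longrightarrow> max (A y) (B y) \<le> m1"
    by (meson abs_le_D1)
  define m2 where "m2 = max m m1"
  have upper: "A y \<le> m2 \<and> B y \<le> m2" if "y \<in> {x..<d}" for y
    using b(2)[of y] m1[of y] that d0 by (cases "y > d0") (auto simp: m2_def)
  define M where "M = \<kappa> * (r * signed_pow r m2)"
  have key: "- D x \<le> exp (M * (t - x)) * (- D t)" if t: "t \<in> {x<..<d}" for t
  proof -
    obtain S where S: "countable S" "\<And>x. x \<in> {c<..<d} - S \<Longrightarrow>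
        \<exists>D'\<le>- \<kappa> * abs_powr_secant r (A x) (B x) * D x. (D has_real_derivative D') (at x)"
      using deriv unfolding co_countable_def by metis
    have "- (exp (M * (x - x)) * D x) \<le> - (exp (M * (t - x)) * D t)"
    proof (rule nonneg_deriv_off_countable_imp_le[where f = "\<lambda>y. - (exp (M * (y - x)) * D y)", OF _ S(1)])
      show "continuous_on {x..t} (\<lambda>y. - (exp (M * (y - x)) * D y))"
        using t x by (intro continuous_intros continuous_on_subset[OF cont(1)]) auto
      fix y assume y: "y \<in> {x<..<t} - S"
      then obtain D' where D': "D' \<le> - \<kappa> * abs_powr_secant r (A y) (B y) * D y"
        "(D has_real_derivative D') (at y)"
        using S(2)[of y] t x by auto
      have le: "abs_powr_secant r (A y) (B y) \<le> r * signed_pow r m2"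
        using upper[of y] y t by (intro abs_powr_secant_le assms) auto
      have "D' \<le> - \<kappa> * abs_powr_secant r (A y) (B y) * D y" by (fact D')
      also have "\<dots> \<le> - \<kappa> * (r * signed_pow r m2) * D y"
        using nonpos[of y] y t x assms(2) le by (intro mult_right_mono_neg mult_left_mono_neg) auto
      finally have "- (D' + M * D y) \<ge> 0" by (simp add: M_def)
      then have "exp (M * (y - x)) * - (D' + M * D y) \<ge> 0" by (rule mult_nonneg_nonneg[rotated]) simp
      moreover have "((\<lambda>y. - (exp (M * (y - x)) * D y)) has_real_derivative
          exp (M * (y - x)) * - (D' + M * D y)) (at y)"
        using D'(2) by (auto intro!: derivative_eq_intros simp: algebra_simps)
      ultimately show "\<exists>d\<ge>0. ((\<lambda>y. - (exp (M * (y - x)) * D y)) has_real_derivative d) (at y)"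
        by blast
    qed (use t in auto)
    then show ?thesis by simp
  qed
  have "((\<lambda>t. exp (M * (t - x)) * (- D t)) \<longlongrightarrow> exp (M * (d - x)) * (- 0)) (at_left d)"
    by (intro tendsto_intros lim)
  moreover have "eventually (\<lambda>t. - D x \<le> exp (M * (t - x)) * (- D t)) (at_left d)"
    using key x by (auto simp: eventually_at_left_field intro!: exI[of _ x])
  ultimately have "- D x \<le> exp (M * (d - x)) * (- 0)"
    by (rule tendsto_lowerbound) simp
  then show ?thesis using nonpos[OF x] by simp
qed

section \<open>Riccati equations and Sturm comparison\<close>

definition riccati :: "real \<Rightarrow> (real \<Rightarrow> real) \<Rightarrow> real \<Rightarrow> real \<Rightarrow> (real \<Rightarrow> real) \<Rightarrow> bool" where
  "riccati p Q c d W \<longleftrightarrow> continuous_on {c<..<d} W \<and>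
     co_countable c d (\<lambda>x. (W has_real_derivative - (p - 1) * (Q x + \<bar>W x\<bar> powr (p / (p - 1)))) (at x))"

text \<open>Divergence of \<open>W\<close> alone would not control the difference of two such
  functions. The subtracted term depends only on \<open>p\<close> and \<open>c\<close>, not on the
  potential or on the scaling of the solution, so differences tend to \<open>0\<close>.\<close>

definition singular_left :: "real \<Rightarrow> real \<Rightarrow> (real \<Rightarrow> real) \<Rightarrow> bool" where
  "singular_left p c W \<longleftrightarrow> ((\<lambda>x. W x - (x - c) powr (1 - p)) \<longlongrightarrow> 0) (at_right c)"

definition singular_right :: "real \<Rightarrow> real \<Rightarrow> (real \<Rightarrow> real) \<Rightarrow> bool" where
  "singular_right p d W \<longleftrightarrow> ((\<lambda>x. W x + (d - x) powr (1 - p)) \<longlongrightarrow> 0) (at_left d)"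

lemma riccatiD:
  assumes "riccati p Q c d W"
  shows "continuous_on {c<..<d} W"
    and "co_countable c d (\<lambda>x. (W has_real_derivative - (p - 1) * (Q x + \<bar>W x\<bar> powr (p / (p - 1)))) (at x))"
  using assms by (auto simp: riccati_def)

lemma riccati_subinterval:
  assumes "riccati p Q c d W" "c \<le> c'" "d' \<le> d"
  shows "riccati p Q c' d' W"
  unfolding riccati_def
proof
  show "continuous_on {c'<..<d'} W"
    by (rule continuous_on_subset[OF riccatiD(1)[OF assms(1)]]) (use assms(2,3) in auto)
qed (rule co_countable_mono[OF riccatiD(2)[OF assms(1)] assms(2,3)])

lemma at_left_reflect_real: "at_left a = filtermap (\<lambda>x. r - x) (at_right (r - a))" for a r :: real
proof -
  have "at_left a = filtermap uminus (at_right (- a))"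
    by (rule at_left_minus)
  also have "at_right (- a) = filtermap (\<lambda>x. x - r) (at_right (r - a))"
    using filtermap_at_right_shift[of r "r - a"] by simp
  finally show ?thesis by (simp add: filtermap_filtermap)
qed

lemma tendsto_at_left_reflect:
  "((f :: real \<Rightarrow> real) \<longlongrightarrow> l) (at_left a) \<longleftrightarrow> ((\<lambda>x. f (r - x)) \<longlongrightarrow> l) (at_right (r - a))"
  by (subst at_left_reflect_real[of a r]) (simp add: filterlim_filtermap)

lemma singular_left_reflect_iff:
  "singular_left p (r - d) (\<lambda>x. - W (r - x)) \<longleftrightarrow> singular_right p d W"
proof -
  have "singular_right p d W \<longleftrightarrow> ((\<lambda>x. W (r - x) + (d - (r - x)) powr (1 - p)) \<longlongrightarrow> 0) (at_right (r - d))"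
    unfolding singular_right_def by (rule tendsto_at_left_reflect)
  also have "\<dots> \<longleftrightarrow> ((\<lambda>x. - (W (r - x) + (d - (r - x)) powr (1 - p))) \<longlongrightarrow> - 0) (at_right (r - d))"
    by (simp only: tendsto_minus_cancel_left[symmetric] minus_zero)
  finally show ?thesis
    by (simp add: singular_left_def algebra_simps)
qed

lemma singular_right_reflect_iff:
  "singular_right p (r - c) (\<lambda>x. - W (r - x)) \<longleftrightarrow> singular_left p c W"
  using singular_left_reflect_iff[of p r "r - c" "\<lambda>x. - W (r - x)"] by simp

lemma riccati_reflect:
  assumes "riccati p Q c d W"
  shows "riccati p (\<lambda>x. Q (r - x)) (r - d) (r - c) (\<lambda>x. - W (r - x))"
  unfolding riccati_def
proof
  show "continuous_on {r - d<..<r - c} (\<lambda>x. - W (r - x))"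
    by (intro continuous_on_minus continuous_on_compose2[OF riccatiD(1)[OF assms]] continuous_intros) auto
  have "((\<lambda>x. - W (r - x)) has_real_derivative - (p - 1) * (Q (r - x) + \<bar>- W (r - x)\<bar> powr (p / (p - 1)))) (at x)"
    if "(W has_real_derivative - (p - 1) * (Q (r - x) + \<bar>W (r - x)\<bar> powr (p / (p - 1)))) (at (r - x))" for x
  proof -
    have "((\<lambda>x. r - x) has_real_derivative - 1) (at x)"
      by (auto intro!: derivative_eq_intros)
    from DERIV_minus[OF DERIV_chain2[OF that this]] show ?thesis by simp
  qed
  then show "co_countable (r - d) (r - c) (\<lambda>x. ((\<lambda>x. - W (r - x)) has_real_derivative
      - (p - 1) * (Q (r - x) + \<bar>- W (r - x)\<bar> powr (p / (p - 1)))) (at x))"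
    by (rule co_countable_mono[OF co_countable_reflect[OF riccatiD(2)[OF assms], of r] order_refl order_refl])
qed

lemma singular_left_at_top:
  assumes "p > 1" "singular_left p c W"
  shows "filterlim W at_top (at_right c)"
proof -
  have "((\<lambda>x. x - c) \<longlongrightarrow> c - c) (at_right c)"
    by (intro tendsto_intros)
  moreover have "eventually (\<lambda>x. 0 < x - c) (at_right c)"
    by (simp add: eventually_at_right_less)
  ultimately have "filterlim (\<lambda>x. x - c) (at_right 0) (at_right c)"
    by (auto simp: filterlim_at elim: eventually_mono)
  moreover have "filterlim (\<lambda>x::real. x powr (1 - p)) at_top (at_right 0)"
  proof -
    have "filterlim (\<lambda>x::real. inverse (x powr (p - 1))) at_top (at_right 0)"
    proof (rule filterlim_inverse_at_top)
      show "((\<lambda>x::real. x powr (p - 1)) \<longlongrightarrow> 0) (at_right 0)"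
        using assms(1) tendsto_powr'[of "\<lambda>x::real. x" 0 "at_right 0" "\<lambda>_. p - 1" "p - 1"]
        by (auto simp: eventually_at_right_less eventually_at_filter)
      show "eventually (\<lambda>x::real. 0 < x powr (p - 1)) (at_right 0)"
        by (auto simp: eventually_at_filter)
    qed
    then show ?thesis
      by (simp add: powr_minus[symmetric])
  qed
  ultimately have "filterlim (\<lambda>x. (x - c) powr (1 - p)) at_top (at_right c)"
    by (rule filterlim_compose[rotated])
  from filterlim_tendsto_add_at_top[OF assms(2)[unfolded singular_left_def] this]
  show ?thesis by simp
qed

lemma singular_right_at_bot:
  assumes "p > 1" "singular_right p d W"
  shows "filterlim W at_bot (at_left d)"
proof -
  have "filterlim (\<lambda>x. - W (d - x)) at_top (at_right (d - d))"
    by (rule singular_left_at_top[OF assms(1) singular_left_reflect_iff[THEN iffD2, OF assms(2)]])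
  then show ?thesis
    unfolding filterlim_uminus_at_top[of W] at_left_reflect_real[of d d]
    by (simp add: filterlim_filtermap filterlim_uminus_at_bot)
qed

lemma riccati_diff_le:
  assumes "p > 1" "riccati p QA c d A" "riccati p QB c d B" "co_countable c d (\<lambda>x. QB x \<le> QA x)"
  shows "co_countable c d (\<lambda>x. \<exists>D'\<le>- (p - 1) * abs_powr_secant (p / (p - 1)) (A x) (B x) * (A x - B x).
           ((\<lambda>x. A x - B x) has_real_derivative D') (at x))"
proof (rule co_countable_elim[OF co_countable_conj[OF riccatiD(2)[OF assms(2)] riccatiD(2)[OF assms(3)]] assms(4)])
  fix x assume *: "(A has_real_derivative - (p - 1) * (QA x + \<bar>A x\<bar> powr (p / (p - 1)))) (at x) \<and>
    (B has_real_derivative - (p - 1) * (QB x + \<bar>B x\<bar> powr (p / (p - 1)))) (at x)" and "QB x \<le> QA x"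
  let ?q = "p / (p - 1)"
  have "?q > 1" using assms(1) by (simp add: divide_simps)
  note eq = abs_powr_diff[OF this, of "A x" "B x"]
  have "- (p - 1) * (QA x + \<bar>A x\<bar> powr ?q) - - (p - 1) * (QB x + \<bar>B x\<bar> powr ?q)
      = - (p - 1) * (QA x - QB x) - (p - 1) * (\<bar>A x\<bar> powr ?q - \<bar>B x\<bar> powr ?q)"
    by (simp add: algebra_simps)
  also have "\<dots> \<le> - (p - 1) * abs_powr_secant ?q (A x) (B x) * (A x - B x)"
    unfolding eq using assms(1) \<open>QB x \<le> QA x\<close> mult_nonneg_nonneg[of "p - 1" "QA x - QB x"]
    by (simp add: algebra_simps)
  finally show "\<exists>D'\<le>- (p - 1) * abs_powr_secant ?q (A x) (B x) * (A x - B x).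
           ((\<lambda>x. A x - B x) has_real_derivative D') (at x)"
    using DERIV_diff[OF conjunct1[OF *] conjunct2[OF *]] by blast
qed

text \<open>The two ways in which a Riccati function of a larger nodal interval can behave at
  \<open>c\<close>: either the intervals share this end, or \<open>c\<close> is an interior point of
  the larger one.\<close>

definition regular_or_singular_left :: "real \<Rightarrow> real \<Rightarrow> (real \<Rightarrow> real) \<Rightarrow> bool" where
  "regular_or_singular_left p c W \<longleftrightarrow> singular_left p c W \<or> (\<exists>l. (W \<longlongrightarrow> l) (at_right c))"

definition regular_or_singular_right :: "real \<Rightarrow> real \<Rightarrow> (real \<Rightarrow> real) \<Rightarrow> bool" where
  "regular_or_singular_right p d W \<longleftrightarrow> singular_right p d W \<or> (\<exists>l. (W \<longlongrightarrow> l) (at_left d))"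

text \<open>The larger potential makes \<open>A\<close> fall faster. At \<open>c\<close> there are
  two starts: if both are singular, the difference tends to \<open>0\<close>; if \<open>A\<close>
  stays finite, it is below \<open>B\<close> near \<open>c\<close> because \<open>B\<close> tends to
  infinity.\<close>

lemma sturm_le:
  assumes "p > 1" "riccati p QA c d A" "riccati p QB c d B" "co_countable c d (\<lambda>x. QB x \<le> QA x)"
    and B: "singular_left p c B" and A: "regular_or_singular_left p c A" and x: "x \<in> {c<..<d}"
  shows "A x \<le> B x"
proof -
  have q: "p / (p - 1) > 1" using assms(1) by (simp add: divide_simps)
  have "eventually (\<lambda>x. A x - B x \<le> 0 \<or> 0 \<le> A x \<and> 0 \<le> B x) (at_right c) \<and>
    (\<forall>e>0. eventually (\<lambda>x. A x - B x < e) (at_right c))"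
    using A unfolding regular_or_singular_left_def
  proof
    assume A: "singular_left p c A"
    have "eventually (\<lambda>x. 0 \<le> A x) (at_right c)" "eventually (\<lambda>x. 0 \<le> B x) (at_right c)"
      using singular_left_at_top[OF assms(1)] A B by (auto simp: filterlim_at_top)
    then have "eventually (\<lambda>x. A x - B x \<le> 0 \<or> 0 \<le> A x \<and> 0 \<le> B x) (at_right c)"
      by eventually_elim auto
    moreover have "((\<lambda>x. (A x - (x - c) powr (1 - p)) - (B x - (x - c) powr (1 - p))) \<longlongrightarrow> 0 - 0) (at_right c)"
      using A B unfolding singular_left_def by (intro tendsto_diff)
    then have "((\<lambda>x. A x - B x) \<longlongrightarrow> 0) (at_right c)" by simp
    ultimately show ?thesis by (auto dest: order_tendstoD)
  next
    assume "\<exists>l. (A \<longlongrightarrow> l) (at_right c)"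
    then obtain l where "(A \<longlongrightarrow> l) (at_right c)" by blast
    then have "eventually (\<lambda>x. A x < l + 1) (at_right c)"
      by (rule order_tendstoD) simp
    moreover have "eventually (\<lambda>x. l + 1 \<le> B x) (at_right c)"
      using singular_left_at_top[OF assms(1) B] by (auto simp: filterlim_at_top)
    ultimately have *: "eventually (\<lambda>x. A x - B x < 0) (at_right c)"
      by eventually_elim auto
    then have "eventually (\<lambda>x. A x - B x < e) (at_right c)" if "e > 0" for e
      using that by (auto elim!: eventually_mono)
    then show ?thesis using * by (auto elim!: eventually_mono)
  qed
  then have near: "eventually (\<lambda>x. A x - B x \<le> 0 \<or> 0 \<le> A x \<and> 0 \<le> B x) (at_right c)"
    and lim: "\<And>e. e > 0 \<Longrightarrow> eventually (\<lambda>x. A x - B x < e) (at_right c)" by simp_all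
  note cont = riccatiD(1)[OF assms(2)] riccatiD(1)[OF assms(3)]
  have "A x - B x \<le> 0"
    by (rule decay_nonpos[OF q _ continuous_on_diff[OF cont] cont riccati_diff_le[OF assms(1-4)] near lim x])
      (use assms(1) in auto)
  then show ?thesis by simp
qed

lemma riccati_eq_imp_potential_eq:
  assumes "p > 1" "riccati p QA c d A" "riccati p QB c d B" "\<And>x. x \<in> {c<..<d} \<Longrightarrow> A x = B x"
  shows "co_countable c d (\<lambda>x. QA x = QB x)"
proof (rule co_countable_elim[OF riccatiD(2)[OF assms(2)] riccatiD(2)[OF assms(3)]])
  fix x assume x: "x \<in> {c<..<d}"
    and A: "(A has_real_derivative - (p - 1) * (QA x + \<bar>A x\<bar> powr (p / (p - 1)))) (at x)"
    and B: "(B has_real_derivative - (p - 1) * (QB x + \<bar>B x\<bar> powr (p / (p - 1)))) (at x)"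
  have "(A has_real_derivative - (p - 1) * (QB x + \<bar>B x\<bar> powr (p / (p - 1)))) (at x)"
    by (rule has_field_derivative_transform_within_open[OF B open_greaterThanLessThan x])
      (use assms(4) in auto)
  from DERIV_unique[OF A this] show "QA x = QB x"
    using assms(1,4) x by simp
qed

lemma continuous_on_Ioo_tendsto:
  fixes f :: "real \<Rightarrow> real"
  assumes "continuous_on {c<..<d} f" "x \<in> {c<..<d}"
  shows "(f \<longlongrightarrow> f x) (at_left x)" "(f \<longlongrightarrow> f x) (at_right x)"
proof -
  have "(f \<longlongrightarrow> f x) (at x)"
    using assms by (simp add: continuous_on_eq_continuous_at isCont_def)
  then show "(f \<longlongrightarrow> f x) (at_left x)" "(f \<longlongrightarrow> f x) (at_right x)"
    by (simp_all add: filterlim_at_split)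
qed

text \<open>If the graphs touched at \<open>x\<close>, \<open>decay_rigid\<close> on
  \<open>{c<..<x}\<close> would make \<open>A\<close> and \<open>B\<close> equal there, and then the
  potentials would agree off a countable set.\<close>

lemma sturm_strict:
  assumes "p > 1" "riccati p QA c d A" "riccati p QB c d B" "co_countable c d (\<lambda>x. QB x < QA x)"
    and B: "singular_left p c B" and A: "regular_or_singular_left p c A" and x: "x \<in> {c<..<d}"
  shows "A x < B x"
proof (rule ccontr)
  have q: "p / (p - 1) > 1" using assms(1) by (simp add: divide_simps)
  have le: "co_countable c d (\<lambda>x. QB x \<le> QA x)"
    using co_countable_mono[OF assms(4), of c d] by (simp add: less_imp_le)
  note AB = sturm_le[OF assms(1-3) le B A]
  assume "\<not> A x < B x"
  then have eq: "A x = B x" using AB[OF x] by simp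
  have A': "riccati p QA c x A" and B': "riccati p QB c x B"
    using x assms(2,3) by (auto intro: riccati_subinterval)
  have Ax: "(A \<longlongrightarrow> A x) (at_left x)" and Bx: "(B \<longlongrightarrow> B x) (at_left x)"
    using continuous_on_Ioo_tendsto(1) x riccatiD(1)[OF assms(2)] riccatiD(1)[OF assms(3)] by blast+
  have "eventually (\<lambda>y. A y < A x + 1) (at_left x)" "eventually (\<lambda>y. B y < B x + 1) (at_left x)"
    using Ax Bx by (auto intro: order_tendstoD)
  then have near: "eventually (\<lambda>y. A y \<le> A x + 1 \<and> B y \<le> A x + 1) (at_left x)"
    by eventually_elim (use eq in auto)
  have lim: "((\<lambda>y. A y - B y) \<longlongrightarrow> 0) (at_left x)"
    using tendsto_diff[OF Ax Bx] eq by simp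
  note cont = riccatiD(1)[OF A'] riccatiD(1)[OF B']
  have le': "co_countable c x (\<lambda>x. QB x \<le> QA x)"
    using co_countable_mono[OF le] x by simp
  have "A y - B y = 0" if "y \<in> {c<..<x}" for y
    by (rule decay_rigid[OF q _ continuous_on_diff[OF cont] cont riccati_diff_le[OF assms(1) A' B' le'] _ near lim that])
      (use AB assms(1) x in auto)
  then have "co_countable c x (\<lambda>x. QA x = QB x)"
    using riccati_eq_imp_potential_eq[OF assms(1) A' B'] by auto
  moreover have "co_countable c x (\<lambda>x. QB x < QA x)"
    using co_countable_mono[OF assms(4)] x by auto
  ultimately have "co_countable c x (\<lambda>x. False)"
    by (rule co_countable_elim) simp
  then show False
    using x by (auto elim: co_countable_ex)
qed

text \<open>Since \<open>A \<le> B\<close> and \<open>B\<close> tends to minus infinity at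
  \<open>d\<close>, so does \<open>A\<close>; a finite limit at \<open>d\<close> is excluded and
  \<open>A\<close> is singular there. The difference then vanishes at \<open>d\<close>, and
  \<open>decay_rigid\<close> forces \<open>A = B\<close>.\<close>

lemma sturm_rigid:
  assumes "p > 1" "c < d" "riccati p QA c d A" "riccati p QB c d B"
    and le: "co_countable c d (\<lambda>x. QB x \<le> QA x)"
    and B: "singular_left p c B" "singular_right p d B"
    and A: "regular_or_singular_left p c A" "regular_or_singular_right p d A"
  shows "singular_left p c A" "singular_right p d A" "co_countable c d (\<lambda>x. QA x = QB x)"
proof -
  have q: "p / (p - 1) > 1" using assms(1) by (simp add: divide_simps)
  note AB = sturm_le[OF assms(1,3,4) le B(1) A(1)]
  have left: "eventually (\<lambda>x. x \<in> {c<..<d}) (at_left d)" and right: "eventually (\<lambda>x. x \<in> {c<..<d}) (at_right c)"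
    using assms(2) by (auto simp: eventually_at_left_field eventually_at_right_field)
  have "\<not> (A \<longlongrightarrow> l) (at_left d)" for l
  proof
    assume "(A \<longlongrightarrow> l) (at_left d)"
    then have "eventually (\<lambda>x. l - 1 < A x) (at_left d)"
      by (rule order_tendstoD) simp
    moreover have "eventually (\<lambda>x. B x \<le> l - 1) (at_left d)"
      using singular_right_at_bot[OF assms(1) B(2)] by (auto simp: filterlim_at_bot)
    ultimately have "eventually (\<lambda>x. False) (at_left d)"
      using left by eventually_elim (use AB in fastforce)
    then show False by simp
  qed
  then have A2: "singular_right p d A"
    using A(2) by (auto simp: regular_or_singular_right_def)
  have "((\<lambda>x. (A x + (d - x) powr (1 - p)) - (B x + (d - x) powr (1 - p))) \<longlongrightarrow> 0 - 0) (at_left d)"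
    using A2 B unfolding singular_right_def by (intro tendsto_diff)
  then have lim: "((\<lambda>x. A x - B x) \<longlongrightarrow> 0) (at_left d)" by simp
  have "eventually (\<lambda>x. A x \<le> 0) (at_left d)" "eventually (\<lambda>x. B x \<le> 0) (at_left d)"
    using singular_right_at_bot[OF assms(1)] A2 B by (auto simp: filterlim_at_bot)
  then have near: "eventually (\<lambda>x. A x \<le> 0 \<and> B x \<le> 0) (at_left d)"
    by eventually_elim auto
  note cont = riccatiD(1)[OF assms(3)] riccatiD(1)[OF assms(4)]
  have "A y - B y = 0" if "y \<in> {c<..<d}" for y
    by (rule decay_rigid[OF q _ continuous_on_diff[OF cont] cont riccati_diff_le[OF assms(1,3-5)] _ near lim that])
      (use AB assms(1) in auto)
  then have eq: "A y = B y" if "y \<in> {c<..<d}" for y using that by simp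
  show "singular_right p d A" by fact
  show "co_countable c d (\<lambda>x. QA x = QB x)"
    by (rule riccati_eq_imp_potential_eq[OF assms(1,3,4) eq])
  show "singular_left p c A"
    using B(1) unfolding singular_left_def
    by (rule Lim_transform_eventually) (use right eq in \<open>auto elim!: eventually_mono\<close>)
qed

text \<open>Expresses, in terms of the Riccati function alone, that \<open>c\<close> and
  \<open>d\<close> are consecutive zeros of a solution.\<close>

definition nodal :: "real \<Rightarrow> (real \<Rightarrow> real) \<Rightarrow> real \<Rightarrow> real \<Rightarrow> (real \<Rightarrow> real) \<Rightarrow> bool" where
  "nodal p Q c d W \<longleftrightarrow> riccati p Q c d W \<and> singular_left p c W \<and> singular_right p d W"

text \<open>The situation of the first eigenfunction on a nodal interval of the second: zero at
  \<open>c\<close>, no zero at \<open>d\<close>. The case \<open>l = 0\<close> means that the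
  solution is flat at \<open>d\<close>.\<close>

definition half_nodal :: "real \<Rightarrow> (real \<Rightarrow> real) \<Rightarrow> real \<Rightarrow> real \<Rightarrow> real \<Rightarrow> (real \<Rightarrow> real) \<Rightarrow> bool" where
  "half_nodal p Q c d l W \<longleftrightarrow> riccati p Q c d W \<and> singular_left p c W \<and> (W \<longlongrightarrow> l) (at_left d)"

lemma nodal_reflect:
  assumes "nodal p Q c d W"
  shows "nodal p (\<lambda>x. Q (r - x)) (r - d) (r - c) (\<lambda>x. - W (r - x))"
  using assms by (simp add: nodal_def riccati_reflect singular_left_reflect_iff singular_right_reflect_iff)

lemma nodal_imp_half_nodal:
  assumes "nodal p Q c d W" "e \<in> {c<..<d}"
  shows "half_nodal p Q c e (W e) W"
  using assms continuous_on_Ioo_tendsto(1)[OF riccatiD(1), of p Q c d W e]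
  by (auto simp: nodal_def half_nodal_def intro: riccati_subinterval)

text \<open>Sturm comparison is run from both ends towards the crossing \<open>e\<close>. From
  \<open>b\<close> it is run after a reflection, which reverses the sign of Riccati functions and
  thus fits the reversed order of the potentials; at \<open>e\<close> continuity decides.\<close>

lemma nodal_le_of_crossing:
  assumes "p > 1" "nodal p QA a b A" "nodal p QB a b B" "e \<in> {a..b}"
    and l: "co_countable a e (\<lambda>x. QA x \<le> QB x)" and r: "co_countable e b (\<lambda>x. QB x \<le> QA x)"
    and x: "x \<in> {a<..<b}"
  shows "B x \<le> A x"
proof -
  have left: "B y \<le> A y" if "y \<in> {a<..<e}" for y
    by (rule sturm_le[OF assms(1) _ _ l _ _ that])
      (use assms in \<open>auto simp: nodal_def regular_or_singular_left_def intro: riccati_subinterval\<close>)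
  have right: "B y \<le> A y" if "y \<in> {e<..<b}" for y
  proof -
    let ?A = "\<lambda>x. - A (0 - x)" and ?B = "\<lambda>x. - B (0 - x)"
    have "?A (- y) \<le> ?B (- y)"
    proof (rule sturm_le[OF assms(1), of "\<lambda>x. QA (0 - x)" "0 - b" "0 - e" ?A "\<lambda>x. QB (0 - x)" ?B])
      show "co_countable (0 - b) (0 - e) (\<lambda>x. QB (0 - x) \<le> QA (0 - x))"
        by (rule co_countable_reflect[OF r])
      have "riccati p QA e b A"
        using assms by (auto simp: nodal_def intro: riccati_subinterval)
      then show "riccati p (\<lambda>x. QA (0 - x)) (0 - b) (0 - e) ?A"
        by (rule riccati_reflect)
      have "riccati p QB e b B"
        using assms by (auto simp: nodal_def intro: riccati_subinterval)
      then show "riccati p (\<lambda>x. QB (0 - x)) (0 - b) (0 - e) ?B"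
        by (rule riccati_reflect)
      show "singular_left p (0 - b) ?B" "regular_or_singular_left p (0 - b) ?A"
        unfolding regular_or_singular_left_def singular_left_reflect_iff
        using assms by (auto simp: nodal_def)
    qed (use that in auto)
    then show ?thesis by simp
  qed
  show ?thesis
  proof (cases x e rule: linorder_cases)
    case equal
    have "(A \<longlongrightarrow> A x) (at_left x)" "(B \<longlongrightarrow> B x) (at_left x)"
      using assms(2,3) x by (auto simp: nodal_def intro: continuous_on_Ioo_tendsto(1)[OF riccatiD(1)])
    moreover have "eventually (\<lambda>y. B y \<le> A y) (at_left x)"
      using left x equal by (auto simp: eventually_at_left_field intro!: exI[of _ a])
    ultimately show ?thesis
      by (intro tendsto_le[of "at_left x" A "A x" B "B x"]) auto
  qed (use left right x in auto)
qed

text \<open>Convexity of \<open>\<bar>w\<bar> powr q\<close> enters here: the secant slope of the first pair dominates that of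
  the second, so \<open>A\<^sub>1 - B\<^sub>1 - k (A\<^sub>2 - B\<^sub>2)\<close> satisfies a linear differential inequality.\<close>

lemma half_nodal_comparison:
  assumes "p > 1" "k > 0" "a < b"
    and A1: "half_nodal p QA1 a b \<alpha> A1" and B1: "half_nodal p QB1 a b \<beta> B1"
    and A2: "nodal p QA2 a b A2" and B2: "nodal p QB2 a b B2"
    and AB2: "\<And>x. x \<in> {a<..<b} \<Longrightarrow> B2 x \<le> A2 x"
    and QA: "co_countable a b (\<lambda>x. QA1 x \<le> QA2 x)" and QB: "co_countable a b (\<lambda>x. QB1 x < QB2 x)"
    and Q: "co_countable a b (\<lambda>x. k * (QA2 x - QB2 x) \<le> QA1 x - QB1 x)"
  shows "\<alpha> \<le> \<beta>"
    and "\<alpha> = \<beta> \<Longrightarrow> co_countable a b (\<lambda>x. QA2 x = QB2 x \<and> QA1 x = QB1 x)"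
proof -
  let ?q = "p / (p - 1)"
  have q: "?q > 1" using assms(1) by (simp add: divide_simps)
  note ric = A1[unfolded half_nodal_def, THEN conjunct1] B1[unfolded half_nodal_def, THEN conjunct1]
    A2[unfolded nodal_def, THEN conjunct1] B2[unfolded nodal_def, THEN conjunct1]
  note cont = ric[THEN riccatiD(1)]
  have A21: "A2 x \<le> A1 x" if "x \<in> {a<..<b}" for x
    by (rule sturm_le[OF assms(1) ric(3,1) QA _ _ that])
      (use A1 A2 in \<open>auto simp: half_nodal_def nodal_def regular_or_singular_left_def\<close>)
  have B21: "B2 x < B1 x" if "x \<in> {a<..<b}" for x
    by (rule sturm_strict[OF assms(1) ric(4,2) QB _ _ that])
      (use B1 B2 in \<open>auto simp: half_nodal_def nodal_def regular_or_singular_left_def\<close>)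
  define D where "D x = A1 x - B1 x - k * (A2 x - B2 x)" for x
  define \<sigma>1 where "\<sigma>1 x = abs_powr_secant ?q (A1 x) (B1 x)" for x
  define \<sigma>2 where "\<sigma>2 x = abs_powr_secant ?q (A2 x) (B2 x)" for x
  define R where "R x = QA1 x - QB1 x - k * (QA2 x - QB2 x)" for x
  have \<sigma>: "\<sigma>2 x < \<sigma>1 x" if "x \<in> {a<..<b}" for x
    unfolding \<sigma>1_def \<sigma>2_def by (intro abs_powr_secant_strict_mono q A21 B21 that)
  \<comment> \<open>The derivative of \<open>D\<close>, regrouped so that the first two summands are
    nonnegative: \<open>R\<close> by hypothesis on the potentials, the product by
    \<open>\<sigma>\<close> and \<open>AB2\<close>. Only the linear term in \<open>D\<close> is
    left.\<close>
  define E where "E x = - (p - 1) * (R x + (\<sigma>1 x - \<sigma>2 x) * (k * (A2 x - B2 x)) + \<sigma>1 x * D x)" for x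
  have deriv: "co_countable a b (\<lambda>x. (D has_real_derivative E x) (at x) \<and> R x \<ge> 0)"
  proof -
    have "co_countable a b (\<lambda>x. (D has_real_derivative E x) (at x))"
    proof (rule co_countable_elim[OF co_countable_conj[OF ric(1,2)[THEN riccatiD(2)]]
          co_countable_conj[OF ric(3,4)[THEN riccatiD(2)]]])
      fix x
      assume "(A1 has_real_derivative - (p - 1) * (QA1 x + \<bar>A1 x\<bar> powr ?q)) (at x) \<and>
          (B1 has_real_derivative - (p - 1) * (QB1 x + \<bar>B1 x\<bar> powr ?q)) (at x)"
        and "(A2 has_real_derivative - (p - 1) * (QA2 x + \<bar>A2 x\<bar> powr ?q)) (at x) \<and>
          (B2 has_real_derivative - (p - 1) * (QB2 x + \<bar>B2 x\<bar> powr ?q)) (at x)"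
      then have "(D has_real_derivative
          - (p - 1) * (QA1 x + \<bar>A1 x\<bar> powr ?q) - - (p - 1) * (QB1 x + \<bar>B1 x\<bar> powr ?q) -
          k * (- (p - 1) * (QA2 x + \<bar>A2 x\<bar> powr ?q) - - (p - 1) * (QB2 x + \<bar>B2 x\<bar> powr ?q))) (at x)"
        unfolding D_def by (intro DERIV_diff DERIV_cmult) auto
      also have "- (p - 1) * (QA1 x + \<bar>A1 x\<bar> powr ?q) - - (p - 1) * (QB1 x + \<bar>B1 x\<bar> powr ?q) -
          k * (- (p - 1) * (QA2 x + \<bar>A2 x\<bar> powr ?q) - - (p - 1) * (QB2 x + \<bar>B2 x\<bar> powr ?q)) =
          - (p - 1) * (R x + (\<bar>A1 x\<bar> powr ?q - \<bar>B1 x\<bar> powr ?q) - k * (\<bar>A2 x\<bar> powr ?q - \<bar>B2 x\<bar> powr ?q))"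
        by (simp add: R_def algebra_simps)
      also have "\<dots> = E x"
        unfolding abs_powr_diff[OF q] E_def \<sigma>1_def \<sigma>2_def D_def by (simp add: algebra_simps)
      finally show "(D has_real_derivative E x) (at x)" .
    qed
    then show ?thesis
      by (rule co_countable_elim[OF _ Q]) (simp add: R_def)
  qed
  have slack: "R x \<ge> 0 \<Longrightarrow> x \<in> {a<..<b} \<Longrightarrow> E x \<le> - (p - 1) * \<sigma>1 x * D x" for x
  proof -
    assume "R x \<ge> 0" and x: "x \<in> {a<..<b}"
    then have "(p - 1) * (R x + (\<sigma>1 x - \<sigma>2 x) * (k * (A2 x - B2 x))) \<ge> 0"
      using \<sigma>[OF x] AB2[OF x] assms(1,2) by (intro mult_nonneg_nonneg add_nonneg_nonneg) auto
    then show ?thesis by (simp add: E_def algebra_simps)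
  qed
  have deriv_le: "co_countable a b (\<lambda>x. \<exists>D'\<le>- (p - 1) * abs_powr_secant ?q (A1 x) (B1 x) * D x.
      (D has_real_derivative D') (at x))"
    by (rule co_countable_mono[OF deriv order_refl order_refl]) (use slack in \<open>auto simp: \<sigma>1_def\<close>)
  have contD: "continuous_on {a<..<b} D"
    unfolding D_def by (intro continuous_intros cont)
  have near: "eventually (\<lambda>x. D x \<le> 0 \<or> 0 \<le> A1 x \<and> 0 \<le> B1 x) (at_right a)"
  proof -
    have "eventually (\<lambda>x. 0 \<le> A1 x) (at_right a)" "eventually (\<lambda>x. 0 \<le> B1 x) (at_right a)"
      using singular_left_at_top[OF assms(1)] A1 B1 by (auto simp: filterlim_at_top half_nodal_def)
    then show ?thesis by eventually_elim auto
  qed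
  \<comment> \<open>All four functions have the same singular part at \<open>a\<close>, and its
    coefficients in \<open>D\<close> add up to \<open>1 - 1 - k * (1 - 1) = 0\<close>.\<close>
  have limD: "(D \<longlongrightarrow> 0) (at_right a)"
  proof -
    let ?s = "\<lambda>x. (x - a) powr (1 - p)"
    have "((\<lambda>x. (A1 x - ?s x) - (B1 x - ?s x) - k * ((A2 x - ?s x) - (B2 x - ?s x))) \<longlongrightarrow>
        0 - 0 - k * (0 - 0)) (at_right a)"
      using A1 B1 A2 B2 by (intro tendsto_intros) (auto simp: half_nodal_def nodal_def singular_left_def)
    then show ?thesis by (simp add: D_def[abs_def])
  qed
  then have lim: "\<And>e. e > 0 \<Longrightarrow> eventually (\<lambda>x. D x < e) (at_right a)"
    by (auto dest: order_tendstoD)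
  have nonpos: "D x \<le> 0" if "x \<in> {a<..<b}" for x
    by (rule decay_nonpos[OF q _ contD cont(1,2) deriv_le near lim that]) (use assms(1) in auto)
  have limA: "(A1 \<longlongrightarrow> \<alpha>) (at_left b)" and limB: "(B1 \<longlongrightarrow> \<beta>) (at_left b)"
    using A1 B1 by (auto simp: half_nodal_def)
  \<comment> \<open>At \<open>b\<close> only the second pair is singular, and it enters through its
    difference, which tends to \<open>0\<close>.\<close>
  have limDb: "(D \<longlongrightarrow> \<alpha> - \<beta>) (at_left b)"
  proof -
    let ?s = "\<lambda>x. (b - x) powr (1 - p)"
    have "((\<lambda>x. A1 x - B1 x - k * ((A2 x + ?s x) - (B2 x + ?s x))) \<longlongrightarrow>
        \<alpha> - \<beta> - k * (0 - 0)) (at_left b)"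
      using limA limB A2 B2 by (intro tendsto_intros) (auto simp: nodal_def singular_right_def)
    then show ?thesis by (simp add: D_def[abs_def])
  qed
  have "eventually (\<lambda>x. D x \<le> 0) (at_left b)"
    using nonpos assms(3) by (auto simp: eventually_at_left_field intro!: exI[of _ a])
  from tendsto_upperbound[OF limDb this] show "\<alpha> \<le> \<beta>" by simp
  assume "\<alpha> = \<beta>"
  then have limDb0: "(D \<longlongrightarrow> 0) (at_left b)" using limDb by simp
  have "eventually (\<lambda>x. A1 x < \<alpha> + 1) (at_left b)" "eventually (\<lambda>x. B1 x < \<alpha> + 1) (at_left b)"
    using limA limB \<open>\<alpha> = \<beta>\<close> by (auto intro: order_tendstoD)
  then have near_b: "eventually (\<lambda>x. A1 x \<le> \<alpha> + 1 \<and> B1 x \<le> \<alpha> + 1) (at_left b)"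
    by eventually_elim auto
  have D0: "D x = 0" if "x \<in> {a<..<b}" for x
    by (rule decay_rigid[OF q _ contD cont(1,2) deriv_le nonpos near_b limDb0 that]) (use assms(1) in auto)
  \<comment> \<open>With \<open>D = 0\<close> throughout, \<open>E\<close> vanishes too, hence so do
    both of its nonnegative summands; \<open>\<sigma>1 - \<sigma>2\<close> is strictly positive, so
    the second one gives \<open>A2 = B2\<close>.\<close>
  have zero: "co_countable a b (\<lambda>x. R x = 0 \<and> A2 x = B2 x)"
  proof (rule co_countable_mono[OF deriv order_refl order_refl])
    fix x assume x: "x \<in> {a<..<b}" and *: "(D has_real_derivative E x) (at x) \<and> 0 \<le> R x"
    have "(D has_real_derivative 0) (at x)"
      by (rule has_field_derivative_transform_within_open[OF _ open_greaterThanLessThan x])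
        (use D0 in auto)
    then have "E x = 0" using * DERIV_unique by blast
    then have "R x + (\<sigma>1 x - \<sigma>2 x) * (k * (A2 x - B2 x)) = 0"
      using assms(1) D0[OF x] by (simp add: E_def)
    moreover have "(\<sigma>1 x - \<sigma>2 x) * (k * (A2 x - B2 x)) \<ge> 0"
      using \<sigma>[OF x] AB2[OF x] assms(2) by simp
    ultimately have "R x = 0" "(\<sigma>1 x - \<sigma>2 x) * (k * (A2 x - B2 x)) = 0"
      using * by linarith+
    then show "R x = 0 \<and> A2 x = B2 x"
      using \<sigma>[OF x] assms(2) by auto
  qed
  have "A2 x = B2 x" if "x \<in> {a<..<b}" for x
    by (rule co_countable_eq_imp_eq[OF co_countable_mono[OF zero order_refl order_refl] cont(3,4) that]) auto
  then have "co_countable a b (\<lambda>x. QA2 x = QB2 x)"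
    by (rule riccati_eq_imp_potential_eq[OF assms(1) ric(3,4)])
  then show "co_countable a b (\<lambda>x. QA2 x = QB2 x \<and> QA1 x = QB1 x)"
    by (rule co_countable_elim[OF _ zero]) (simp add: R_def)
qed

text \<open>The reflected function is nodal for the same potential, so comparison in both directions
  makes it equal to \<open>W\<close> at the midpoint, where reflection only changes the
  sign.\<close>

lemma nodal_symmetric_midpoint:
  assumes "p > 1" "nodal p Q c d W" "c < d" "co_countable c d (\<lambda>x. Q (c + d - x) = Q x)"
  shows "W ((c + d) / 2) = 0"
proof -
  let ?V = "\<lambda>x. - W (c + d - x)"
  have V: "nodal p (\<lambda>x. Q (c + d - x)) c d ?V"
    using nodal_reflect[OF assms(2), of "c + d"] by simp
  have mid: "(c + d) / 2 \<in> {c<..<d}" using assms(3) by auto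
  have eqs: "co_countable c d (\<lambda>x. Q (c + d - x) \<le> Q x)" "co_countable c d (\<lambda>x. Q x \<le> Q (c + d - x))"
    using co_countable_mono[OF assms(4) order_refl order_refl] by auto
  have "W ((c + d) / 2) \<le> ?V ((c + d) / 2)"
    by (rule sturm_le[OF assms(1) _ _ eqs(1) _ _ mid])
      (use assms(2) V in \<open>auto simp: nodal_def regular_or_singular_left_def\<close>)
  moreover have "?V ((c + d) / 2) \<le> W ((c + d) / 2)"
    by (rule sturm_le[OF assms(1) _ _ eqs(2) _ _ mid])
      (use assms(2) V in \<open>auto simp: nodal_def regular_or_singular_left_def\<close>)
  ultimately show ?thesis by (simp add: field_simps)
qed

section \<open>Affine changes of variable and constant potentials\<close>

lemma co_countable_affine:
  assumes "co_countable c d P" "s > 0"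
  shows "co_countable (t + c / s) (t + d / s) (\<lambda>x. P (s * (x - t)))"
proof -
  obtain S where S: "countable S" "\<forall>x\<in>{c<..<d} - S. P x"
    using assms by (auto simp: co_countable_def)
  have "P (s * (x - t))" if "x \<in> {t + c / s<..<t + d / s} - (\<lambda>y. t + y / s) ` S" for x
  proof -
    have "x = t + s * (x - t) / s" using assms(2) by simp
    then have "s * (x - t) \<notin> S" using that by (metis DiffE imageI)
    moreover have "c < s * (x - t)" "s * (x - t) < d"
      using that assms(2) by (auto simp: field_simps)
    ultimately show ?thesis using S(2) by auto
  qed
  then show ?thesis
    using S(1) unfolding co_countable_def by (intro exI[of _ "(\<lambda>y. t + y / s) ` S"]) auto
qed

text \<open>Rescaling \<open>x\<close> by \<open>s\<close> multiplies the derivative of a solution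
  by \<open>s\<close>, hence its signed power by \<open>s powr (p - 1)\<close>; the
  \<open>Q\<close>-term then has to scale like \<open>\<bar>W\<bar> powr (p / (p - 1))\<close>, that
  is by \<open>s powr p\<close>.\<close>

lemma riccati_affine:
  assumes "p > 1" "riccati p Q c d W" "s > 0"
  shows "riccati p (\<lambda>x. s powr p * Q (s * (x - t))) (t + c / s) (t + d / s) (\<lambda>x. s powr (p - 1) * W (s * (x - t)))"
  unfolding riccati_def
proof
  show "continuous_on {t + c / s<..<t + d / s} (\<lambda>x. s powr (p - 1) * W (s * (x - t)))"
    using assms(3)
    by (intro continuous_on_mult continuous_on_const continuous_on_compose2[OF riccatiD(1)[OF assms(2)]] continuous_intros)
      (auto simp: field_simps)
  have "((\<lambda>x. s powr (p - 1) * W (s * (x - t))) has_real_derivative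
      - (p - 1) * (s powr p * Q (s * (x - t)) + \<bar>s powr (p - 1) * W (s * (x - t))\<bar> powr (p / (p - 1)))) (at x)"
    if "(W has_real_derivative
      - (p - 1) * (Q (s * (x - t)) + \<bar>W (s * (x - t))\<bar> powr (p / (p - 1)))) (at (s * (x - t)))" for x
  proof -
    have "((\<lambda>x. s * (x - t)) has_real_derivative s) (at x)"
      by (auto intro!: derivative_eq_intros)
    note d = DERIV_cmult[OF DERIV_chain2[OF that this], of "s powr (p - 1)"]
    have "s powr p = s powr (p - 1) * s"
      using assms(3) powr_add[of s "p - 1" 1] by simp
    moreover have "\<bar>s powr (p - 1) * W (s * (x - t))\<bar> powr (p / (p - 1)) =
        s powr p * \<bar>W (s * (x - t))\<bar> powr (p / (p - 1))"
      using assms(1) by (simp add: abs_mult powr_mult powr_powr)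
    ultimately show ?thesis
      using d by (simp add: algebra_simps)
  qed
  then show "co_countable (t + c / s) (t + d / s) (\<lambda>x. ((\<lambda>x. s powr (p - 1) * W (s * (x - t))) has_real_derivative
      - (p - 1) * (s powr p * Q (s * (x - t)) + \<bar>s powr (p - 1) * W (s * (x - t))\<bar> powr (p / (p - 1)))) (at x))"
    by (rule co_countable_mono[OF co_countable_affine[OF riccatiD(2)[OF assms(2)] assms(3), of t] order_refl order_refl])
qed

lemma filterlim_affine_at_right:
  fixes s :: real
  assumes "s > 0"
  shows "filterlim (\<lambda>x. s * (x - t)) (at_right c) (at_right (t + c / s))"
  unfolding filterlim_at
proof
  have "((\<lambda>x. s * (x - t)) \<longlongrightarrow> s * (t + c / s - t)) (at_right (t + c / s))"
    by (intro tendsto_intros)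
  then show "((\<lambda>x. s * (x - t)) \<longlongrightarrow> c) (at_right (t + c / s))"
    using assms by simp
  have "eventually (\<lambda>x. t + c / s < x) (at_right (t + c / s))"
    by (rule eventually_at_right_less)
  then show "eventually (\<lambda>x. s * (x - t) \<in> {c<..} \<and> s * (x - t) \<noteq> c) (at_right (t + c / s))"
    by eventually_elim (use assms in \<open>auto simp: field_simps\<close>)
qed

lemma singular_left_affine:
  assumes "singular_left p c W" "s > 0"
  shows "singular_left p (t + c / s) (\<lambda>x. s powr (p - 1) * W (s * (x - t)))"
proof -
  have "((\<lambda>x. s powr (p - 1) * (W (s * (x - t)) - (s * (x - t) - c) powr (1 - p))) \<longlongrightarrow> s powr (p - 1) * 0)
      (at_right (t + c / s))"
    by (intro tendsto_intros filterlim_compose[OF assms(1)[unfolded singular_left_def] filterlim_affine_at_right] assms)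
  moreover have "eventually (\<lambda>x. s powr (p - 1) * (W (s * (x - t)) - (s * (x - t) - c) powr (1 - p)) =
      s powr (p - 1) * W (s * (x - t)) - (x - (t + c / s)) powr (1 - p)) (at_right (t + c / s))"
    using eventually_at_right_less[of "t + c / s"]
  proof eventually_elim
    case (elim x)
    have "s * (x - t) - c = s * (x - (t + c / s))"
      using assms(2) by (simp add: field_simps)
    then have "(s * (x - t) - c) powr (1 - p) = s powr (1 - p) * (x - (t + c / s)) powr (1 - p)"
      by (simp add: powr_mult)
    moreover have "s powr (p - 1) * s powr (1 - p) = 1"
      using assms(2) by (simp add: powr_add[symmetric])
    ultimately show ?case by (simp add: right_diff_distrib mult.assoc[symmetric])
  qed
  ultimately show ?thesis
    unfolding singular_left_def by (auto dest: Lim_transform_eventually)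
qed

lemma singular_right_affine:
  assumes "singular_right p d W" "s > 0"
  shows "singular_right p (t + d / s) (\<lambda>x. s powr (p - 1) * W (s * (x - t)))"
proof -
  have "singular_left p (- d) (\<lambda>x. - W (- x))"
    using assms(1) singular_left_reflect_iff[of p 0 d W] by simp
  from singular_left_affine[OF this assms(2), of "- t"]
  have "singular_left p (0 - (t + d / s)) (\<lambda>x. - (s powr (p - 1) * W (s * (0 - x - t))))"
    by (simp add: algebra_simps)
  then show ?thesis
    using singular_left_reflect_iff[of p 0 "t + d / s" "\<lambda>x. s powr (p - 1) * W (s * (x - t))"] by blast
qed

lemma nodal_affine:
  assumes "p > 1" "nodal p Q c d W" "s > 0"
  shows "nodal p (\<lambda>x. s powr p * Q (s * (x - t))) (t + c / s) (t + d / s) (\<lambda>x. s powr (p - 1) * W (s * (x - t)))"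
  using assms unfolding nodal_def by (auto intro: riccati_affine singular_left_affine singular_right_affine)

text \<open>Here \<open>K\<close> is the first eigenvalue of the density \<open>1\<close> on the
  unit interval; all constant comparison potentials are obtained from it by scaling.\<close>

lemma nodal_const_interval:
  assumes "p > 1" "nodal p (\<lambda>_. K) 0 1 Y" "a < b"
  shows "\<exists>Z. nodal p (\<lambda>_. K / (b - a) powr p) a b Z"
proof -
  have "nodal p (\<lambda>_. (1 / (b - a)) powr p * K) (a + 0 / (1 / (b - a))) (a + 1 / (1 / (b - a)))
     (\<lambda>x. (1 / (b - a)) powr (p - 1) * Y (1 / (b - a) * (x - a)))"
    using assms by (intro nodal_affine) auto
  then show ?thesis
    using assms(3) by (auto simp: powr_divide)
qed

text \<open>Scales to the doubled interval from \<open>a\<close> to \<open>2 * b - a\<close>, whose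
  midpoint is \<open>b\<close>. By symmetry the Riccati function vanishes there, and the doubled
  length contributes the factor \<open>2 powr p\<close>.\<close>

lemma half_nodal_const_interval:
  assumes "p > 1" "nodal p (\<lambda>_. K) 0 1 Y" "a < b"
  shows "\<exists>Z. half_nodal p (\<lambda>_. K / (b - a) powr p / 2 powr p) a b 0 Z"
proof -
  have "a < 2 * b - a" using assms(3) by simp
  from nodal_const_interval[OF assms(1,2) this] obtain Z where
    Z: "nodal p (\<lambda>_. K / (2 * b - a - a) powr p) a (2 * b - a) Z" by blast
  have "Z ((a + (2 * b - a)) / 2) = 0"
    by (rule nodal_symmetric_midpoint[OF assms(1) Z]) (use assms(3) in \<open>auto intro: co_countableI\<close>)
  then have "Z b = 0" by simp
  moreover have "(2 * b - a - a) powr p = 2 powr p * (b - a) powr p"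
    using powr_mult[of 2 "b - a" p] by (simp add: algebra_simps)
  ultimately show ?thesis
    using nodal_imp_half_nodal[OF Z, of b] assms(3) by (auto simp: mult.commute)
qed

text \<open>The comparison density is the constant \<open>L\<close> for which \<open>(a, b)\<close> is a nodal interval
  at the same eigenvalue \<open>\<mu>\<^sub>2\<close>; its first eigenfunction on the doubled interval is flat at \<open>b\<close>.\<close>

lemma half_nodal_increasing_density:
  assumes "p > 1" "K > 0" "nodal p (\<lambda>_. K) 0 1 Y" "a < b" "0 < \<mu>1" "\<mu>1 \<le> \<mu>2"
    and L: "\<mu>2 * L = K / (b - a) powr p"
    and W1: "half_nodal p (\<lambda>x. \<mu>1 * \<rho> x) a b \<alpha> W1" and W2: "nodal p (\<lambda>x. \<mu>2 * \<rho> x) a b W2"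
    and pos: "co_countable a b (\<lambda>x. \<rho> x > 0)"
    and e: "e \<in> {a..b}" "co_countable a e (\<lambda>x. \<rho> x \<le> L)" "co_countable e b (\<lambda>x. L \<le> \<rho> x)"
    and ratio: "\<mu>2 \<le> 2 powr p * \<mu>1"
  shows "\<alpha> \<le> 0" and "\<alpha> = 0 \<Longrightarrow> \<mu>2 = 2 powr p * \<mu>1 \<and> co_countable a b (\<lambda>x. \<rho> x = L)"
proof -
  obtain Z where Z: "nodal p (\<lambda>_. K / (b - a) powr p) a b Z"
    using nodal_const_interval[OF assms(1,3,4)] by blast
  obtain U where U: "half_nodal p (\<lambda>_. K / (b - a) powr p / 2 powr p) a b 0 U"
    using half_nodal_const_interval[OF assms(1,3,4)] by blast
  note Z = Z[folded L] and U = U[folded L]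
  have \<mu>2: "\<mu>2 > 0" using assms by simp
  have "L > 0"
    using L \<mu>2 assms(2,4) by (metis divide_pos_pos powr_gt_zero zero_less_mult_pos diff_gt_0_iff_gt less_irrefl)
  have two: "2 powr p > (1::real)" using assms(1) by simp
  have AB: "Z x \<le> W2 x" if "x \<in> {a<..<b}" for x
    by (rule nodal_le_of_crossing[OF assms(1) W2 Z e(1) _ _ that])
      (use e \<mu>2 in \<open>auto intro: co_countable_mono mult_left_mono\<close>)
  have QA: "co_countable a b (\<lambda>x. \<mu>1 * \<rho> x \<le> \<mu>2 * \<rho> x)"
    by (rule co_countable_mono[OF pos]) (use assms in auto)
  have QB: "co_countable a b (\<lambda>x. \<mu>2 * L / 2 powr p < \<mu>2 * L)"
    by (rule co_countableI) (use \<mu>2 \<open>L > 0\<close> two in \<open>simp add: divide_less_eq\<close>)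
  have k: "\<mu>1 / \<mu>2 > 0" using assms \<mu>2 by simp
  \<comment> \<open>With the weight \<open>\<mu>1 / \<mu>2\<close> the density cancels from the
    required inequality between potentials; this constant inequality, which is \<open>ratio\<close>
    times \<open>L\<close>, is what remains.\<close>
  have "\<mu>2 * L / 2 powr p \<le> \<mu>1 * L"
    using ratio \<open>L > 0\<close> two mult_right_mono[OF ratio, of L] by (simp add: divide_le_eq mult_ac)
  then have "\<mu>1 / \<mu>2 * (\<mu>2 * \<rho> x - \<mu>2 * L) \<le> \<mu>1 * \<rho> x - \<mu>2 * L / 2 powr p" for x
    using \<mu>2 by (simp add: right_diff_distrib)
  then have Q: "co_countable a b (\<lambda>x. \<mu>1 / \<mu>2 * (\<mu>2 * \<rho> x - \<mu>2 * L) \<le> \<mu>1 * \<rho> x - \<mu>2 * L / 2 powr p)"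
    by (intro co_countableI)
  note comp = half_nodal_comparison[OF assms(1) k assms(4) W1 U W2 Z AB QA QB Q]
  show "\<alpha> \<le> 0" by (rule comp)
  assume "\<alpha> = 0"
  then have eq: "co_countable a b (\<lambda>x. \<mu>2 * \<rho> x = \<mu>2 * L \<and> \<mu>1 * \<rho> x = \<mu>2 * L / 2 powr p)"
    by (intro comp(2)) simp_all
  then obtain x where "\<mu>2 * \<rho> x = \<mu>2 * L" "\<mu>1 * \<rho> x = \<mu>2 * L / 2 powr p"
    using assms(4) by (auto elim: co_countable_ex)
  then have "\<mu>1 * L = \<mu>2 * L / 2 powr p" using \<mu>2 by simp
  then have "\<mu>2 = 2 powr p * \<mu>1" using \<open>L > 0\<close> by (simp add: field_simps)
  moreover have "co_countable a b (\<lambda>x. \<rho> x = L)"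
    by (rule co_countable_mono[OF eq order_refl order_refl]) (use \<mu>2 in simp)
  ultimately show "\<mu>2 = 2 powr p * \<mu>1 \<and> co_countable a b (\<lambda>x. \<rho> x = L)" ..
qed

text \<open>The comparison of \<open>half_nodal_increasing_density\<close> with density and constant
  exchanged: \<open>U\<close> and \<open>Z\<close> now play the part of the first-named functions.
  The reversed \<open>ratio\<close> also supplies \<open>\<mu>1 < \<mu>2\<close>, hence the strict
  inequality demanded of the second-named potentials.\<close>

lemma half_nodal_decreasing_density:
  assumes "p > 1" "K > 0" "nodal p (\<lambda>_. K) 0 1 Y" "a < b" "0 < \<mu>1"
    and L: "\<mu>2 * L = K / (b - a) powr p"
    and W1: "half_nodal p (\<lambda>x. \<mu>1 * \<rho> x) a b \<alpha> W1" and W2: "nodal p (\<lambda>x. \<mu>2 * \<rho> x) a b W2"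
    and pos: "co_countable a b (\<lambda>x. \<rho> x > 0)"
    and e: "e \<in> {a..b}" "co_countable a e (\<lambda>x. L \<le> \<rho> x)" "co_countable e b (\<lambda>x. \<rho> x \<le> L)"
    and ratio: "2 powr p * \<mu>1 \<le> \<mu>2"
  shows "\<alpha> \<ge> 0" and "\<alpha> = 0 \<Longrightarrow> \<mu>2 = 2 powr p * \<mu>1 \<and> co_countable a b (\<lambda>x. \<rho> x = L)"
proof -
  obtain Z where Z: "nodal p (\<lambda>_. K / (b - a) powr p) a b Z"
    using nodal_const_interval[OF assms(1,3,4)] by blast
  obtain U where U: "half_nodal p (\<lambda>_. K / (b - a) powr p / 2 powr p) a b 0 U"
    using half_nodal_const_interval[OF assms(1,3,4)] by blast
  note Z = Z[folded L] and U = U[folded L]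
  have two: "2 powr p > (1::real)" using assms(1) by simp
  have lt: "\<mu>1 < \<mu>2"
    using mult_strict_right_mono[OF two \<open>0 < \<mu>1\<close>] ratio by simp
  then have \<mu>2: "\<mu>2 > 0" using assms by simp
  have "L > 0"
    using L \<mu>2 assms(2,4) by (metis divide_pos_pos powr_gt_zero zero_less_mult_pos diff_gt_0_iff_gt less_irrefl)
  have AB: "W2 x \<le> Z x" if "x \<in> {a<..<b}" for x
    by (rule nodal_le_of_crossing[OF assms(1) Z W2 e(1) _ _ that])
      (use e \<mu>2 in \<open>auto intro: co_countable_mono mult_left_mono\<close>)
  have QB: "co_countable a b (\<lambda>x. \<mu>1 * \<rho> x < \<mu>2 * \<rho> x)"
    by (rule co_countable_mono[OF pos]) (use lt in auto)
  have QA: "co_countable a b (\<lambda>x. \<mu>2 * L / 2 powr p \<le> \<mu>2 * L)"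
    by (rule co_countableI) (use \<mu>2 \<open>L > 0\<close> two in \<open>simp add: divide_le_eq\<close>)
  have k: "\<mu>1 / \<mu>2 > 0" using assms \<mu>2 by simp
  have "\<mu>1 * L \<le> \<mu>2 * L / 2 powr p"
    using ratio \<open>L > 0\<close> two mult_right_mono[OF ratio, of L] by (simp add: le_divide_eq mult_ac)
  then have "\<mu>1 / \<mu>2 * (\<mu>2 * L - \<mu>2 * \<rho> x) \<le> \<mu>2 * L / 2 powr p - \<mu>1 * \<rho> x" for x
    using \<mu>2 by (simp add: right_diff_distrib)
  then have Q: "co_countable a b (\<lambda>x. \<mu>1 / \<mu>2 * (\<mu>2 * L - \<mu>2 * \<rho> x) \<le> \<mu>2 * L / 2 powr p - \<mu>1 * \<rho> x)"
    by (intro co_countableI)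
  note comp = half_nodal_comparison[OF assms(1) k assms(4) U W1 Z W2 AB QA QB Q]
  show "0 \<le> \<alpha>" by (rule comp)
  assume "\<alpha> = 0"
  then have eq: "co_countable a b (\<lambda>x. \<mu>2 * L = \<mu>2 * \<rho> x \<and> \<mu>2 * L / 2 powr p = \<mu>1 * \<rho> x)"
    by (intro comp(2)) simp_all
  then obtain x where "\<mu>2 * L = \<mu>2 * \<rho> x" "\<mu>2 * L / 2 powr p = \<mu>1 * \<rho> x"
    using assms(4) by (auto elim: co_countable_ex)
  then have "\<mu>1 * L = \<mu>2 * L / 2 powr p" using \<mu>2 by simp
  then have "\<mu>2 = 2 powr p * \<mu>1" using \<open>L > 0\<close> by (simp add: field_simps)
  moreover have "co_countable a b (\<lambda>x. \<rho> x = L)"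
    by (rule co_countable_mono[OF eq order_refl order_refl]) (use \<mu>2 in simp)
  ultimately show "\<mu>2 = 2 powr p * \<mu>1 \<and> co_countable a b (\<lambda>x. \<rho> x = L)" ..
qed

section \<open>Ratio estimates for Riccati functions\<close>

lemma not_singular_right_of_tendsto:
  assumes "p > 1" "(W \<longlongrightarrow> l) (at_left d)"
  shows "\<not> singular_right p d W"
  using singular_right_at_bot[OF assms(1)] not_tendsto_and_filterlim_at_infinity[OF _ assms(2)]
    filterlim_at_bot_imp_at_infinity by fastforce

lemma not_singular_left_of_tendsto:
  assumes "p > 1" "(W \<longlongrightarrow> l) (at_right c)"
  shows "\<not> singular_left p c W"
  using singular_left_at_top[OF assms(1)] not_tendsto_and_filterlim_at_infinity[OF _ assms(2)]
    filterlim_at_top_imp_at_infinity by fastforce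

text \<open>Restricted to the smaller interval, \<open>A\<close> is singular at a shared end and
  continuous at an interior one. By \<open>sturm_rigid\<close> it is singular at both ends, and a
  function with a finite limit is not, so both ends are shared.\<close>

lemma nodal_subinterval_rigid:
  assumes "p > 1" "nodal p QA c' d' A" "nodal p QB c d B" "c' \<le> c" "c < d" "d \<le> d'"
    and le: "co_countable c d (\<lambda>x. QB x \<le> QA x)"
  shows "c' = c" "d' = d" "co_countable c d (\<lambda>x. QA x = QB x)"
proof -
  have contA: "continuous_on {c'<..<d'} A"
    using assms(2) by (auto simp: nodal_def intro: riccatiD(1))
  have limL: "(A \<longlongrightarrow> A c) (at_right c)" if "c' < c"
    using continuous_on_Ioo_tendsto(2)[OF contA, of c] assms that by auto
  have limR: "(A \<longlongrightarrow> A d) (at_left d)" if "d < d'"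
    using continuous_on_Ioo_tendsto(1)[OF contA, of d] assms that by auto
  have L: "regular_or_singular_left p c A"
    using assms(2,4) limL by (cases "c' = c") (auto simp: regular_or_singular_left_def nodal_def)
  have R: "regular_or_singular_right p d A"
    using assms(2,6) limR by (cases "d = d'") (auto simp: regular_or_singular_right_def nodal_def)
  have "riccati p QA c d A"
    using assms by (auto simp: nodal_def intro: riccati_subinterval)
  note rigid = sturm_rigid[OF assms(1,5) this _ le _ _ L R]
  show "co_countable c d (\<lambda>x. QA x = QB x)"
    using assms(3) by (intro rigid(3)) (auto simp: nodal_def)
  have "singular_left p c A" "singular_right p d A"
    using assms(3) rigid(1,2) by (auto simp: nodal_def)
  then show "c' = c" "d' = d"
    using not_singular_left_of_tendsto[OF assms(1) limL] not_singular_right_of_tendsto[OF assms(1) limR]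
      assms(4,6) by (auto simp: order_less_le)
qed

lemma nodal_subinterval_less:
  assumes "p > 1" "nodal p (\<lambda>x. \<mu> * \<rho> x) c' d' A" "nodal p (\<lambda>x. \<nu> * \<rho> x) c d B"
    and "c' \<le> c" "c < d" "d \<le> d'" "c' \<noteq> c \<or> d' \<noteq> d"
    and pos: "co_countable c d (\<lambda>x. \<rho> x > 0)"
  shows "\<mu> < \<nu>"
proof (rule ccontr)
  assume "\<not> \<mu> < \<nu>"
  then have "co_countable c d (\<lambda>x. \<nu> * \<rho> x \<le> \<mu> * \<rho> x)"
    by (intro co_countable_mono[OF pos order_refl order_refl]) auto
  from nodal_subinterval_rigid[OF assms(1-6) this] assms(7) show False by auto
qed

lemma nodal_same_interval:
  assumes "p > 1" "nodal p (\<lambda>x. \<mu> * \<rho> x) c d A" "nodal p (\<lambda>x. \<nu> * \<rho> x) c d B" "c < d"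
    and pos: "co_countable c d (\<lambda>x. \<rho> x > 0)"
  shows "\<mu> = \<nu>"
proof -
  have *: "\<mu> = \<nu>" if "nodal p (\<lambda>x. \<mu> * \<rho> x) c d A" "nodal p (\<lambda>x. \<nu> * \<rho> x) c d B" "\<nu> \<le> \<mu>" for \<mu> \<nu> A B
  proof -
    have "co_countable c d (\<lambda>x. \<nu> * \<rho> x \<le> \<mu> * \<rho> x)"
      by (intro co_countable_mono[OF pos order_refl order_refl]) (use that in auto)
    from nodal_subinterval_rigid(3)[OF assms(1) that(1,2) order_refl assms(4) order_refl this]
    have "co_countable c d (\<lambda>x. \<mu> * \<rho> x = \<nu> * \<rho> x)" .
    then obtain x where "\<mu> * \<rho> x = \<nu> * \<rho> x \<and> \<rho> x > 0"
      by (rule co_countable_ex[OF co_countable_conj[OF _ pos] assms(4)])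
    then show ?thesis by auto
  qed
  show ?thesis
    using *[OF assms(2,3)] *[OF assms(3,2)] by linarith
qed

section \<open>Barriers, wells and steps with given nodal functions\<close>

lemma mono_crossing:
  fixes f :: "real \<Rightarrow> real"
  assumes "u \<le> v" "\<And>x y. u < x \<Longrightarrow> x \<le> y \<Longrightarrow> y < v \<Longrightarrow> f x \<le> f y"
  shows "\<exists>e\<in>{u..v}. co_countable u e (\<lambda>x. f x \<le> L) \<and> co_countable e v (\<lambda>x. L \<le> f x)"
proof -
  \<comment> \<open>The point \<open>u\<close> keeps the set nonempty when \<open>f\<close> exceeds
    \<open>L\<close> throughout; the crossing is then at \<open>u\<close>.\<close>
  define T where "T = insert u {x \<in> {u<..<v}. f x \<le> L}"
  define e where "e = Sup T"
  have bdd: "bdd_above T" by (rule bdd_aboveI[of _ v]) (use assms(1) in \<open>auto simp: T_def\<close>)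
  have "u \<le> e" unfolding e_def by (rule cSup_upper[OF _ bdd]) (simp add: T_def)
  moreover have "e \<le> v" unfolding e_def by (rule cSup_least) (use assms(1) in \<open>auto simp: T_def\<close>)
  moreover have "f x \<le> L" if "x \<in> {u<..<e}" for x
  proof -
    have "x < Sup T" "T \<noteq> {}" using that by (simp_all add: e_def T_def)
    then obtain y where "y \<in> T" "x < y"
      using less_cSupD by blast
    then show ?thesis using assms(2)[of x y] that by (auto simp: T_def)
  qed
  moreover have "L \<le> f x" if "x \<in> {e<..<v}" for x
  proof (rule ccontr)
    assume "\<not> L \<le> f x"
    then have "x \<in> T" using that \<open>u \<le> e\<close> by (auto simp: T_def)
    then show False using cSup_upper[OF _ bdd] that by (fastforce simp: e_def)
  qed
  ultimately show ?thesis by (intro bexI[of _ e]) (auto intro: co_countableI)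
qed

lemma antimono_crossing:
  fixes f :: "real \<Rightarrow> real"
  assumes "u \<le> v" "\<And>x y. u < x \<Longrightarrow> x \<le> y \<Longrightarrow> y < v \<Longrightarrow> f y \<le> f x"
  shows "\<exists>e\<in>{u..v}. co_countable u e (\<lambda>x. L \<le> f x) \<and> co_countable e v (\<lambda>x. f x \<le> L)"
  using mono_crossing[OF assms(1), of "\<lambda>x. - f x" "- L"] assms(2) by simp

text \<open>The node is taken in the left half. On \<open>{0<..<z}\<close> the density increases and
  crosses \<open>L\<close> once; the interval from \<open>z\<close> to \<open>H\<close>, reflected,
  contains the peak and needs an extra argument. The two sides give \<open>W1 z \<le> 0\<close> and
  \<open>- W1 z \<le> 0\<close>, so both rigidity cases apply.\<close>

lemma barrier_ratio_aux:
  assumes "p > 1" "K > 0" "nodal p (\<lambda>_. K) 0 1 Y" "0 < z" "z \<le> H / 2" "0 < \<mu>1"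
    and W1: "nodal p (\<lambda>x. \<mu>1 * \<rho> x) 0 H W1"
    and W2: "nodal p (\<lambda>x. \<mu>2 * \<rho> x) 0 z W2" and W2': "nodal p (\<lambda>x. \<mu>2 * \<rho> x) z H W2'"
    and pos: "co_countable 0 H (\<lambda>x. \<rho> x > 0)"
    and inc: "\<And>x y. 0 < x \<Longrightarrow> x \<le> y \<Longrightarrow> y < H / 2 \<Longrightarrow> \<rho> x \<le> \<rho> y"
    and dec: "\<And>x y. H / 2 < x \<Longrightarrow> x \<le> y \<Longrightarrow> y < H \<Longrightarrow> \<rho> y \<le> \<rho> x"
    and ratio: "\<mu>2 \<le> 2 powr p * \<mu>1"
  shows "\<mu>2 = 2 powr p * \<mu>1 \<and> (\<exists>c. co_countable 0 H (\<lambda>x. \<rho> x = c))"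
proof -
  have zH: "z < H" using assms(4,5) by simp
  have pos_left: "co_countable 0 z (\<lambda>x. \<rho> x > 0)"
    by (rule co_countable_mono[OF pos]) (use zH in auto)
  have lt: "\<mu>1 < \<mu>2"
    by (rule nodal_subinterval_less[OF assms(1) W1 W2 _ _ _ _ pos_left]) (use assms(4) zH in auto)
  then have \<mu>2: "\<mu>2 > 0" using assms(6) by simp
  define L where "L = K / (z - 0) powr p / \<mu>2"
  define L' where "L' = K / (H - z - 0) powr p / \<mu>2"
  have L: "\<mu>2 * L = K / (z - 0) powr p" and L': "\<mu>2 * L' = K / (H - z - 0) powr p"
    using \<mu>2 by (simp_all add: L_def L'_def)
  have "L' \<le> L"
    unfolding L_def L'_def using assms(1,2,4,5) \<mu>2
    by (intro divide_right_mono divide_left_mono powr_mono2 mult_pos_pos) auto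
  have half1: "half_nodal p (\<lambda>x. \<mu>1 * \<rho> x) 0 z (W1 z) W1"
    by (rule nodal_imp_half_nodal[OF W1]) (use assms(4) zH in auto)
  obtain e where e: "e \<in> {0..z}" "co_countable 0 e (\<lambda>x. \<rho> x \<le> L)" "co_countable e z (\<lambda>x. L \<le> \<rho> x)"
    using mono_crossing[of 0 z \<rho> L] inc assms(4,5) by auto
  note left = half_nodal_increasing_density[OF assms(1-4,6) less_imp_le[OF lt] L half1 W2 pos_left e ratio]
  \<comment> \<open>Otherwise monotonicity would keep the density strictly below \<open>L\<close> on
    the whole first nodal interval, which is also nodal for the constant \<open>L\<close>.\<close>
  have ge: "L \<le> \<rho> x" if x: "x \<in> {z<..<H / 2}" for x
  proof (rule ccontr)
    assume "\<not> L \<le> \<rho> x"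
    then have less: "\<rho> y < L" if "y \<in> {0<..<z}" for y
      using inc[of y x] that x by auto
    obtain Z where Z: "nodal p (\<lambda>_. K / (z - 0) powr p) 0 z Z"
      using nodal_const_interval[OF assms(1,3,4)] by blast
    have "co_countable 0 z (\<lambda>x. \<mu>2 * L = \<mu>2 * \<rho> x)"
      by (rule nodal_subinterval_rigid(3)[OF assms(1) Z[folded L] W2])
        (use assms(4) \<mu>2 less in \<open>auto intro!: co_countableI simp: less_imp_le\<close>)
    from co_countable_ex[OF this assms(4)] less \<mu>2 show False by auto
  qed
  let ?\<rho> = "\<lambda>x. \<rho> (H - x)" and ?W1 = "\<lambda>x. - W1 (H - x)"
  have "nodal p (\<lambda>x. \<mu>1 * ?\<rho> x) (H - H) (H - 0) ?W1"
    by (rule nodal_reflect[OF W1])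
  then have "half_nodal p (\<lambda>x. \<mu>1 * ?\<rho> x) (H - H) (H - z) (?W1 (H - z)) ?W1"
    by (rule nodal_imp_half_nodal) (use assms(4) zH in auto)
  then have half1': "half_nodal p (\<lambda>x. \<mu>1 * ?\<rho> x) 0 (H - z) (- W1 z) ?W1" by simp
  have nodal2': "nodal p (\<lambda>x. \<mu>2 * ?\<rho> x) 0 (H - z) (\<lambda>x. - W2' (H - x))"
    using nodal_reflect[OF W2', of H] by simp
  have pos': "co_countable 0 (H - z) (\<lambda>x. ?\<rho> x > 0)"
    using co_countable_mono[OF co_countable_reflect[OF pos, of H], of 0 "H - z"] assms(4) by simp
  obtain e' where e': "e' \<in> {0..H / 2}" "co_countable 0 e' (\<lambda>x. ?\<rho> x \<le> L')"
      "co_countable e' (H / 2) (\<lambda>x. L' \<le> ?\<rho> x)"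
    using mono_crossing[of 0 "H / 2" ?\<rho> L'] dec assms(4,5) by (auto simp: field_simps)
  \<comment> \<open>Past the peak the reflected density decreases, and a second crossing is excluded
    by \<open>ge\<close> and \<open>L' \<le> L\<close>; the latter holds because the second nodal
    interval is at least as long as the first.\<close>
  have "co_countable (H / 2) (H - z) (\<lambda>x. L' \<le> ?\<rho> x)"
    using ge \<open>L' \<le> L\<close> by (intro co_countableI) (force simp: field_simps intro: order_trans)
  with e' have e'': "e' \<in> {0..H - z}" "co_countable 0 e' (\<lambda>x. ?\<rho> x \<le> L')"
      "co_countable e' (H - z) (\<lambda>x. L' \<le> ?\<rho> x)"
    using assms(5) co_countable_split by auto
  have "0 < H - z" using zH by simp
  note right = half_nodal_increasing_density[OF assms(1-3) this assms(6) less_imp_le[OF lt] L' half1' nodal2' pos' e'' ratio]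
  have "W1 z = 0" using left(1) right(1) by simp
  then have eq: "\<mu>2 = 2 powr p * \<mu>1" and cl: "co_countable 0 z (\<lambda>x. \<rho> x = L)"
    and "co_countable 0 (H - z) (\<lambda>x. ?\<rho> x = L')"
    using left(2) right(2) by auto
  from co_countable_reflect[OF this(3), of H] have cr: "co_countable z H (\<lambda>x. \<rho> x = L')" by simp
  \<comment> \<open>The two constants come from different sides of \<open>z\<close>. If
    \<open>z\<close> is left of the midpoint, the density is \<open>L'\<close> on
    \<open>{z<..<H / 2}\<close> and at least \<open>L\<close> there.\<close>
  have "L = L'"
  proof (cases "z = H / 2")
    case True
    then have "H - z = z" by simp
    then show ?thesis by (simp add: L_def L'_def)
  next
    case False
    have "co_countable z (H / 2) (\<lambda>x. \<rho> x = L')"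
      by (rule co_countable_mono[OF cr]) (use zH assms(4) in auto)
    moreover have "z < H / 2" using False assms(5) by simp
    ultimately obtain x where "x \<in> {z<..<H / 2}" "\<rho> x = L'" by (rule co_countable_ex)
    then show ?thesis using \<open>L' \<le> L\<close> ge[of x] by simp
  qed
  then have "co_countable 0 H (\<lambda>x. \<rho> x = L)"
    using co_countable_split[OF cl, of H] cr by simp
  then show ?thesis using eq by blast
qed

lemma barrier_ratio:
  assumes "p > 1" "K > 0" "nodal p (\<lambda>_. K) 0 1 Y" "z \<in> {0<..<H}" "0 < \<mu>1"
    and W1: "nodal p (\<lambda>x. \<mu>1 * \<rho> x) 0 H W1"
    and W2: "nodal p (\<lambda>x. \<mu>2 * \<rho> x) 0 z W2" and W2': "nodal p (\<lambda>x. \<mu>2 * \<rho> x) z H W2'"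
    and pos: "co_countable 0 H (\<lambda>x. \<rho> x > 0)"
    and inc: "\<And>x y. 0 < x \<Longrightarrow> x \<le> y \<Longrightarrow> y < H / 2 \<Longrightarrow> \<rho> x \<le> \<rho> y"
    and dec: "\<And>x y. H / 2 < x \<Longrightarrow> x \<le> y \<Longrightarrow> y < H \<Longrightarrow> \<rho> y \<le> \<rho> x"
    and ratio: "\<mu>2 \<le> 2 powr p * \<mu>1"
  shows "\<mu>2 = 2 powr p * \<mu>1 \<and> (\<exists>c. co_countable 0 H (\<lambda>x. \<rho> x = c))"
proof (cases "z \<le> H / 2")
  case True
  then show ?thesis
    using assms by (intro barrier_ratio_aux[OF assms(1-3) _ True assms(5) W1 W2 W2' pos inc dec ratio]) auto
next
  case False
  let ?\<rho> = "\<lambda>x. \<rho> (H - x)"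
  have r: "nodal p (\<lambda>x. \<mu>1 * ?\<rho> x) 0 H (\<lambda>x. - W1 (H - x))"
    "nodal p (\<lambda>x. \<mu>2 * ?\<rho> x) 0 (H - z) (\<lambda>x. - W2' (H - x))"
    "nodal p (\<lambda>x. \<mu>2 * ?\<rho> x) (H - z) H (\<lambda>x. - W2 (H - x))"
    "co_countable 0 H (\<lambda>x. ?\<rho> x > 0)"
    using nodal_reflect[OF W1, of H] nodal_reflect[OF W2, of H] nodal_reflect[OF W2', of H]
      co_countable_reflect[OF pos, of H] by simp_all
  have "\<mu>2 = 2 powr p * \<mu>1 \<and> (\<exists>c. co_countable 0 H (\<lambda>x. ?\<rho> x = c))"
    by (rule barrier_ratio_aux[OF assms(1-3) _ _ assms(5) r _ _ ratio])
      (use False assms(4) inc dec in \<open>auto simp: field_simps\<close>)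
  moreover have "co_countable 0 H (\<lambda>x. \<rho> x = c)" if "co_countable 0 H (\<lambda>x. ?\<rho> x = c)" for c
    using co_countable_reflect[OF that, of H] by simp
  ultimately show ?thesis by blast
qed

text \<open>After reflection \<open>{0<..<H - z}\<close> is a nodal interval at the same eigenvalue,
  and by symmetry for the same potential. It and \<open>{0<..<z}\<close> start at the same point, so
  one contains the other and rigidity makes them equal.\<close>

lemma symmetric_node_midpoint:
  assumes "p > 1" "z \<in> {0<..<H}"
    and W2: "nodal p (\<lambda>x. \<mu> * \<rho> x) 0 z W" and W2': "nodal p (\<lambda>x. \<mu> * \<rho> x) z H W'"
    and pos: "co_countable 0 H (\<lambda>x. \<rho> x > 0)"
    and sym: "\<And>x. x \<in> {0..H} \<Longrightarrow> \<rho> (H - x) = \<rho> x"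
  shows "z = H / 2"
proof -
  have V: "nodal p (\<lambda>x. \<mu> * \<rho> (H - x)) 0 (H - z) (\<lambda>x. - W' (H - x))"
    using nodal_reflect[OF W2', of H] by simp
  have le: "co_countable 0 c (\<lambda>x. \<mu> * \<rho> x \<le> \<mu> * \<rho> (H - x))" "co_countable 0 c (\<lambda>x. \<mu> * \<rho> (H - x) \<le> \<mu> * \<rho> x)"
    if "c \<le> H" for c
    using sym that by (auto intro!: co_countableI)
  show ?thesis
  proof (cases "z \<le> H / 2")
    case True
    then show ?thesis
      using nodal_subinterval_rigid(2)[OF assms(1) V W2 _ _ _ le(1)] assms(2) by auto
  next
    case False
    then show ?thesis
      using nodal_subinterval_rigid(2)[OF assms(1) W2 V _ _ _ le(2)] assms(2) by auto
  qed
qed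

text \<open>Symmetry puts the node at the midpoint and makes the first eigenfunction flat there. The
  boundary value is thus \<open>0\<close> from the start, and the left half alone already gives the
  rigidity case.\<close>

lemma well_ratio:
  assumes "p > 1" "K > 0" "nodal p (\<lambda>_. K) 0 1 Y" "z \<in> {0<..<H}" "0 < \<mu>1"
    and W1: "nodal p (\<lambda>x. \<mu>1 * \<rho> x) 0 H W1"
    and W2: "nodal p (\<lambda>x. \<mu>2 * \<rho> x) 0 z W2" and W2': "nodal p (\<lambda>x. \<mu>2 * \<rho> x) z H W2'"
    and pos: "co_countable 0 H (\<lambda>x. \<rho> x > 0)"
    and dec: "\<And>x y. 0 < x \<Longrightarrow> x \<le> y \<Longrightarrow> y < H / 2 \<Longrightarrow> \<rho> y \<le> \<rho> x"
    and sym: "\<And>x. x \<in> {0..H} \<Longrightarrow> \<rho> (H - x) = \<rho> x"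
    and ratio: "2 powr p * \<mu>1 \<le> \<mu>2"
  shows "\<mu>2 = 2 powr p * \<mu>1 \<and> (\<exists>c. co_countable 0 H (\<lambda>x. \<rho> x = c))"
proof -
  have H: "H > 0" using assms(4) by simp
  have z: "z = H / 2"
    by (rule symmetric_node_midpoint[OF assms(1,4) W2 W2' pos sym])
  have "0 < 2 powr p * \<mu>1" using assms(5) by simp
  then have \<mu>2: "\<mu>2 > 0" using ratio by simp
  have "W1 ((0 + H) / 2) = 0"
    by (rule nodal_symmetric_midpoint[OF assms(1) W1]) (use H sym in \<open>auto intro!: co_countableI\<close>)
  moreover have "half_nodal p (\<lambda>x. \<mu>1 * \<rho> x) 0 (H / 2) (W1 (H / 2)) W1"
    by (rule nodal_imp_half_nodal[OF W1]) (use H in auto)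
  ultimately have half: "half_nodal p (\<lambda>x. \<mu>1 * \<rho> x) 0 (H / 2) 0 W1" by simp
  define L where "L = K / (H / 2 - 0) powr p / \<mu>2"
  have L: "\<mu>2 * L = K / (H / 2 - 0) powr p" using \<mu>2 by (simp add: L_def)
  obtain e where e: "e \<in> {0..H / 2}" "co_countable 0 e (\<lambda>x. L \<le> \<rho> x)" "co_countable e (H / 2) (\<lambda>x. \<rho> x \<le> L)"
    using antimono_crossing[of 0 "H / 2" \<rho> L] dec H by auto
  have pos': "co_countable 0 (H / 2) (\<lambda>x. \<rho> x > 0)"
    by (rule co_countable_mono[OF pos]) (use H in auto)
  have H2: "0 < H / 2" using H by simp
  have *: "\<mu>2 = 2 powr p * \<mu>1" "co_countable 0 (H / 2) (\<lambda>x. \<rho> x = L)"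
    using half_nodal_decreasing_density(2)[OF assms(1-3) H2 assms(5) L half W2[unfolded z] pos' e ratio]
    by auto
  have "co_countable (H / 2) H (\<lambda>x. \<rho> (H - x) = L)"
    using co_countable_reflect[OF *(2), of H] by simp
  then have "co_countable (H / 2) H (\<lambda>x. \<rho> x = L)"
    by (rule co_countable_mono) (use sym H in auto)
  then show ?thesis using * co_countable_split by blast
qed

text \<open>If the jump lies inside \<open>{0<..<z}\<close>, both nodal intervals have a downward
  crossing: the reflected right one carries a constant density. They give
  \<open>W1 z \<ge> 0\<close> and \<open>- W1 z \<ge> 0\<close>, while \<open>W1 z = 0\<close> would
  force a constant density across the jump.\<close>

lemma step_ratio:
  assumes "p > 1" "K > 0" "nodal p (\<lambda>_. K) 0 1 Y" "z \<in> {0<..<H}" "0 < \<mu>1" "0 < \<mu>2"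
    and W1: "nodal p (\<lambda>x. \<mu>1 * \<rho> x) 0 H W1"
    and W2: "nodal p (\<lambda>x. \<mu>2 * \<rho> x) 0 z W2" and W2': "nodal p (\<lambda>x. \<mu>2 * \<rho> x) z H W2'"
    and b: "0 < b" "b < H" and M: "1 < M" "M * b powr p < (H - b) powr p"
    and \<rho>: "\<And>x. x \<in> {0<..<b} \<Longrightarrow> \<rho> x = M" "\<And>x. x \<in> {b<..<H} \<Longrightarrow> \<rho> x = 1"
  shows "\<mu>2 < 2 powr p * \<mu>1"
proof (rule ccontr)
  assume "\<not> \<mu>2 < 2 powr p * \<mu>1"
  then have ratio: "2 powr p * \<mu>1 \<le> \<mu>2" by simp
  have z0: "0 < z" and zH: "0 < H - z" "z < H" using assms(4) by auto
  obtain Z where Z: "nodal p (\<lambda>_. K / (z - 0) powr p) 0 z Z"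
    using nodal_const_interval[OF assms(1,3) z0] by blast
  \<comment> \<open>If \<open>z \<le> b\<close>, the first interval carries the constant
    \<open>M\<close>, so \<open>K = \<mu>2 * M * z powr p\<close>, and density at least
    \<open>1\<close> on the second gives \<open>\<mu>2 * (H - z) powr p \<le> K\<close>. Then
    \<open>(H - z) powr p \<le> M * z powr p\<close>, which the bound on \<open>M\<close>
    excludes.\<close>
  have "b < z"
  proof (rule ccontr)
    assume "\<not> b < z"
    then have zb: "z \<le> b" by simp
    have "co_countable 0 z (\<lambda>x. K / (z - 0) powr p = \<mu>2 * M)"
    proof -
      have eqM: "co_countable 0 z (\<lambda>x. \<mu>2 * \<rho> x = \<mu>2 * M)"
        using \<rho>(1) zb by (intro co_countableI) auto
      show ?thesis
      proof (cases "\<mu>2 * M \<le> K / (z - 0) powr p")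
        case True
        have "co_countable 0 z (\<lambda>x. \<mu>2 * \<rho> x \<le> K / (z - 0) powr p)"
          by (rule co_countable_mono[OF eqM]) (use True in auto)
        from nodal_subinterval_rigid(3)[OF assms(1) Z W2 order_refl z0 order_refl this]
        show ?thesis by (rule co_countable_elim[OF _ eqM]) simp
      next
        case False
        have "co_countable 0 z (\<lambda>x. K / (z - 0) powr p \<le> \<mu>2 * \<rho> x)"
          by (rule co_countable_mono[OF eqM]) (use False in auto)
        from nodal_subinterval_rigid(3)[OF assms(1) W2 Z order_refl z0 order_refl this]
        show ?thesis by (rule co_countable_elim[OF _ eqM]) simp
      qed
    qed
    then have K: "K = \<mu>2 * M * z powr p"
      using z0 by (auto elim!: co_countable_ex simp: field_simps)
    obtain Z' where Z': "nodal p (\<lambda>_. K / (H - z) powr p) z H Z'"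
      using nodal_const_interval[OF assms(1,3) zH(2)] by blast
    have \<rho>1: "co_countable z H (\<lambda>x. 1 \<le> \<rho> x)"
    proof (rule co_countable_split[of z b])
      show "co_countable z b (\<lambda>x. 1 \<le> \<rho> x)" "co_countable b H (\<lambda>x. 1 \<le> \<rho> x)"
        using \<rho> M(1) z0 by (auto intro!: co_countableI)
    qed
    have "\<mu>2 \<le> K / (H - z) powr p"
    proof (rule ccontr)
      assume less: "\<not> \<mu>2 \<le> K / (H - z) powr p"
      have ge: "\<mu>2 * \<rho> x \<ge> \<mu>2" if "1 \<le> \<rho> x" for x
        using that assms(6) by (simp add: mult_le_cancel_left1)
      have "co_countable z H (\<lambda>x. K / (H - z) powr p \<le> \<mu>2 * \<rho> x)"
        by (rule co_countable_mono[OF \<rho>1 order_refl order_refl]) (use ge less in fastforce)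
      from nodal_subinterval_rigid(3)[OF assms(1) W2' Z' order_refl zH(2) order_refl this]
      obtain x where "1 \<le> \<rho> x" "\<mu>2 * \<rho> x = K / (H - z) powr p"
        using co_countable_ex[OF co_countable_conj[OF \<rho>1] zH(2)] by blast
      then show False using ge[of x] less by simp
    qed
    then have "\<mu>2 * (H - z) powr p \<le> \<mu>2 * (M * z powr p)"
      unfolding K using zH by (simp add: field_simps)
    then have "(H - z) powr p \<le> M * z powr p" using assms(6) by simp
    also have "\<dots> \<le> M * b powr p"
      using zb z0 M(1) assms(1) by (intro mult_left_mono powr_mono2) auto
    also have "\<dots> < (H - b) powr p" by (rule M)
    also have "\<dots> \<le> (H - z) powr p"
      using zb b assms(1) by (intro powr_mono2) auto
    finally show False by simp
  qed
  have anti: "co_countable 0 z (\<lambda>x. \<rho> x > 0)" "co_countable 0 (H - z) (\<lambda>x. \<rho> (H - x) > 0)"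
  proof (rule co_countable_split[of 0 b])
    show "co_countable 0 b (\<lambda>x. \<rho> x > 0)" "co_countable b z (\<lambda>x. \<rho> x > 0)"
      using \<rho> M(1) zH by (auto intro!: co_countableI)
    show "co_countable 0 (H - z) (\<lambda>x. \<rho> (H - x) > 0)"
      using \<rho>(2) \<open>b < z\<close> by (auto intro!: co_countableI)
  qed
  define L where "L = K / (z - 0) powr p / \<mu>2"
  define L' where "L' = K / (H - z - 0) powr p / \<mu>2"
  have L: "\<mu>2 * L = K / (z - 0) powr p" and L': "\<mu>2 * L' = K / (H - z - 0) powr p"
    using assms(6) by (simp_all add: L_def L'_def)
  have half1: "half_nodal p (\<lambda>x. \<mu>1 * \<rho> x) 0 z (W1 z) W1"
    by (rule nodal_imp_half_nodal[OF W1]) (use assms(4) in auto)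
  \<comment> \<open>The value of the density at \<open>b\<close> is unspecified; this copy is
    monotone, so a crossing point exists, and it agrees off \<open>b\<close>.\<close>
  define \<rho>' where "\<rho>' x = (if x < b then M else 1)" for x
  have \<rho>': "co_countable 0 z (\<lambda>x. \<rho> x = \<rho>' x)"
  proof (rule co_countable_split[of 0 b])
    show "co_countable 0 b (\<lambda>x. \<rho> x = \<rho>' x)" "co_countable b z (\<lambda>x. \<rho> x = \<rho>' x)"
      using \<rho> zH by (auto intro!: co_countableI simp: \<rho>'_def)
  qed
  obtain e where e: "e \<in> {0..z}" "co_countable 0 e (\<lambda>x. L \<le> \<rho>' x)" "co_countable e z (\<lambda>x. \<rho>' x \<le> L)"
  proof -
    have "\<rho>' y \<le> \<rho>' x" if "x \<le> y" for x y
      using that M(1) by (auto simp: \<rho>'_def)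
    then show thesis
      using antimono_crossing[of 0 z \<rho>' L] z0 that by auto
  qed
  have e1: "co_countable 0 e (\<lambda>x. L \<le> \<rho> x)"
    by (rule co_countable_elim[OF e(2) co_countable_mono[OF \<rho>', where Q = "\<lambda>x. \<rho> x = \<rho>' x"]])
      (use e(1) in auto)
  have e2: "co_countable e z (\<lambda>x. \<rho> x \<le> L)"
    by (rule co_countable_elim[OF e(3) co_countable_mono[OF \<rho>', where Q = "\<lambda>x. \<rho> x = \<rho>' x"]])
      (use e(1) in auto)
  note left = half_nodal_decreasing_density[OF assms(1-3) z0 assms(5) L half1 W2 anti(1) e(1) e1 e2 ratio]
  have "W1 z \<noteq> 0"
  proof
    assume "W1 z = 0"
    then have c: "co_countable 0 z (\<lambda>x. \<rho> x = L)" using left(2) by simp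
    have "co_countable 0 b (\<lambda>x. \<rho> x = L)"
      by (rule co_countable_mono[OF c]) (use \<open>b < z\<close> in auto)
    then obtain x where x: "x \<in> {0<..<b}" "\<rho> x = L"
      using b(1) by (rule co_countable_ex)
    have "co_countable b z (\<lambda>x. \<rho> x = L)"
      by (rule co_countable_mono[OF c]) (use b in auto)
    then obtain y where y: "y \<in> {b<..<z}" "\<rho> y = L"
      using \<open>b < z\<close> by (rule co_countable_ex)
    show False using \<rho>(1)[OF x(1)] \<rho>(2)[of y] x y M(1) zH by auto
  qed
  let ?\<rho> = "\<lambda>x. \<rho> (H - x)" and ?W1 = "\<lambda>x. - W1 (H - x)"
  have "nodal p (\<lambda>x. \<mu>1 * ?\<rho> x) (H - H) (H - 0) ?W1"
    by (rule nodal_reflect[OF W1])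
  then have "half_nodal p (\<lambda>x. \<mu>1 * ?\<rho> x) (H - H) (H - z) (?W1 (H - z)) ?W1"
    by (rule nodal_imp_half_nodal) (use assms(4) in auto)
  then have half1': "half_nodal p (\<lambda>x. \<mu>1 * ?\<rho> x) 0 (H - z) (- W1 z) ?W1" by simp
  have nodal2': "nodal p (\<lambda>x. \<mu>2 * ?\<rho> x) 0 (H - z) (\<lambda>x. - W2' (H - x))"
    using nodal_reflect[OF W2', of H] by simp
  obtain e' where e': "e' \<in> {0..H - z}" "co_countable 0 e' (\<lambda>x. L' \<le> ?\<rho> x)"
      "co_countable e' (H - z) (\<lambda>x. ?\<rho> x \<le> L')"
    using antimono_crossing[of 0 "H - z" ?\<rho> L'] \<rho>(2) \<open>b < z\<close> zH by auto
  have "- W1 z \<ge> 0"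
    by (rule half_nodal_decreasing_density(1)[OF assms(1-3) zH(1) assms(5) L' half1' nodal2' anti(2) e' ratio])
  then show False using left(1) \<open>W1 z \<noteq> 0\<close> by simp
qed

section \<open>From solutions to Riccati functions\<close>

text \<open>The equation as a first-order system: \<phi> is the signed power of the derivative of
  \<open>y\<close>. The first equation holds at every point, since its right-hand side is
  continuous; the second inherits the discontinuities of \<open>Q\<close>.\<close>

definition regular_sol :: "real \<Rightarrow> (real \<Rightarrow> real) \<Rightarrow> real \<Rightarrow> real \<Rightarrow> (real \<Rightarrow> real) \<Rightarrow> (real \<Rightarrow> real) \<Rightarrow> bool" where
  "regular_sol p Q a b y \<phi> \<longleftrightarrow>
     (\<forall>x\<in>{a..b}. (y has_real_derivative signed_pow (p / (p - 1)) (\<phi> x)) (at x within {a..b})) \<and>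
     continuous_on {a..b} \<phi> \<and>
     co_countable a b (\<lambda>x. (\<phi> has_real_derivative - (p - 1) * Q x * signed_pow p (y x)) (at x))"

lemma regular_solD:
  assumes "regular_sol p Q a b y \<phi>"
  shows "\<And>x. x \<in> {a..b} \<Longrightarrow> (y has_real_derivative signed_pow (p / (p - 1)) (\<phi> x)) (at x within {a..b})"
    and "\<And>x. x \<in> {a<..<b} \<Longrightarrow> (y has_real_derivative signed_pow (p / (p - 1)) (\<phi> x)) (at x)"
    and "continuous_on {a..b} \<phi>" "continuous_on {a..b} y"
    and "co_countable a b (\<lambda>x. (\<phi> has_real_derivative - (p - 1) * Q x * signed_pow p (y x)) (at x))"
proof -
  show d: "\<And>x. x \<in> {a..b} \<Longrightarrow> (y has_real_derivative signed_pow (p / (p - 1)) (\<phi> x)) (at x within {a..b})"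
    using assms by (auto simp: regular_sol_def)
  show "(y has_real_derivative signed_pow (p / (p - 1)) (\<phi> x)) (at x)" if "x \<in> {a<..<b}" for x
    using d[of x] that at_within_Icc_at[of a x b] by auto
  show "continuous_on {a..b} y"
    using d by (meson DERIV_continuous continuous_on_eq_continuous_within)
qed (use assms in \<open>auto simp: regular_sol_def\<close>)

lemma regular_sol_reflect:
  assumes "regular_sol p Q a b y \<phi>"
  shows "regular_sol p (\<lambda>x. Q (r - x)) (r - b) (r - a) (\<lambda>x. y (r - x)) (\<lambda>x. - \<phi> (r - x))"
  unfolding regular_sol_def
proof (intro conjI ballI)
  fix x assume x: "x \<in> {r - b..r - a}"
  have img: "(\<lambda>x. r - x) ` {r - b..r - a} = {a..b}" by simp
  have "((\<lambda>x. r - x) has_real_derivative - 1) (at x within {r - b..r - a})"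
    by (auto intro!: derivative_eq_intros)
  moreover have "(y has_real_derivative signed_pow (p / (p - 1)) (\<phi> (r - x)))
      (at (r - x) within (\<lambda>x. r - x) ` {r - b..r - a})"
    unfolding img using x by (intro regular_solD(1)[OF assms]) auto
  ultimately have "((y \<circ> (\<lambda>x. r - x)) has_real_derivative signed_pow (p / (p - 1)) (\<phi> (r - x)) * - 1)
      (at x within {r - b..r - a})"
    by (rule DERIV_image_chain[rotated])
  then show "((\<lambda>x. y (r - x)) has_real_derivative signed_pow (p / (p - 1)) (- \<phi> (r - x)))
      (at x within {r - b..r - a})"
    by (simp add: o_def)
next
  show "continuous_on {r - b..r - a} (\<lambda>x. - \<phi> (r - x))"
    by (intro continuous_on_minus continuous_on_compose2[OF regular_solD(3)[OF assms]] continuous_intros) auto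
  have "((\<lambda>x. - \<phi> (r - x)) has_real_derivative - (p - 1) * Q (r - x) * signed_pow p (y (r - x))) (at x)"
    if "(\<phi> has_real_derivative - (p - 1) * Q (r - x) * signed_pow p (y (r - x))) (at (r - x))" for x
  proof -
    have "((\<lambda>x. r - x) has_real_derivative - 1) (at x)"
      by (auto intro!: derivative_eq_intros)
    from DERIV_minus[OF DERIV_chain2[OF that this]] show ?thesis by simp
  qed
  then show "co_countable (r - b) (r - a) (\<lambda>x. ((\<lambda>x. - \<phi> (r - x)) has_real_derivative
      - (p - 1) * Q (r - x) * signed_pow p (y (r - x))) (at x))"
    by (rule co_countable_mono[OF co_countable_reflect[OF regular_solD(5)[OF assms], of r] order_refl order_refl])
qed

lemma regular_sol_subinterval:
  assumes "regular_sol p Q a b y \<phi>" "a \<le> c" "d \<le> b"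
  shows "regular_sol p Q c d y \<phi>"
  unfolding regular_sol_def
proof (intro conjI ballI)
  have sub: "{c..d} \<subseteq> {a..b}" using assms by auto
  show "(y has_real_derivative signed_pow (p / (p - 1)) (\<phi> x)) (at x within {c..d})" if "x \<in> {c..d}" for x
    using DERIV_subset[OF regular_solD(1)[OF assms(1)] sub] that sub by auto
  show "continuous_on {c..d} \<phi>"
    by (rule continuous_on_subset[OF regular_solD(3)[OF assms(1)] sub])
qed (rule co_countable_mono[OF regular_solD(5)[OF assms(1)] assms(2,3)])

section \<open>Uniqueness, zeros and singular behaviour of solutions\<close>

lemma conjugate_exponent:
  fixes p :: real
  assumes "p > 1"
  shows "p / (p - 1) > 1" "(p - 1) * (p / (p - 1)) = p" "(p - 1) * (p / (p - 1) - 1) = 1"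
    "(p / (p - 1) - 1) * (p - 1) = 1"
  using assms by (simp_all add: field_simps)

lemma continuous_on_abs_powr [continuous_intros]:
  fixes f :: "real \<Rightarrow> real"
  assumes "r > 1" "continuous_on S f"
  shows "continuous_on S (\<lambda>x. \<bar>f x\<bar> powr r)"
  unfolding mult_signed_pow[symmetric] by (intro continuous_intros assms)

text \<open>A Young inequality without constants: the larger of
  \<open>\<bar>u\<bar> powr (p - 1)\<close> and \<open>\<bar>v\<bar>\<close> decides which of the
  two summands alone dominates the product.\<close>

lemma signed_pow_product_le:
  assumes "p > 1"
  shows "\<bar>signed_pow p u * signed_pow (p / (p - 1)) v\<bar> \<le> \<bar>u\<bar> powr p + \<bar>v\<bar> powr (p / (p - 1))"
proof -
  let ?q = "p / (p - 1)"
  note q = conjugate_exponent[OF assms]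
  have eq: "\<bar>signed_pow p u * signed_pow ?q v\<bar> = \<bar>u\<bar> powr (p - 1) * \<bar>v\<bar> powr (?q - 1)"
    by (simp add: abs_mult abs_signed_pow)
  show ?thesis
  proof (cases "\<bar>u\<bar> powr (p - 1) \<le> \<bar>v\<bar>")
    case True
    then have "\<bar>u\<bar> powr (p - 1) * \<bar>v\<bar> powr (?q - 1) \<le> \<bar>v\<bar> * \<bar>v\<bar> powr (?q - 1)"
      by (intro mult_right_mono) auto
    also have "\<dots> = \<bar>v\<bar> powr ?q"
      using mult_signed_pow[of "\<bar>v\<bar>" ?q] by (simp add: signed_pow_of_nonneg)
    finally show ?thesis unfolding eq by (simp add: add_increasing)
  next
    case False
    have "\<bar>v\<bar> powr (?q - 1) \<le> (\<bar>u\<bar> powr (p - 1)) powr (?q - 1)"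
      using False q(1) by (intro powr_mono2) auto
    also have "\<dots> = \<bar>u\<bar>"
      using q(3) by (simp only: powr_powr) simp
    finally have "\<bar>u\<bar> powr (p - 1) * \<bar>v\<bar> powr (?q - 1) \<le> \<bar>u\<bar> powr (p - 1) * \<bar>u\<bar>"
      by (intro mult_left_mono) auto
    also have "\<dots> = \<bar>u\<bar> powr p"
      using mult_signed_pow[of "\<bar>u\<bar>" p] by (simp add: signed_pow_of_nonneg mult.commute)
    finally show ?thesis unfolding eq by (simp add: add_increasing2)
  qed
qed

text \<open>For \<open>p \<noteq> 2\<close> one of the two signed powers is not Lipschitz at
  \<open>0\<close>, so the usual uniqueness theorem does not apply. The energy \<open>E\<close> is
  homogeneous of the right degree: its derivative is bounded by a multiple of \<open>E\<close>, and
  Gronwall keeps it at \<open>0\<close>.\<close>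

lemma regular_sol_zero_right:
  assumes "p > 1" "regular_sol p Q a b y \<phi>" "co_countable a b (\<lambda>x. \<bar>Q x\<bar> \<le> C)"
    and "a \<le> b" "y a = 0" "\<phi> a = 0" and x: "x \<in> {a..b}"
  shows "y x = 0 \<and> \<phi> x = 0"
proof -
  let ?q = "p / (p - 1)"
  note q = conjugate_exponent[OF assms(1)]
  define E where "E x = \<bar>y x\<bar> powr p + \<bar>\<phi> x\<bar> powr ?q" for x
  have "co_countable a b (\<lambda>x. \<exists>d\<le>p * (1 + C) * E x. (E has_real_derivative d) (at x))"
  proof (rule co_countable_elim[OF regular_solD(5)[OF assms(2)] assms(3)])
    fix x assume x: "x \<in> {a<..<b}" and C: "\<bar>Q x\<bar> \<le> C"
      and \<phi>: "(\<phi> has_real_derivative - (p - 1) * Q x * signed_pow p (y x)) (at x)"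
    let ?s = "signed_pow p (y x) * signed_pow ?q (\<phi> x)"
    have "(E has_real_derivative p * signed_pow p (y x) * signed_pow ?q (\<phi> x) +
        ?q * signed_pow ?q (\<phi> x) * (- (p - 1) * Q x * signed_pow p (y x))) (at x)"
      unfolding E_def
      by (intro DERIV_add DERIV_chain2[OF has_real_derivative_abs_powr[OF assms(1)] regular_solD(2)[OF assms(2) x]]
          DERIV_chain2[OF has_real_derivative_abs_powr[OF q(1)] \<phi>])
    also have "p * signed_pow p (y x) * signed_pow ?q (\<phi> x) +
        ?q * signed_pow ?q (\<phi> x) * (- (p - 1) * Q x * signed_pow p (y x)) = p * ((1 - Q x) * ?s)"
      using assms(1) by (simp add: field_simps)
    finally have "(E has_real_derivative p * ((1 - Q x) * ?s)) (at x)" .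
    moreover have "(1 - Q x) * ?s \<le> (1 + C) * E x"
    proof -
      have "(1 - Q x) * ?s \<le> \<bar>1 - Q x\<bar> * \<bar>?s\<bar>"
        by (metis abs_ge_self abs_mult)
      also have "\<dots> \<le> (1 + C) * E x"
        using C signed_pow_product_le[OF assms(1), of "y x" "\<phi> x"] unfolding E_def
        by (intro mult_mono) auto
      finally show ?thesis .
    qed
    then have "p * ((1 - Q x) * ?s) \<le> p * (1 + C) * E x"
      using assms(1) mult_left_mono[of _ _ p] by (simp add: mult.assoc)
    ultimately show "\<exists>d\<le>p * (1 + C) * E x. (E has_real_derivative d) (at x)"
      by blast
  qed
  then obtain S where S: "countable S" "\<forall>x\<in>{a<..<b} - S. \<exists>d\<le>p * (1 + C) * E x. (E has_real_derivative d) (at x)"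
    by (auto simp: co_countable_def)
  have "continuous_on {a..b} E"
    unfolding E_def using assms(1) q(1) regular_solD(3,4)[OF assms(2)]
    by (intro continuous_on_add continuous_on_abs_powr)
  then have "continuous_on {a..x} E"
    by (rule continuous_on_subset) (use x in auto)
  then have "E x \<le> exp (p * (1 + C) * (x - a)) * E a"
    by (intro gronwall_off_countable[OF _ S(1)]) (use S(2) x in auto)
  moreover have "E a = 0" using assms(5,6) by (simp add: E_def)
  ultimately have le: "\<bar>y x\<bar> powr p + \<bar>\<phi> x\<bar> powr ?q \<le> 0" by (simp add: E_def)
  moreover have "\<bar>y x\<bar> powr p \<ge> 0" "\<bar>\<phi> x\<bar> powr ?q \<ge> 0" by simp_all
  ultimately have "\<bar>y x\<bar> powr p = 0" "\<bar>\<phi> x\<bar> powr ?q = 0" by linarith+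
  then show ?thesis by simp
qed

lemma regular_sol_zero:
  assumes "p > 1" "regular_sol p Q a b y \<phi>" "co_countable a b (\<lambda>x. \<bar>Q x\<bar> \<le> C)"
    and c: "c \<in> {a..b}" "y c = 0" "\<phi> c = 0" and x: "x \<in> {a..b}"
  shows "y x = 0 \<and> \<phi> x = 0"
proof (cases "c \<le> x")
  case True
  show ?thesis
    by (rule regular_sol_zero_right[OF assms(1) regular_sol_subinterval[OF assms(2)] co_countable_mono[OF assms(3)]])
      (use True c x in auto)
next
  case False
  have "y (0 - (- x)) = 0 \<and> - \<phi> (0 - (- x)) = 0"
    by (rule regular_sol_zero_right[OF assms(1)
          regular_sol_reflect[OF regular_sol_subinterval[OF assms(2), of a c], of 0]
          co_countable_reflect[OF co_countable_mono[OF assms(3)], of a c]])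
      (use False c x in auto)
  then show ?thesis by simp
qed

lemma regular_sol_next_zero:
  assumes "regular_sol p Q a b y \<phi>" "c \<in> {a..<b}" "y c = 0" "\<phi> c \<noteq> 0" "y b = 0"
  shows "\<exists>d\<in>{c<..b}. y d = 0 \<and> (\<forall>x\<in>{c<..<d}. y x \<noteq> 0)"
proof -
  let ?l = "signed_pow (p / (p - 1)) (\<phi> c)"
  have d: "(y has_real_derivative ?l) (at c within {a..b})"
    using regular_solD(1)[OF assms(1), of c] assms(2) by auto
  have "\<exists>\<delta>>0. \<forall>h>0. c + h \<in> {a..b} \<longrightarrow> h < \<delta> \<longrightarrow> y (c + h) \<noteq> 0"
  proof (cases "?l > 0")
    case True
    from has_real_derivative_pos_inc_right[OF d True] assms(3) show ?thesis by fastforce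
  next
    case False
    then have "?l < 0" using assms(4) by (simp add: linorder_neq_iff)
    from has_real_derivative_neg_dec_right[OF d this] assms(3) show ?thesis by fastforce
  qed
  then obtain \<delta> where \<delta>: "\<delta> > 0" "\<And>h. h > 0 \<Longrightarrow> c + h \<in> {a..b} \<Longrightarrow> h < \<delta> \<Longrightarrow> y (c + h) \<noteq> 0" by blast
  have near: "y x \<noteq> 0" if "x \<in> {c<..<c + \<delta>}" "x \<le> b" for x
    using \<delta>(2)[of "x - c"] that assms(2) by auto
  \<comment> \<open>Leaving out the zero-free stretch behind \<open>c\<close> makes the set closed
    and keeps its infimum away from \<open>c\<close>.\<close>
  define T where "T = {x \<in> {c + \<delta>..b}. y x = 0}"
  have bT: "b \<in> T"
    using near[of b] assms(2,5) \<delta>(1) by (auto simp: T_def not_less[symmetric])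
  have "continuous_on {c + \<delta>..b} y"
    by (rule continuous_on_subset[OF regular_solD(4)[OF assms(1)]]) (use assms(2) \<delta>(1) in auto)
  then have "closed T"
    unfolding T_def using continuous_closed_preimage[of "{c + \<delta>..b}" y "{0}"]
    by (simp add: vimage_def Int_def)
  moreover have bdd: "bdd_below T" by (rule bdd_belowI[of _ "c + \<delta>"]) (simp add: T_def)
  ultimately have inf: "Inf T \<in> T" using closed_contains_Inf bT by blast
  show ?thesis
  proof (intro bexI conjI ballI)
    show "y (Inf T) = 0" "Inf T \<in> {c<..b}" using inf \<delta>(1) by (auto simp: T_def)
    fix x assume x: "x \<in> {c<..<Inf T}"
    show "y x \<noteq> 0"
    proof (cases "x < c + \<delta>")
      case True
      then show ?thesis using near[of x] x inf by (auto simp: T_def)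
    next
      case False
      have "x \<notin> T" using cInf_lower[OF _ bdd, of x] x by auto
      then show ?thesis using False x inf by (auto simp: T_def)
    qed
  qed
qed

lemma regular_sol_riccati:
  assumes "p > 1" "regular_sol p Q a b y \<phi>" "a \<le> c" "d \<le> b" "\<And>x. x \<in> {c<..<d} \<Longrightarrow> y x \<noteq> 0"
  shows "riccati p Q c d (\<lambda>x. \<phi> x / signed_pow p (y x))"
  unfolding riccati_def
proof
  let ?q = "p / (p - 1)"
  note q = conjugate_exponent[OF assms(1)]
  have sub: "{c<..<d} \<subseteq> {a..b}" using assms(3,4) by auto
  show "continuous_on {c<..<d} (\<lambda>x. \<phi> x / signed_pow p (y x))"
    using assms(1,5)
    by (intro continuous_intros continuous_on_subset[OF regular_solD(3)[OF assms(2)] sub]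
        continuous_on_subset[OF regular_solD(4)[OF assms(2)] sub]) auto
  show "co_countable c d (\<lambda>x. ((\<lambda>x. \<phi> x / signed_pow p (y x)) has_real_derivative
      - (p - 1) * (Q x + \<bar>\<phi> x / signed_pow p (y x)\<bar> powr ?q)) (at x))"
  proof (rule co_countable_mono[OF regular_solD(5)[OF assms(2)] assms(3,4)])
    fix x assume x: "x \<in> {c<..<d}"
      and \<phi>: "(\<phi> has_real_derivative - (p - 1) * Q x * signed_pow p (y x)) (at x)"
    have y: "y x \<noteq> 0" using assms(5)[OF x] .
    have dy: "(y has_real_derivative signed_pow ?q (\<phi> x)) (at x)"
      by (rule regular_solD(2)[OF assms(2)]) (use x assms(3,4) in auto)
    note deriv = DERIV_divide[OF \<phi> DERIV_chain2[OF has_real_derivative_signed_pow[OF y, of p] dy]]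
    have sq: "signed_pow p (y x) * signed_pow p (y x) = \<bar>y x\<bar> powr (p - 2) * \<bar>y x\<bar> powr p"
      using mult_signed_pow[of "y x" p] by (simp add: signed_pow_def mult_ac)
    have W: "\<bar>\<phi> x / signed_pow p (y x)\<bar> powr ?q = \<bar>\<phi> x\<bar> powr ?q / \<bar>y x\<bar> powr p"
      using abs_signed_pow_powr[OF q(2), of "y x"] by (simp add: abs_divide powr_divide)
    have "(- (p - 1) * Q x * signed_pow p (y x) * signed_pow p (y x) -
        \<phi> x * ((p - 1) * \<bar>y x\<bar> powr (p - 2) * signed_pow ?q (\<phi> x))) / (signed_pow p (y x) * signed_pow p (y x)) =
        - (p - 1) * Q x - (p - 1) * (\<bar>y x\<bar> powr (p - 2) * (\<phi> x * signed_pow ?q (\<phi> x))) / (signed_pow p (y x) * signed_pow p (y x))"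
      using y by (simp add: field_simps)
    also have "\<dots> = - (p - 1) * (Q x + \<bar>\<phi> x / signed_pow p (y x)\<bar> powr ?q)"
      unfolding mult_signed_pow W sq using y by (simp add: field_simps)
    finally show "((\<lambda>x. \<phi> x / signed_pow p (y x)) has_real_derivative
      - (p - 1) * (Q x + \<bar>\<phi> x / signed_pow p (y x)\<bar> powr ?q)) (at x)"
      using deriv y by simp
  qed
qed

lemma powr_diff_le:
  fixes p t v :: real
  assumes "p > 1" "t > 0" "\<bar>v - t\<bar> \<le> t / 2"
  shows "\<bar>v powr (1 - p) - t powr (1 - p)\<bar> \<le> (p - 1) * (t / 2) powr (- p) * \<bar>v - t\<bar>"
proof (rule lipschitz_off_countable[of "{}" "t / 2" "2 * t"])
  show "continuous_on {t / 2..2 * t} (\<lambda>u. u powr (1 - p))"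
    using assms(2) by (intro continuous_intros) auto
  fix u assume "u \<in> {t / 2<..<2 * t} - {}"
  then have u: "u > 0" "t / 2 \<le> u" using assms(2) by auto
  have "((\<lambda>u. u powr (1 - p)) has_real_derivative (1 - p) * u powr (- p)) (at u)"
    using u has_real_derivative_powr[of u "1 - p"] by (simp add: diff_diff_eq)
  moreover have "\<bar>(1 - p) * u powr (- p)\<bar> \<le> (p - 1) * (t / 2) powr (- p)"
    using assms(1,2) u by (simp add: abs_mult mult_left_mono powr_mono2')
  ultimately show "\<exists>d. \<bar>d\<bar> \<le> (p - 1) * (t / 2) powr (- p) \<and> ((\<lambda>u. u powr (1 - p)) has_real_derivative d) (at u)"
    by blast
qed (use assms(2) abs_le_D1[OF assms(3)] abs_le_D2[OF assms(3)] in auto)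

text \<open>Here \<open>V = y / y'\<close> satisfies \<open>V' = 1 + Q \<bar>V\<bar> powr p\<close> and \<open>V c = 0\<close>.\<close>

lemma regular_sol_singular_left:
  assumes "p > 1" "regular_sol p Q a b y \<phi>" "co_countable a b (\<lambda>x. \<bar>Q x\<bar> \<le> C)"
    and c: "c \<in> {a..<b}" "y c = 0" "\<phi> c \<noteq> 0"
  shows "singular_left p c (\<lambda>x. \<phi> x / signed_pow p (y x))"
proof -
  let ?q = "p / (p - 1)"
  note q = conjugate_exponent[OF assms(1)]
  define V where "V x = y x / signed_pow ?q (\<phi> x)" for x
  have "a \<le> c" "c < b" using c(1) by auto
  note sol = regular_sol_subinterval[OF assms(2) \<open>a \<le> c\<close> order_refl]
  have at: "at c within {c..b} = at_right c"
    using \<open>c < b\<close> by (rule at_within_Icc_at_right)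
  have s_nz: "signed_pow ?q (\<phi> c) \<noteq> 0" using c(3) by simp
  have lim_\<phi>: "(\<phi> \<longlongrightarrow> \<phi> c) (at_right c)"
    by (rule continuous_on_Icc_at_rightD[OF regular_solD(3)[OF sol] \<open>c < b\<close>])
  have lim_s: "((\<lambda>x. signed_pow ?q (\<phi> x)) \<longlongrightarrow> signed_pow ?q (\<phi> c)) (at_right c)"
    by (rule continuous_on_Icc_at_rightD[OF continuous_on_signed_pow[OF q(1) regular_solD(3)[OF sol]] \<open>c < b\<close>])
  have "((\<lambda>x. (y x - y c) / (x - c)) \<longlongrightarrow> signed_pow ?q (\<phi> c)) (at_right c)"
    using regular_solD(1)[OF sol, of c] \<open>c < b\<close> unfolding has_field_derivative_iff
    by (simp add: at)
  from tendsto_divide[OF this lim_s s_nz]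
  have "((\<lambda>x. V x / (x - c)) \<longlongrightarrow> 1) (at_right c)"
    using s_nz by (simp add: V_def c(2) mult.commute)
  then have "eventually (\<lambda>x. \<bar>V x / (x - c)\<bar> < 2) (at_right c)"
    by (intro order_tendstoD(2)[OF tendsto_rabs]) auto
  moreover have "eventually (\<lambda>x. \<phi> x \<noteq> 0) (at_right c)"
    using tendsto_imp_eventually_ne[OF lim_\<phi> c(3)] .
  \<comment> \<open>The constant \<open>1 / 2\<close> will give
    \<open>\<bar>V x - (x - c)\<bar> \<le> (x - c) / 2\<close>, the range in which
    \<open>powr_diff_le\<close> applies; \<open>2 powr p\<close> comes from
    \<open>\<bar>V x\<bar> \<le> 2 * (x - c)\<close>.\<close>
  moreover have "((\<lambda>x. \<bar>C\<bar> * 2 powr p * (x - c) powr p) \<longlongrightarrow> \<bar>C\<bar> * 2 powr p * 0 powr p) (at_right c)"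
    using assms(1)
    by (intro tendsto_intros tendsto_powr') (auto intro!: tendsto_eq_intros simp: eventually_at_filter)
  then have "eventually (\<lambda>x. \<bar>C\<bar> * 2 powr p * (x - c) powr p < 1 / 2) (at_right c)"
    using assms(1) by (intro order_tendstoD(2)) auto
  moreover have "eventually (\<lambda>x. x < b) (at_right c)"
    using \<open>c < b\<close> by (auto simp: eventually_at_right_field)
  ultimately have "eventually (\<lambda>x. \<bar>V x / (x - c)\<bar> < 2 \<and> \<phi> x \<noteq> 0 \<and>
      \<bar>C\<bar> * 2 powr p * (x - c) powr p < 1 / 2 \<and> x < b) (at_right c)"
    by eventually_elim simp
  then obtain d where "d > c" and d: "\<And>x. c < x \<Longrightarrow> x < d \<Longrightarrow> \<bar>V x / (x - c)\<bar> < 2 \<and> \<phi> x \<noteq> 0 \<and>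
      \<bar>C\<bar> * 2 powr p * (x - c) powr p < 1 / 2 \<and> x < b"
    unfolding eventually_at_right_field by blast
  have V_le: "\<bar>V x\<bar> \<le> 2 * (x - c)" if "x \<in> {c<..<d}" for x
    using d[of x] that by (auto simp: abs_divide divide_less_eq)
  obtain S where S: "countable S" "\<And>x. x \<in> {a<..<b} - S \<Longrightarrow>
      (\<phi> has_real_derivative - (p - 1) * Q x * signed_pow p (y x)) (at x) \<and> \<bar>Q x\<bar> \<le> C"
    using co_countable_conj[OF regular_solD(5)[OF assms(2)] assms(3)] unfolding co_countable_def by metis
  have dV: "(V has_real_derivative 1 + Q u * \<bar>V u\<bar> powr p) (at u)" if u: "u \<in> {c<..<d} - S" for u
  proof -
    have u': "u \<in> {a<..<b} - S" "\<phi> u \<noteq> 0" using d[of u] u c(1) by auto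
    let ?s = "signed_pow ?q (\<phi> u)"
    have dy: "(y has_real_derivative ?s) (at u)"
      by (rule regular_solD(2)[OF assms(2)]) (use u' in auto)
    have d\<phi>: "(\<phi> has_real_derivative - (p - 1) * Q u * signed_pow p (y u)) (at u)" using S(2)[OF u'(1)] by simp
    have sq: "?s * ?s = \<bar>\<phi> u\<bar> powr (?q - 2) * \<bar>\<phi> u\<bar> powr ?q"
      using mult_signed_pow[of "\<phi> u" ?q] by (simp add: signed_pow_def mult_ac)
    have Vp: "\<bar>V u\<bar> powr p = \<bar>y u\<bar> powr p / \<bar>\<phi> u\<bar> powr ?q"
      using abs_signed_pow_powr[of ?q p "\<phi> u"] q assms(1)
      by (simp add: V_def abs_divide powr_divide field_simps)
    have "(?s * ?s - y u * ((?q - 1) * \<bar>\<phi> u\<bar> powr (?q - 2) * (- (p - 1) * Q u * signed_pow p (y u)))) / (?s * ?s) =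
        1 + ((?q - 1) * (p - 1)) * Q u * (\<bar>\<phi> u\<bar> powr (?q - 2) * (y u * signed_pow p (y u))) / (?s * ?s)"
      using u'(2) by (simp add: divide_simps) (simp add: algebra_simps)
    also have "\<dots> = 1 + Q u * \<bar>V u\<bar> powr p"
      unfolding mult_signed_pow Vp sq q(4) using u'(2) by simp
    finally show ?thesis
      using DERIV_divide[OF dy DERIV_chain2[OF has_real_derivative_signed_pow[OF u'(2), of ?q] d\<phi>]] u'(2)
      unfolding V_def by simp
  qed
  \<comment> \<open>Integrates the equation for \<open>V - x\<close>, whose derivative
    \<open>Q * \<bar>V\<bar> powr p\<close> is small by the crude bound \<open>V_le\<close>.\<close>
  have bound: "\<bar>V x - (x - c)\<bar> \<le> \<bar>C\<bar> * 2 powr p * (x - c) powr p * (x - c)" if x: "x \<in> {c<..<d}" for x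
  proof -
    have "\<bar>(V x - x) - (V c - c)\<bar> \<le> \<bar>C\<bar> * (2 * (x - c)) powr p * \<bar>x - c\<bar>"
    proof (rule lipschitz_off_countable[OF S(1), of c x "\<lambda>x. V x - x"])
      have "{c..x} \<subseteq> {c..b}" using d[of x] x by auto
      moreover have "\<phi> u \<noteq> 0" if "u \<in> {c..x}" for u
        using d[of u] c(3) x that by (cases "u = c") auto
      ultimately show "continuous_on {c..x} (\<lambda>x. V x - x)"
        unfolding V_def using regular_solD(3,4)[OF sol] q(1)
        by (intro continuous_intros) (auto elim: continuous_on_subset)
      fix u assume u: "u \<in> {c<..<x} - S"
      then have ud: "u \<in> {c<..<d} - S" using x by auto
      have "\<bar>Q u\<bar> \<le> \<bar>C\<bar>"
        using S(2)[of u] d[of u] ud \<open>a \<le> c\<close> by auto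
      moreover have "\<bar>V u\<bar> powr p \<le> (2 * (x - c)) powr p"
        using V_le[of u] u ud assms(1) by (intro powr_mono2) auto
      ultimately have "\<bar>Q u * \<bar>V u\<bar> powr p\<bar> \<le> \<bar>C\<bar> * (2 * (x - c)) powr p"
        by (simp add: abs_mult mult_mono)
      moreover have "((\<lambda>x. V x - x) has_real_derivative Q u * \<bar>V u\<bar> powr p) (at u)"
        using DERIV_diff[OF dV[OF ud] DERIV_ident] by simp
      ultimately show "\<exists>d. \<bar>d\<bar> \<le> \<bar>C\<bar> * (2 * (x - c)) powr p \<and> ((\<lambda>x. V x - x) has_real_derivative d) (at u)"
        by blast
    qed (use x in auto)
    moreover have "(V x - x) - (V c - c) = V x - (x - c)" by (simp add: V_def c(2))
    moreover have "\<bar>x - c\<bar> = x - c" using x by simp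
    ultimately show ?thesis by (simp only: powr_mult mult.assoc)
  qed
  have main: "\<bar>\<phi> x / signed_pow p (y x) - (x - c) powr (1 - p)\<bar> \<le> (p - 1) * \<bar>C\<bar> * 4 powr p * (x - c)"
    if x: "x \<in> {c<..<d}" for x
  proof -
    let ?t = "x - c"
    have t: "?t > 0" using x by simp
    have "\<bar>C\<bar> * 2 powr p * ?t powr p * ?t \<le> 1 / 2 * ?t"
      using d[of x] x by (intro mult_right_mono) auto
    then have half: "\<bar>V x - ?t\<bar> \<le> ?t / 2" using bound[OF x] by simp
    have Vpos: "V x > 0"
    proof (rule ccontr)
      assume "\<not> V x > 0"
      then have "?t \<le> - (V x - ?t)" by simp
      also have "\<dots> \<le> ?t / 2" by (rule abs_le_D2[OF half])
      finally show False using t by simp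
    qed
    have \<phi>x: "\<phi> x \<noteq> 0" using d[of x] x by simp
    have "y x = V x * signed_pow ?q (\<phi> x)" using \<phi>x by (simp add: V_def)
    then have "signed_pow p (y x) = V x powr (p - 1) * \<phi> x"
      using Vpos signed_pow_signed_pow[OF q(4), of "\<phi> x"] by (simp add: signed_pow_mult signed_pow_of_nonneg)
    \<comment> \<open>A pure power of \<open>V\<close>: the error in \<open>V\<close> is of order
      \<open>(x - c) powr (p + 1)\<close>, the derivative of the power costs
      \<open>(x - c) powr (- p)\<close>, and an error of order \<open>x - c\<close> is left.\<close>
    then have W: "\<phi> x / signed_pow p (y x) = V x powr (1 - p)"
      using \<phi>x powr_minus_divide[of "V x" "p - 1"] by simp
    have "\<bar>V x powr (1 - p) - ?t powr (1 - p)\<bar> \<le> (p - 1) * (?t / 2) powr (- p) * \<bar>V x - ?t\<bar>"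
      by (rule powr_diff_le[OF assms(1) t half])
    also have "\<dots> \<le> (p - 1) * (?t / 2) powr (- p) * (\<bar>C\<bar> * 2 powr p * ?t powr p * ?t)"
      using assms(1) by (intro mult_left_mono bound x) auto
    also have "\<dots> = (p - 1) * \<bar>C\<bar> * (2 powr p * 2 powr p) * ?t * (?t powr (- p) * ?t powr p)"
      using t by (simp add: powr_divide powr_minus_divide)
    also have "\<dots> = (p - 1) * \<bar>C\<bar> * 4 powr p * ?t"
      using t powr_mult[of 2 2 p] powr_add[of ?t "- p" p] by simp
    finally show ?thesis unfolding W .
  qed
  show ?thesis
    unfolding singular_left_def
  proof (rule Lim_null_comparison)
    show "eventually (\<lambda>x. norm (\<phi> x / signed_pow p (y x) - (x - c) powr (1 - p)) \<le>
        (p - 1) * \<bar>C\<bar> * 4 powr p * (x - c)) (at_right c)"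
      using main \<open>d > c\<close> by (auto simp: eventually_at_right_field intro!: exI[of _ d])
    have "((\<lambda>x. (p - 1) * \<bar>C\<bar> * 4 powr p * (x - c)) \<longlongrightarrow> (p - 1) * \<bar>C\<bar> * 4 powr p * (c - c)) (at_right c)"
      by (intro tendsto_intros)
    then show "((\<lambda>x. (p - 1) * \<bar>C\<bar> * 4 powr p * (x - c)) \<longlongrightarrow> 0) (at_right c)" by simp
  qed
qed

lemma regular_sol_nodal:
  assumes "p > 1" "regular_sol p Q a b y \<phi>" "co_countable a b (\<lambda>x. \<bar>Q x\<bar> \<le> C)"
    and cd: "a \<le> c" "c < d" "d \<le> b" "y c = 0" "y d = 0" "\<And>x. x \<in> {c<..<d} \<Longrightarrow> y x \<noteq> 0"
  shows "nodal p Q c d (\<lambda>x. \<phi> x / signed_pow p (y x))"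
proof -
  have "y ((c + d) / 2) \<noteq> 0" using cd(2) by (intro cd(6)) auto
  then have nz: "\<phi> x \<noteq> 0" if "x \<in> {a..b}" "y x = 0" for x
    using regular_sol_zero[OF assms(1-3) that, of "(c + d) / 2"] cd(1-3) by auto
  have "singular_left p (0 - d) (\<lambda>x. - \<phi> (0 - x) / signed_pow p (y (0 - x)))"
    by (rule regular_sol_singular_left[OF assms(1) regular_sol_reflect[OF assms(2), of 0]
          co_countable_reflect[OF assms(3), of 0]]) (use cd nz[of d] in auto)
  then have "singular_right p d (\<lambda>x. \<phi> x / signed_pow p (y x))"
    using singular_left_reflect_iff[of p 0 d "\<lambda>x. \<phi> x / signed_pow p (y x)"] by simp
  moreover have "singular_left p c (\<lambda>x. \<phi> x / signed_pow p (y x))"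
    by (rule regular_sol_singular_left[OF assms(1-3)]) (use cd nz[of c] in auto)
  ultimately show ?thesis
    unfolding nodal_def using regular_sol_riccati[OF assms(1,2) cd(1,3,6)] by blast
qed

section \<open>Absolutely continuous solutions\<close>

lemma abs_continuous_on_lipschitz:
  assumes "\<And>x y. x \<in> S \<Longrightarrow> y \<in> S \<Longrightarrow> \<bar>f x - f y\<bar> \<le> M * \<bar>x - y\<bar>"
  shows "abs_continuous_on S f"
  unfolding abs_continuous_on_def
proof (intro allI impI)
  fix e :: real assume e: "e > 0"
  define d where "d = e / (\<bar>M\<bar> + 1)"
  have d: "d > 0" using e by (simp add: d_def)
  have "(\<Sum>i<n. \<bar>f (b i) - f (a i)\<bar>) < e"
    if H: "(\<forall>i<n. a i \<le> b i \<and> {a i..b i} \<subseteq> S) \<and> disjoint_family_on (\<lambda>i. {a i<..<b i}) {..<n} \<and>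
        (\<Sum>i<n. b i - a i) < d" for n :: nat and a b
  proof -
    have "\<bar>f (b i) - f (a i)\<bar> \<le> (\<bar>M\<bar> + 1) * (b i - a i)" if "i < n" for i
    proof -
      have i: "a i \<le> b i" "a i \<in> S" "b i \<in> S" using H that by (auto simp: subset_eq)
      have "\<bar>f (b i) - f (a i)\<bar> \<le> M * \<bar>b i - a i\<bar>" by (rule assms[OF i(3,2)])
      also have "\<dots> \<le> (\<bar>M\<bar> + 1) * \<bar>b i - a i\<bar>" by (intro mult_right_mono) auto
      finally show ?thesis using i by simp
    qed
    then have "(\<Sum>i<n. \<bar>f (b i) - f (a i)\<bar>) \<le> (\<Sum>i<n. (\<bar>M\<bar> + 1) * (b i - a i))"
      by (intro sum_mono) auto
    also have "\<dots> = (\<bar>M\<bar> + 1) * (\<Sum>i<n. b i - a i)" by (simp add: sum_distrib_left)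
    also have "\<dots> < (\<bar>M\<bar> + 1) * d" using H by (intro mult_strict_left_mono) auto
    also have "\<dots> = e" by (simp add: d_def)
    finally show ?thesis .
  qed
  then show "\<exists>d>0. \<forall>(n::nat) a b. (\<forall>i<n. a i \<le> b i \<and> {a i..b i} \<subseteq> S) \<and>
      disjoint_family_on (\<lambda>i. {a i<..<b i}) {..<n} \<and> (\<Sum>i<n. b i - a i) < d \<longrightarrow>
      (\<Sum>i<n. \<bar>f (b i) - f (a i)\<bar>) < e"
    using d by blast
qed

lemma abs_continuous_on_diff:
  assumes "abs_continuous_on S f" "abs_continuous_on S g"
  shows "abs_continuous_on S (\<lambda>x. f x - g x)"
  unfolding abs_continuous_on_def
proof (intro allI impI)
  fix e :: real assume "e > 0"
  then have e: "e / 2 > 0" by simp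
  obtain d1 where d1: "d1 > 0" "\<And>(n::nat) a b. (\<forall>i<n. a i \<le> b i \<and> {a i..b i} \<subseteq> S) \<and>
      disjoint_family_on (\<lambda>i. {a i<..<b i}) {..<n} \<and> (\<Sum>i<n. b i - a i) < d1 \<Longrightarrow>
      (\<Sum>i<n. \<bar>f (b i) - f (a i)\<bar>) < e / 2"
    using assms(1) e unfolding abs_continuous_on_def by meson
  obtain d2 where d2: "d2 > 0" "\<And>(n::nat) a b. (\<forall>i<n. a i \<le> b i \<and> {a i..b i} \<subseteq> S) \<and>
      disjoint_family_on (\<lambda>i. {a i<..<b i}) {..<n} \<and> (\<Sum>i<n. b i - a i) < d2 \<Longrightarrow>
      (\<Sum>i<n. \<bar>g (b i) - g (a i)\<bar>) < e / 2"
    using assms(2) e unfolding abs_continuous_on_def by meson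
  have "(\<Sum>i<n. \<bar>(f (b i) - g (b i)) - (f (a i) - g (a i))\<bar>) < e"
    if H: "(\<forall>i<n. a i \<le> b i \<and> {a i..b i} \<subseteq> S) \<and> disjoint_family_on (\<lambda>i. {a i<..<b i}) {..<n} \<and>
        (\<Sum>i<n. b i - a i) < min d1 d2" for n :: nat and a b
  proof -
    have "(\<Sum>i<n. \<bar>(f (b i) - g (b i)) - (f (a i) - g (a i))\<bar>) \<le>
        (\<Sum>i<n. \<bar>f (b i) - f (a i)\<bar> + \<bar>g (b i) - g (a i)\<bar>)"
      by (intro sum_mono) auto
    also have "\<dots> < e"
      using d1(2)[of n a b] d2(2)[of n a b] H by (simp add: sum.distrib)
    finally show ?thesis .
  qed
  then show "\<exists>d>0. \<forall>(n::nat) a b. (\<forall>i<n. a i \<le> b i \<and> {a i..b i} \<subseteq> S) \<and>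
      disjoint_family_on (\<lambda>i. {a i<..<b i}) {..<n} \<and> (\<Sum>i<n. b i - a i) < d \<longrightarrow>
      (\<Sum>i<n. \<bar>(f (b i) - g (b i)) - (f (a i) - g (a i))\<bar>) < e"
    using d1(1) d2(1) by (intro exI[of _ "min d1 d2"]) auto
qed

lemma abs_continuous_on_subset:
  assumes "abs_continuous_on S f" "T \<subseteq> S"
  shows "abs_continuous_on T f"
  using assms unfolding abs_continuous_on_def by (meson order_trans)

lemma abs_continuous_on_imp_continuous_on:
  assumes "abs_continuous_on {a..b} f"
  shows "continuous_on {a..b} f"
  unfolding continuous_on_iff
proof (intro ballI allI impI)
  fix x e :: real assume x: "x \<in> {a..b}" and "e > 0"
  then obtain d where d: "d > 0" "\<And>(n::nat) u v. (\<forall>i<n. u i \<le> v i \<and> {u i..v i} \<subseteq> {a..b}) \<and>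
      disjoint_family_on (\<lambda>i. {u i<..<v i}) {..<n} \<and> (\<Sum>i<n. v i - u i) < d \<Longrightarrow>
      (\<Sum>i<n. \<bar>f (v i) - f (u i)\<bar>) < e"
    using assms unfolding abs_continuous_on_def by meson
  have "dist (f y) (f x) < e" if y: "y \<in> {a..b}" "dist y x < d" for y
  proof (cases "x \<le> y")
    case True
    then show ?thesis
      using d(2)[of 1 "\<lambda>_. x" "\<lambda>_. y"] x y by (simp add: disjoint_family_on_def dist_real_def)
  next
    case False
    then show ?thesis
      using d(2)[of 1 "\<lambda>_. y" "\<lambda>_. x"] x y
      by (simp add: disjoint_family_on_def dist_real_def abs_minus_commute)
  qed
  then show "\<exists>d>0. \<forall>y\<in>{a..b}. dist y x < d \<longrightarrow> dist (f y) (f x) < e" using d(1) by blast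
qed

text \<open>A gauge argument: in a fine tagged division, the intervals tagged at good points
  contribute little because the derivative is \<open>0\<close> there, and those tagged in the null
  set because they lie in an open set of small measure, where absolute continuity applies.\<close>

lemma abs_continuous_on_ae_zero_deriv:
  assumes "a \<le> b" and ac: "abs_continuous_on {a..b} h"
    and ae: "AE x\<in>{a<..<b} in lebesgue. (h has_real_derivative 0) (at x)"
  shows "h b = h a"
proof -
  have small: "\<bar>h b - h a\<bar> \<le> e * (b - a) + e" if e: "e > 0" for e
  proof -
    obtain d where d: "d > 0" "\<And>(n::nat) u v. (\<forall>i<n. u i \<le> v i \<and> {u i..v i} \<subseteq> {a..b}) \<and>
        disjoint_family_on (\<lambda>i. {u i<..<v i}) {..<n} \<and> (\<Sum>i<n. v i - u i) < d \<Longrightarrow>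
        (\<Sum>i<n. \<bar>h (v i) - h (u i)\<bar>) < e"
      using ac e unfolding abs_continuous_on_def by meson
    obtain N0 where N0: "{x \<in> space lebesgue. \<not> (x \<in> {a<..<b} \<longrightarrow> (h has_real_derivative 0) (at x))} \<subseteq> N0"
      "emeasure lebesgue N0 = 0" "N0 \<in> sets lebesgue"
      using ae by (rule AE_E)
    \<comment> \<open>Nothing is known about the derivative at the end points, so they are treated
      as bad points.\<close>
    define N where "N = insert a (insert b N0)"
    have "N0 \<in> null_sets lebesgue" using N0 by auto
    then have "N \<in> null_sets lebesgue"
      by (simp add: N_def flip: negligible_iff_null_sets)
    then have N: "N \<in> sets lebesgue" "emeasure lebesgue N = 0" by auto
    have deriv: "(h has_real_derivative 0) (at x)" if "x \<in> {a..b} - N" for x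
      using N0(1) that by (force simp: N_def)
    obtain U where U: "open U" "N \<subseteq> U" "U - N \<in> lmeasurable" "emeasure lebesgue (U - N) < ennreal d"
      using sets_lebesgue_outer_open[OF N(1) d(1)] .
    have Uset: "U \<in> sets lebesgue" using U(1) by simp
    have "emeasure lebesgue U = emeasure lebesgue (U - N)"
      using emeasure_Diff_null_set[OF \<open>N \<in> null_sets lebesgue\<close> Uset] by simp
    then have emU: "emeasure lebesgue U < ennreal d" using U(4) by simp
    then have Ufm: "U \<in> lmeasurable"
      using Uset order_less_trans[OF emU ennreal_less_top] by (intro fmeasurableI) (auto simp: less_top)
    have mU: "measure lebesgue U < d"
      using emU d(1) emeasure_eq_measure2[OF Ufm] by (simp add: ennreal_less_iff)
    \<comment> \<open>The gauge: at a bad point it stays inside \<open>U\<close>, at a good point it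
      keeps the increment of \<open>h\<close> below \<open>e\<close> times the length.\<close>
    have "\<exists>\<delta>>0. (x \<in> N \<longrightarrow> ball x \<delta> \<subseteq> U) \<and>
        (x \<in> {a..b} - N \<longrightarrow> (\<forall>y. \<bar>y - x\<bar> < \<delta> \<longrightarrow> \<bar>h y - h x\<bar> \<le> e * \<bar>y - x\<bar>))" for x
    proof (cases "x \<in> N")
      case True
      then show ?thesis using U(1,2) by (meson DiffD2 openE subsetD)
    next
      case False
      show ?thesis
      proof (cases "x \<in> {a..b}")
        case True
        have "(h has_derivative (\<lambda>t. 0 * t)) (at x)"
          using True False by (intro deriv[unfolded has_field_derivative_def]) auto
        from this[unfolded has_derivative_at_alt, THEN conjunct2, rule_format, OF e]
        obtain \<delta> where "\<delta> > 0" "\<forall>y. norm (y - x) < \<delta> \<longrightarrow> norm (h y - h x - 0 * (y - x)) \<le> e * norm (y - x)"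
          by blast
        then show ?thesis using False by (intro exI[of _ \<delta>]) auto
      qed (use False in \<open>auto intro: exI[of _ 1]\<close>)
    qed
    then obtain g where g: "\<And>x. g x > 0" "\<And>x. x \<in> N \<Longrightarrow> ball x (g x) \<subseteq> U"
      "\<And>x y. x \<in> {a..b} - N \<Longrightarrow> \<bar>y - x\<bar> < g x \<Longrightarrow> \<bar>h y - h x\<bar> \<le> e * \<bar>y - x\<bar>"
      by metis
    have "gauge (\<lambda>x. ball x (g x))" using g(1) by (auto simp: gauge_def)
    then obtain P where P: "P tagged_division_of {a..b}" "(\<lambda>x. ball x (g x)) fine P"
      using fine_division_exists_real by blast
    note PD = tagged_division_ofD[OF P(1)]
    have K: "\<exists>u v. K = {u..v} \<and> u \<le> v \<and> u \<in> {a..b} \<and> v \<in> {a..b} \<and> x \<in> {u..v} \<and> x \<in> {a..b} \<and>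
        \<bar>u - x\<bar> < g x \<and> \<bar>v - x\<bar> < g x" if xKP: "(x, K) \<in> P" for x K
    proof -
      obtain u v where K: "K = cbox u v" using PD(4)[OF xKP] by blast
      then have x: "x \<in> {u..v}" using PD(2)[OF xKP] by simp
      then have mem: "u \<in> K" "v \<in> K" "x \<in> K" using K by auto
      have "K \<subseteq> {a..b}" using PD(3)[OF xKP] .
      then have ab: "u \<in> {a..b}" "v \<in> {a..b}" "x \<in> {a..b}" using mem by blast+
      have "K \<subseteq> ball x (g x)" using P(2) xKP by (auto simp: fine_def)
      then have "u \<in> ball x (g x)" "v \<in> ball x (g x)" using mem by blast+
      then have "\<bar>u - x\<bar> < g x" "\<bar>v - x\<bar> < g x"
        by (simp_all add: dist_real_def abs_minus_commute)
      moreover have "K = {u..v}" "u \<le> v" using K x by auto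
      ultimately show ?thesis using ab x by blast
    qed
    define c where "c = (\<lambda>xK :: real \<times> real set. \<bar>h (Sup (snd xK)) - h (Inf (snd xK))\<bar>)"
    define P1 where "P1 = {xK \<in> P. fst xK \<notin> N}"
    define P2 where "P2 = {xK \<in> P. fst xK \<in> N}"
    have fin: "finite P" "finite P1" "finite P2" using PD(1) by (auto simp: P1_def P2_def)
    have "h b - h a = (\<Sum>(x, K)\<in>P. h (Sup K) - h (Inf K))"
      using additive_tagged_division_1[OF assms(1) P(1), of h] by simp
    also have "\<bar>\<dots>\<bar> \<le> (\<Sum>xK\<in>P. c xK)"
      by (rule order_trans[OF sum_abs]) (auto intro!: sum_mono simp: c_def)
    also have "\<dots> = sum c P1 + sum c P2"
      using fin by (subst sum.union_disjoint[symmetric]) (auto simp: P1_def P2_def intro!: sum.cong)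
    also have "sum c P1 \<le> e * (b - a)"
    proof -
      have "sum c P1 \<le> (\<Sum>(x, K)\<in>P1. e * measure lborel K)"
      proof (rule sum_mono, clarify)
        fix x K assume xK: "(x, K) \<in> P1"
        then obtain u v where uv: "K = {u..v}" "u \<le> v" "x \<in> {u..v}" "x \<in> {a..b}"
          "\<bar>u - x\<bar> < g x" "\<bar>v - x\<bar> < g x"
          using K[of x K] by (auto simp: P1_def)
        have "x \<in> {a..b} - N" using uv xK by (simp add: P1_def)
        from g(3)[OF this uv(5)] g(3)[OF this uv(6)]
        have "\<bar>h v - h u\<bar> \<le> e * (x - u) + e * (v - x)" using uv(3) by simp
        then show "c (x, K) \<le> e * measure lborel K"
          using uv by (simp add: c_def algebra_simps)
      qed
      also have "\<dots> \<le> (\<Sum>(x, K)\<in>P. e * measure lborel K)"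
        using fin e by (intro sum_mono2) (auto simp: P1_def)
      also have "\<dots> = e * (\<Sum>(x, K)\<in>P. measure lborel K)"
        by (simp add: sum_distrib_left case_prod_unfold)
      also have "(\<Sum>(x, K)\<in>P. measure lborel K) = b - a"
        using additive_content_tagged_division[of P a b] P(1) assms(1) by simp
      finally show ?thesis .
    qed
    also have "sum c P2 \<le> e"
    proof -
      \<comment> \<open>The badly tagged intervals are listed as a finite sequence, the form in
        which \<open>abs_continuous_on\<close> can be used.\<close>
      obtain en where en: "bij_betw en {..<card P2} P2"
        using ex_bij_betw_nat_finite[OF fin(3)] by (auto simp: atLeast0LessThan)
      define u where "u i = Inf (snd (en i))" for i
      define v where "v i = Sup (snd (en i))" for i
      have uv: "snd (en i) = {u i..v i}" "u i \<le> v i" "{u i..v i} \<subseteq> {a..b}" "{u i<..<v i} \<subseteq> U"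
        if i: "i < card P2" for i
      proof -
        obtain x L where xL: "en i = (x, L)" "(x, L) \<in> P2"
          using en i by (metis bij_betwE lessThan_iff surj_pair)
        then obtain s t where st: "L = {s..t}" "s \<le> t" "s \<in> {a..b}" "t \<in> {a..b}" "x \<in> {s..t}"
            "\<bar>s - x\<bar> < g x" "\<bar>t - x\<bar> < g x"
          using K[of x L] by (auto simp: P2_def)
        then have "u i = s" "v i = t" by (simp_all add: u_def v_def xL)
        moreover have "{s<..<t} \<subseteq> ball x (g x)" using st by (auto simp: dist_real_def)
        moreover have "ball x (g x) \<subseteq> U" using g(2) xL by (auto simp: P2_def)
        ultimately show "snd (en i) = {u i..v i}" "u i \<le> v i" "{u i..v i} \<subseteq> {a..b}" "{u i<..<v i} \<subseteq> U"
          using st xL by auto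
      qed
      have disj: "disjoint_family_on (\<lambda>i. {u i<..<v i}) {..<card P2}"
        unfolding disjoint_family_on_def
      proof (intro ballI impI)
        fix i j assume ij: "i \<in> {..<card P2}" "j \<in> {..<card P2}" "i \<noteq> j"
        then have "en i \<noteq> en j" "en i \<in> P" "en j \<in> P"
          using en by (auto simp: bij_betw_def inj_on_def P2_def)
        then have "interior (snd (en i)) \<inter> interior (snd (en j)) = {}"
          using PD(5)[of "fst (en i)" "snd (en i)" "fst (en j)" "snd (en j)"] by (metis prod.collapse)
        then show "{u i<..<v i} \<inter> {u j<..<v j} = {}"
          using ij uv(1)[of i] uv(1)[of j] by (simp add: interior_atLeastAtMost_real)
      qed
      have "(\<Sum>i<card P2. v i - u i) = (\<Sum>i<card P2. measure lebesgue {u i<..<v i})"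
        using uv(2) by (intro sum.cong) auto
      also have "\<dots> = measure lebesgue (\<Union>i<card P2. {u i<..<v i})"
        using disj by (intro measure_UNION'[symmetric]) (auto simp: disjoint_family_on_def pairwise_def disjnt_def)
      also have "\<dots> \<le> measure lebesgue U"
        using uv(4) Ufm by (intro measure_mono_fmeasurable) auto
      also have "\<dots> < d" by (rule mU)
      finally have "(\<Sum>i<card P2. \<bar>h (v i) - h (u i)\<bar>) < e"
        using disj uv by (intro d(2)) auto
      moreover have "sum c P2 = (\<Sum>i<card P2. c (en i))"
        by (rule sum.reindex_bij_betw[OF en, symmetric])
      ultimately show ?thesis by (simp add: c_def u_def v_def)
    qed
    finally show ?thesis by simp
  qed
  have "\<bar>h b - h a\<bar> \<le> 0"
  proof (rule field_le_epsilon)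
    fix e :: real assume "e > 0"
    then have "e / (b - a + 1) > 0" using assms(1) by simp
    from small[OF this] have "\<bar>h b - h a\<bar> \<le> e / (b - a + 1) * (b - a + 1)"
      by (simp only: distrib_left mult_1_right)
    then show "\<bar>h b - h a\<bar> \<le> 0 + e"
      using assms(1) by simp
  qed
  then show ?thesis by simp
qed

section \<open>From almost everywhere to countable exceptional sets\<close>

lemma co_countable_AE:
  assumes "co_countable a b P"
  shows "AE x\<in>{a<..<b} in lebesgue. P x"
proof -
  obtain S where S: "countable S" "\<forall>x\<in>{a<..<b} - S. P x"
    using assms by (auto simp: co_countable_def)
  have "S \<in> null_sets lebesgue"
    using countable_imp_null_set_lborel[OF S(1)] by (rule null_sets_completionI)
  then show ?thesis
    by (rule AE_I') (use S(2) in auto)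
qed

text \<open>Set to \<open>0\<close> outside the open interval, the function is continuous off a
  countable set, which yields Borel measurability; boundedness does the rest.\<close>

lemma integrable_of_co_countable_isCont:
  fixes f :: "real \<Rightarrow> real"
  assumes "\<And>x. x \<in> {a..b} \<Longrightarrow> \<bar>f x\<bar> \<le> M" "co_countable a b (isCont f)"
  shows "f absolutely_integrable_on {a..b}"
proof -
  obtain S where S: "countable S" "\<And>x. x \<in> {a<..<b} - S \<Longrightarrow> isCont f x"
    using assms(2) unfolding co_countable_def by metis
  define g where "g x = (if x \<in> {a<..<b} then f x else 0)" for x
  have "continuous_on (- (S \<union> {a, b})) g"
  proof (rule continuous_at_imp_continuous_on, rule ballI)
    fix x assume x: "x \<in> - (S \<union> {a, b})"
    consider "x \<in> {a<..<b}" | "x \<in> {..<a} \<union> {b<..}" using x by force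
    then show "isCont g x"
    proof cases
      case 1
      have "isCont f x" using S(2)[of x] 1 x by auto
      moreover have "eventually (\<lambda>x. f x = g x) (nhds x)"
        using eventually_nhds_in_open[OF open_greaterThanLessThan 1] by eventually_elim (simp add: g_def)
      ultimately show ?thesis using isCont_cong by blast
    next
      case 2
      have "open ({..<a} \<union> {b<..})" by (intro open_Un) auto
      from eventually_nhds_in_open[OF this 2] have "eventually (\<lambda>x. 0 = g x) (nhds x)"
        by eventually_elim (auto simp: g_def)
      then show ?thesis using isCont_cong[of "\<lambda>_. 0" g x] by simp
    qed
  qed
  then have "g \<in> borel_measurable borel"
    using S(1) by (intro borel_measurable_continuous_countable_exceptions) auto
  then have gm: "g \<in> borel_measurable (lebesgue_on {a..b})"
    by (intro measurable_restrict_space1 measurable_completion) simp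
  have "(\<lambda>x. \<bar>M\<bar>) integrable_on {a..b}" by (rule integrable_const_ivl)
  then have "g absolutely_integrable_on {a..b}"
    by (rule measurable_bounded_by_integrable_imp_absolutely_integrable[OF gm, rotated])
      (use assms(1) in \<open>auto simp: g_def intro: order_trans[OF _ abs_ge_self]\<close>)
  then show ?thesis
    by (rule absolutely_integrable_spike[of _ _ "{a, b}"]) (auto simp: g_def)
qed

lemma indefinite_integral_co_countable:
  fixes f :: "real \<Rightarrow> real"
  assumes bound: "\<And>x. x \<in> {a..b} \<Longrightarrow> \<bar>f x\<bar> \<le> M" and cont: "co_countable a b (isCont f)"
  shows "continuous_on {a..b} (\<lambda>x. integral {a..x} f)"
    and "co_countable a b (\<lambda>x. ((\<lambda>x. integral {a..x} f) has_real_derivative f x) (at x))"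
proof -
  have int: "f integrable_on {a..b}"
    using integrable_of_co_countable_isCont[OF _ cont] bound by (force simp: absolutely_integrable_on_def)
  then show "continuous_on {a..b} (\<lambda>x. integral {a..x} f)"
    by (rule indefinite_integral_continuous_1)
  show "co_countable a b (\<lambda>x. ((\<lambda>x. integral {a..x} f) has_real_derivative f x) (at x))"
  proof (rule co_countable_mono[OF cont order_refl order_refl])
    fix x assume x: "x \<in> {a<..<b}" "isCont f x"
    have "((\<lambda>u. integral {a..u} f) has_vector_derivative f x) (at x within ({a..b} - {}))"
      using x by (intro integral_has_vector_derivative_continuous_at[OF int])
        (auto intro: continuous_at_imp_continuous_at_within)
    then show "((\<lambda>u. integral {a..u} f) has_real_derivative f x) (at x)"
      using x at_within_Icc_at[of a x b] by (simp add: has_real_derivative_iff_has_vector_derivative)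
  qed
qed

text \<open>The difference between \<phi> and the indefinite integral of \<open>f\<close> is
  absolutely continuous with derivative \<open>0\<close> almost everywhere, hence constant. The
  integral is differentiable wherever \<open>f\<close> is continuous, so the almost everywhere
  equation improves to one off a countable set.\<close>

lemma abs_continuous_on_ae_deriv:
  assumes "a \<le> b" and ac: "abs_continuous_on {a..b} \<phi>"
    and ae: "AE x\<in>{a<..<b} in lebesgue. (\<phi> has_real_derivative f x) (at x)"
    and bound: "\<And>x. x \<in> {a..b} \<Longrightarrow> \<bar>f x\<bar> \<le> M"
    and cont: "co_countable a b (isCont f)"
  shows "co_countable a b (\<lambda>x. (\<phi> has_real_derivative f x) (at x))"
proof -
  define F where "F x = integral {a..x} f" for x
  have contF: "continuous_on {a..b} F"
    unfolding F_def by (rule indefinite_integral_co_countable(1)[OF _ cont]) (rule bound)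
  have coF: "co_countable a b (\<lambda>x. (F has_real_derivative f x) (at x))"
    unfolding F_def by (rule indefinite_integral_co_countable(2)[OF _ cont]) (rule bound)
  from coF obtain S where S: "countable S" "\<And>x. x \<in> {a<..<b} - S \<Longrightarrow> (F has_real_derivative f x) (at x)"
    unfolding co_countable_def by metis
  have "abs_continuous_on {a..b} F"
  proof (rule abs_continuous_on_lipschitz)
    fix x y assume "x \<in> {a..b}" "y \<in> {a..b}"
    then show "\<bar>F x - F y\<bar> \<le> M * \<bar>x - y\<bar>"
    proof (rule lipschitz_off_countable[OF S(1) contF])
      show "\<exists>d. \<bar>d\<bar> \<le> M \<and> (F has_real_derivative d) (at x)" if "x \<in> {a<..<b} - S" for x
        using S(2)[OF that] bound[of x] that by (intro exI[of _ "f x"]) auto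
    qed
  qed
  then have ach: "abs_continuous_on {a..b} (\<lambda>x. \<phi> x - F x)"
    by (rule abs_continuous_on_diff[OF ac])
  have aeh: "AE x\<in>{a<..<b} in lebesgue. ((\<lambda>x. \<phi> x - F x) has_real_derivative 0) (at x)"
    using ae co_countable_AE[OF coF]
  proof eventually_elim
    case (elim x)
    show ?case
    proof
      assume "x \<in> {a<..<b}"
      then show "((\<lambda>x. \<phi> x - F x) has_real_derivative 0) (at x)"
        using DERIV_diff[of \<phi> "f x" x _ F "f x"] elim by simp
    qed
  qed
  have eq: "\<phi> x = F x + (\<phi> a - F a)" if x: "x \<in> {a..b}" for x
  proof -
    have "AE t\<in>{a<..<x} in lebesgue. ((\<lambda>x. \<phi> x - F x) has_real_derivative 0) (at t)"
      using aeh by eventually_elim (use x in auto)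
    then have "\<phi> x - F x = \<phi> a - F a"
      using x by (intro abs_continuous_on_ae_zero_deriv abs_continuous_on_subset[OF ach]) auto
    then show ?thesis by simp
  qed
  show ?thesis
  proof (rule co_countable_mono[OF coF order_refl order_refl])
    fix x assume x: "x \<in> {a<..<b}" and "(F has_real_derivative f x) (at x)"
    then have "((\<lambda>x. F x + (\<phi> a - F a)) has_real_derivative f x) (at x)"
      by (auto intro!: derivative_eq_intros)
    then show "(\<phi> has_real_derivative f x) (at x)"
      by (rule has_field_derivative_transform_within_open[OF _ open_greaterThanLessThan x])
        (rule eq[symmetric], simp)
  qed
qed

text \<open>The common ground of densities monotone on both halves and of step densities. The last
  clause, a positive lower bound on one fixed interval inside the left half, makes the Pruefer angle
  at \<open>H\<close> unbounded in the spectral parameter.\<close>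

definition nice_density :: "real \<Rightarrow> (real \<Rightarrow> real) \<Rightarrow> bool" where
  "nice_density H \<rho> \<longleftrightarrow>
     (\<exists>B. \<forall>x\<in>{0..H}. \<bar>\<rho> x\<bar> \<le> B) \<and> co_countable 0 H (isCont \<rho>) \<and> co_countable 0 H (\<lambda>x. \<rho> x > 0) \<and>
     (\<exists>c>0. co_countable (H / 4) (H / 3) (\<lambda>x. \<rho> x \<ge> c))"

lemma dirichlet_solution_regular:
  assumes "p > 1" "nice_density (pi_hat p) \<rho>" "dirichlet_solution p \<rho> \<mu> y" "pi_hat p > 0"
  shows "\<exists>\<phi>. regular_sol p (\<lambda>x. \<mu> * \<rho> x) 0 (pi_hat p) y \<phi>"
proof -
  let ?H = "pi_hat p"
  obtain dy where dy: "\<forall>x\<in>{0..?H}. (y has_real_derivative dy x) (at x within {0..?H})"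
    "abs_continuous_on {0..?H} (\<lambda>x. signed_pow p (dy x))"
    "AE x\<in>{0<..<?H} in lebesgue. ((\<lambda>t. signed_pow p (dy t)) has_real_derivative
       - (p - 1) * \<mu> * \<rho> x * signed_pow p (y x)) (at x)"
    using assms(3) by (auto simp: dirichlet_solution_def)
  define \<phi> where "\<phi> x = signed_pow p (dy x)" for x
  define f where "f x = - (p - 1) * \<mu> * \<rho> x * signed_pow p (y x)" for x
  have conty: "continuous_on {0..?H} y"
    using dy(1) by (meson DERIV_continuous continuous_on_eq_continuous_within)
  obtain B where B: "\<forall>x\<in>{0..?H}. \<bar>\<rho> x\<bar> \<le> B"
    using assms(2) by (auto simp: nice_density_def)
  define g where "g x = - (p - 1) * \<mu> * signed_pow p (y x)" for x
  have contg: "continuous_on {0..?H} g"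
    unfolding g_def using assms(1) conty by (intro continuous_intros)
  obtain G where G: "\<forall>x\<in>{0..?H}. \<bar>g x\<bar> \<le> G"
    using continuous_on_Icc_abs_bounded[OF contg] by blast
  have fg: "f = (\<lambda>x. g x * \<rho> x)" by (auto simp: f_def g_def)
  have "co_countable 0 ?H (\<lambda>x. (\<phi> has_real_derivative f x) (at x))"
  proof (rule abs_continuous_on_ae_deriv)
    show "abs_continuous_on {0..?H} \<phi>" using dy(2) by (simp add: \<phi>_def[abs_def])
    show "AE x\<in>{0<..<?H} in lebesgue. (\<phi> has_real_derivative f x) (at x)"
      using dy(3) by (simp add: \<phi>_def[abs_def] f_def)
    show "\<bar>f x\<bar> \<le> G * B" if "x \<in> {0..?H}" for x
      unfolding fg abs_mult using G B that by (intro mult_mono) auto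
    have "co_countable 0 ?H (isCont \<rho>)" using assms(2) by (simp add: nice_density_def)
    then show "co_countable 0 ?H (isCont f)"
    proof (rule co_countable_mono)
      fix x assume x: "x \<in> {0<..<?H}" "isCont \<rho> x"
      have "isCont g x"
        using continuous_on_interior[OF contg] x by simp
      then show "isCont f x"
        unfolding fg using x by (intro continuous_intros)
    qed auto
  qed (use assms(4) in auto)
  moreover have "continuous_on {0..?H} \<phi>"
    unfolding \<phi>_def using dy(2) by (rule abs_continuous_on_imp_continuous_on)
  moreover have "signed_pow (p / (p - 1)) (\<phi> x) = dy x" for x
    unfolding \<phi>_def by (rule signed_pow_signed_pow[OF conjugate_exponent(3)[OF assms(1)]])
  ultimately have "regular_sol p (\<lambda>x. \<mu> * \<rho> x) 0 ?H y \<phi>"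
    using dy(1) by (simp add: regular_sol_def f_def mult.assoc)
  then show ?thesis by blast
qed

lemma regular_sol_dirichlet_solution:
  assumes "p > 1" "nice_density (pi_hat p) \<rho>" "regular_sol p (\<lambda>x. \<mu> * \<rho> x) 0 (pi_hat p) y \<phi>"
    and "y 0 = 0" "y (pi_hat p) = 0"
  shows "dirichlet_solution p \<rho> \<mu> y"
proof -
  let ?H = "pi_hat p" and ?q = "p / (p - 1)"
  note q = conjugate_exponent[OF assms(1)]
  note sol = regular_solD[OF assms(3)]
  have inv_eq: "signed_pow p (signed_pow ?q (\<phi> x)) = \<phi> x" for x
    by (rule signed_pow_signed_pow[OF q(4)])
  obtain B where B: "\<forall>x\<in>{0..?H}. \<bar>\<rho> x\<bar> \<le> B"
    using assms(2) by (auto simp: nice_density_def)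
  have contq: "continuous_on {0..?H} (\<lambda>x. signed_pow ?q (\<phi> x))"
    using sol(3) q(1) by (intro continuous_intros)
  obtain M1 where M1: "\<forall>x\<in>{0..?H}. \<bar>signed_pow ?q (\<phi> x)\<bar> \<le> M1"
    using continuous_on_Icc_abs_bounded[OF contq] by blast
  have contp: "continuous_on {0..?H} (\<lambda>x. - (p - 1) * \<mu> * signed_pow p (y x))"
    using sol(4) assms(1) by (intro continuous_intros)
  obtain M2 where M2: "\<forall>x\<in>{0..?H}. \<bar>- (p - 1) * \<mu> * signed_pow p (y x)\<bar> \<le> M2"
    using continuous_on_Icc_abs_bounded[OF contp] by blast
  obtain S where S: "countable S" "\<And>x. x \<in> {0<..<?H} - S \<Longrightarrow>
      (\<phi> has_real_derivative - (p - 1) * (\<mu> * \<rho> x) * signed_pow p (y x)) (at x)"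
    using sol(5) unfolding co_countable_def by metis
  have "abs_continuous_on {0..?H} y"
  proof (rule abs_continuous_on_lipschitz)
    fix x t assume "x \<in> {0..?H}" "t \<in> {0..?H}"
    then show "\<bar>y x - y t\<bar> \<le> M1 * \<bar>x - t\<bar>"
    proof (rule lipschitz_off_countable[OF countable_empty sol(4)])
      show "\<exists>d. \<bar>d\<bar> \<le> M1 \<and> (y has_real_derivative d) (at x)" if "x \<in> {0<..<?H} - {}" for x
        using sol(2)[of x] M1 that by (intro exI[of _ "signed_pow ?q (\<phi> x)"]) auto
    qed
  qed
  moreover have "abs_continuous_on {0..?H} \<phi>"
  proof (rule abs_continuous_on_lipschitz)
    fix x t assume "x \<in> {0..?H}" "t \<in> {0..?H}"
    then show "\<bar>\<phi> x - \<phi> t\<bar> \<le> M2 * B * \<bar>x - t\<bar>"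
    proof (rule lipschitz_off_countable[OF S(1) sol(3)])
      fix x assume x: "x \<in> {0<..<?H} - S"
      have "\<bar>(- (p - 1) * \<mu> * signed_pow p (y x)) * \<rho> x\<bar> \<le> M2 * B"
        unfolding abs_mult[of _ "\<rho> x"] by (rule mult_mono) (use M2 B x in fastforce)+
      then show "\<exists>d. \<bar>d\<bar> \<le> M2 * B \<and> (\<phi> has_real_derivative d) (at x)"
        using S(2)[OF x] by (intro exI[of _ "(- (p - 1) * \<mu> * signed_pow p (y x)) * \<rho> x"]) (simp add: mult_ac)
    qed
  qed
  moreover have "AE x\<in>{0<..<?H} in lebesgue.
      (\<phi> has_real_derivative - (p - 1) * \<mu> * \<rho> x * signed_pow p (y x)) (at x)"
    using co_countable_AE[OF sol(5)] by (simp add: mult.assoc)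
  ultimately show ?thesis
    unfolding dirichlet_solution_def using assms(4,5) sol(1)
    by (intro conjI exI[of _ "\<lambda>x. signed_pow ?q (\<phi> x)"]) (simp_all add: inv_eq)
qed

section \<open>Existence of eigenfunctions\<close>

text \<open>Picard iteration for a right-hand side discontinuous in \<open>t\<close>. The fixed
  point is sought as \<open>exp (- K * t) * \<alpha> t\<close>; this weight makes the map a
  contraction on the whole interval at once.\<close>

lemma integral_equation_solvable:
  fixes f :: "real \<Rightarrow> real \<Rightarrow> real"
  assumes "H > 0"
    and bound: "\<And>t \<theta>. t \<in> {0..H} \<Longrightarrow> \<bar>f t \<theta>\<bar> \<le> M"
    and lip: "\<And>t \<theta> \<eta>. t \<in> {0..H} \<Longrightarrow> \<bar>f t \<theta> - f t \<eta>\<bar> \<le> \<Lambda> * \<bar>\<theta> - \<eta>\<bar>"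
    and cont: "\<And>\<beta>. continuous_on UNIV \<beta> \<Longrightarrow> co_countable 0 H (isCont (\<lambda>t. f t (\<beta> t)))"
  shows "\<exists>\<alpha>. continuous_on UNIV \<alpha> \<and> (\<forall>x\<in>{0..H}. \<alpha> x = integral {0..x} (\<lambda>t. f t (\<alpha> t)))"
proof -
  \<comment> \<open>The contraction constant is \<open>\<bar>\<Lambda>\<bar> / K\<close>, here at
    most \<open>1 / 2\<close>; the summand \<open>1\<close> keeps \<open>K\<close> positive.\<close>
  define K where "K = 2 * \<bar>\<Lambda>\<bar> + 1"
  have K: "K > 0" by (simp add: K_def)
  \<comment> \<open>Bounded continuous functions live on the whole line; clamping extends the
    integral from \<open>{0..H}\<close> constantly.\<close>
  define cl where "cl x = max 0 (min H x)" for x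
  have cl: "cl x \<in> {0..H}" for x using assms(1) by (auto simp: cl_def)
  have cl_id: "cl x = x" if "x \<in> {0..H}" for x using that by (auto simp: cl_def)
  have contcl: "continuous_on UNIV cl" unfolding cl_def by (intro continuous_intros)
  define g where "g \<beta> t = f t (exp (K * t) * \<beta> t)" for \<beta> t
  define R where "R \<beta> x = exp (- K * cl x) * integral {0..cl x} (g \<beta>)" for \<beta> x
  have gb: "\<bar>g \<beta> t\<bar> \<le> M" if "t \<in> {0..H}" for \<beta> t
    unfolding g_def by (rule bound[OF that])
  have gc: "co_countable 0 H (isCont (g \<beta>))" if "continuous_on UNIV \<beta>" for \<beta>
    unfolding g_def by (rule cont) (intro continuous_intros that)
  have contI: "continuous_on {0..H} (\<lambda>x. integral {0..x} (g \<beta>))" if "continuous_on UNIV \<beta>" for \<beta>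
    by (rule indefinite_integral_co_countable(1)[OF gb gc[OF that]])
  have int: "g \<beta> integrable_on {0..x}" if "continuous_on UNIV \<beta>" "x \<le> H" for \<beta> x
  proof -
    have "g \<beta> integrable_on {0..H}"
      using integrable_of_co_countable_isCont[OF gb gc[OF that(1)]]
      by (simp add: absolutely_integrable_on_def)
    then show ?thesis by (rule integrable_subinterval_real) (use that in auto)
  qed
  have R_bcont: "R (apply_bcontfun \<beta>) \<in> bcontfun" for \<beta> :: "real \<Rightarrow>\<^sub>C real"
  proof -
    let ?b = "apply_bcontfun \<beta>"
    have contR: "continuous_on UNIV (R ?b)"
      unfolding R_def
      by (intro continuous_on_mult continuous_on_exp continuous_on_compose2[OF contI contcl] continuous_intros contcl)
        (use cl in auto)
    have "compact (R ?b ` {0..H})"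
      by (intro compact_continuous_image continuous_on_subset[OF contR]) auto
    then obtain b where b: "\<forall>x\<in>{0..H}. \<bar>R ?b x\<bar> \<le> b"
      using compact_imp_bounded[THEN bounded_iff[THEN iffD1]] by force
    have "R ?b (cl x) = R ?b x" for x by (simp add: R_def cl_id[OF cl])
    then have "norm (R ?b x) \<le> b" for x using b cl[of x] by (metis real_norm_def)
    with contR show ?thesis by (rule bcontfun_normI)
  qed
  define T where "T \<beta> = Bcontfun (R (apply_bcontfun \<beta>))" for \<beta> :: "real \<Rightarrow>\<^sub>C real"
  have T: "apply_bcontfun (T \<beta>) = R (apply_bcontfun \<beta>)" for \<beta>
    unfolding T_def by (rule Bcontfun_inverse[OF R_bcont])
  have "dist (T \<beta>) (T \<gamma>) \<le> 1 / 2 * dist \<beta> \<gamma>" for \<beta> \<gamma>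
  proof (rule dist_bound)
    fix x
    let ?x = "cl x" and ?b = "apply_bcontfun \<beta>" and ?c = "apply_bcontfun \<gamma>"
    have x: "?x \<in> {0..H}" by (rule cl)
    define C where "C = \<bar>\<Lambda>\<bar> * dist \<beta> \<gamma>"
    have C: "C \<ge> 0" by (simp add: C_def)
    have expint: "((\<lambda>t. C * exp (K * t)) has_integral (C * exp (K * ?x) / K - C * exp (K * 0) / K)) {0..?x}"
    proof (rule fundamental_theorem_of_calculus)
      fix t
      have "((\<lambda>t. C * exp (K * t) / K) has_real_derivative C * exp (K * t)) (at t within {0..?x})"
        using K by (auto intro!: derivative_eq_intros)
      then show "((\<lambda>t. C * exp (K * t) / K) has_vector_derivative C * exp (K * t)) (at t within {0..?x})"
        by (simp add: has_real_derivative_iff_has_vector_derivative)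
    qed (use x in auto)
    have ints: "g ?b integrable_on {0..?x}" "g ?c integrable_on {0..?x}"
      using int x by auto
    have "\<bar>integral {0..?x} (g ?b) - integral {0..?x} (g ?c)\<bar> = \<bar>integral {0..?x} (\<lambda>t. g ?b t - g ?c t)\<bar>"
      by (simp add: integral_diff[OF ints])
    also have "\<dots> \<le> integral {0..?x} (\<lambda>t. C * exp (K * t))"
    proof -
      have "norm (integral {0..?x} (\<lambda>t. g ?b t - g ?c t)) \<le> integral {0..?x} (\<lambda>t. C * exp (K * t))"
      proof (rule integral_norm_bound_integral)
        show "(\<lambda>t. g ?b t - g ?c t) integrable_on {0..?x}" by (intro integrable_diff ints)
        show "(\<lambda>t. C * exp (K * t)) integrable_on {0..?x}" using expint by blast
        fix t assume "t \<in> {0..?x}"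
        then have t: "t \<in> {0..H}" using x by auto
        have "\<bar>g ?b t - g ?c t\<bar> \<le> \<Lambda> * \<bar>exp (K * t) * ?b t - exp (K * t) * ?c t\<bar>"
          unfolding g_def by (rule lip[OF t])
        also have "\<dots> = \<Lambda> * (exp (K * t) * dist (?b t) (?c t))"
          by (simp add: dist_real_def abs_mult right_diff_distrib[symmetric])
        also have "\<dots> \<le> \<bar>\<Lambda>\<bar> * (exp (K * t) * dist \<beta> \<gamma>)"
          by (intro mult_mono mult_left_mono dist_bounded) auto
        finally show "norm (g ?b t - g ?c t) \<le> C * exp (K * t)" by (simp add: C_def mult_ac)
      qed
      then show ?thesis by simp
    qed
    also have "\<dots> \<le> C * exp (K * ?x) / K"
      unfolding integral_unique[OF expint] using C K by simp
    finally have le: "\<bar>integral {0..?x} (g ?b) - integral {0..?x} (g ?c)\<bar> \<le> C * exp (K * ?x) / K" .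
    have "dist (R ?b x) (R ?c x) = exp (- K * ?x) * \<bar>integral {0..?x} (g ?b) - integral {0..?x} (g ?c)\<bar>"
      by (simp add: R_def dist_real_def right_diff_distrib[symmetric] abs_mult)
    also have "\<dots> \<le> exp (- K * ?x) * (C * exp (K * ?x) / K)"
      by (intro mult_left_mono le) simp
    also have "\<dots> = C / K" by (simp add: exp_minus)
    also have "\<dots> \<le> 1 / 2 * dist \<beta> \<gamma>"
    proof -
      have "2 * \<bar>\<Lambda>\<bar> * dist \<beta> \<gamma> \<le> K * dist \<beta> \<gamma>"
        by (intro mult_right_mono) (auto simp: K_def)
      then show ?thesis using K by (simp add: C_def divide_simps mult_ac)
    qed
    finally show "dist (apply_bcontfun (T \<beta>) x) (apply_bcontfun (T \<gamma>) x) \<le> 1 / 2 * dist \<beta> \<gamma>"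
      unfolding T .
  qed
  then obtain \<beta> where fixpt: "T \<beta> = \<beta>"
    using banach_fix_type[of "1 / 2" T] by auto
  define \<alpha> where "\<alpha> x = exp (K * x) * apply_bcontfun \<beta> x" for x
  have "\<alpha> x = integral {0..x} (\<lambda>t. f t (\<alpha> t))" if x: "x \<in> {0..H}" for x
  proof -
    have "apply_bcontfun \<beta> x = R (apply_bcontfun \<beta>) x" using T[of \<beta>] fixpt by metis
    then have "\<alpha> x = exp (K * x) * (exp (- K * x) * integral {0..x} (g (apply_bcontfun \<beta>)))"
      by (simp add: \<alpha>_def R_def cl_id[OF x])
    also have "\<dots> = integral {0..x} (g (apply_bcontfun \<beta>))"
      by (simp add: exp_minus)
    finally show ?thesis by (simp add: g_def[abs_def] \<alpha>_def)
  qed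
  moreover have "continuous_on UNIV \<alpha>"
    unfolding \<alpha>_def by (intro continuous_intros continuous_on_apply_bcontfun)
  ultimately show ?thesis by blast
qed

text \<open>\<open>u\<close> and \<open>v\<close> will be \<open>\<bar>w\<bar> powr q\<close> and \<open>\<bar>Y\<bar> powr p\<close> along a closed curve \<open>(Y, w)\<close> around
  the origin, so that \<open>\<alpha>\<close> is a Pruefer angle.\<close>

lemma angle_exists:
  assumes "H > 0" and \<rho>: "nice_density H \<rho>" and "\<Lambda> \<ge> 0"
    and uv: "\<And>\<theta>. u \<theta> \<in> {0..1}" "\<And>\<theta>. v \<theta> \<in> {0..1}" "\<And>\<theta>. 1 \<le> u \<theta> + v \<theta>"
    and lip: "\<And>\<theta> \<eta>. \<bar>u \<theta> - u \<eta>\<bar> \<le> \<Lambda> * \<bar>\<theta> - \<eta>\<bar>" "\<And>\<theta> \<eta>. \<bar>v \<theta> - v \<eta>\<bar> \<le> \<Lambda> * \<bar>\<theta> - \<eta>\<bar>"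
    and N: "N > (0::real)"
  shows "\<exists>m>0. \<exists>\<alpha>. continuous_on {0..H} \<alpha> \<and> \<alpha> 0 = 0 \<and> \<alpha> H = N \<and>
    co_countable 0 H (\<lambda>x. (\<alpha> has_real_derivative m * (u (\<alpha> x) + \<rho> x * v (\<alpha> x))) (at x))"
proof -
  obtain B where B0: "\<forall>x\<in>{0..H}. \<bar>\<rho> x\<bar> \<le> B" using \<rho> by (auto simp: nice_density_def)
  have B: "B \<ge> 0" using B0 assms(1) by (meson abs_ge_zero atLeastAtMost_iff less_imp_le order_refl order_trans)
  have cont\<rho>: "co_countable 0 H (isCont \<rho>)" and pos: "co_countable 0 H (\<lambda>x. \<rho> x > 0)"
    using \<rho> by (auto simp: nice_density_def)
  have contu: "isCont u \<theta>" and contv: "isCont v \<theta>" for \<theta>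
  proof -
    have "isCont f \<theta>" if "\<And>\<eta>. \<bar>f \<theta> - f \<eta>\<bar> \<le> \<Lambda> * \<bar>\<theta> - \<eta>\<bar>" for f :: "real \<Rightarrow> real"
    proof -
      have "((\<lambda>\<eta>. f \<eta> - f \<theta>) \<longlongrightarrow> 0) (at \<theta>)"
      proof (rule Lim_null_comparison)
        show "eventually (\<lambda>\<eta>. norm (f \<eta> - f \<theta>) \<le> \<Lambda> * \<bar>\<theta> - \<eta>\<bar>) (at \<theta>)"
          using that by (simp add: abs_minus_commute)
        have "((\<lambda>\<eta>. \<Lambda> * \<bar>\<theta> - \<eta>\<bar>) \<longlongrightarrow> \<Lambda> * \<bar>\<theta> - \<theta>\<bar>) (at \<theta>)" by (intro tendsto_intros)
        then show "((\<lambda>\<eta>. \<Lambda> * \<bar>\<theta> - \<eta>\<bar>) \<longlongrightarrow> 0) (at \<theta>)" by simp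
      qed
      then show ?thesis unfolding isCont_def using Lim_null by blast
    qed
    then show "isCont u \<theta>" "isCont v \<theta>" using lip by auto
  qed
  define f where "f m t \<theta> = m * (u \<theta> + \<rho> t * v \<theta>)" for m t \<theta>
  have F_bound: "\<bar>u \<theta> + \<rho> t * v \<theta>\<bar> \<le> 1 + B" if "t \<in> {0..H}" for t \<theta>
  proof -
    have "\<bar>\<rho> t * v \<theta>\<bar> \<le> B * 1"
      unfolding abs_mult using B0 B that uv(2)[of \<theta>] by (intro mult_mono) auto
    then show ?thesis using uv(1)[of \<theta>] by auto
  qed
  have F_lip: "\<bar>(u \<theta> + \<rho> t * v \<theta>) - (u \<eta> + \<rho> t * v \<eta>)\<bar> \<le> \<Lambda> * (1 + B) * \<bar>\<theta> - \<eta>\<bar>"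
    if "t \<in> {0..H}" for t \<theta> \<eta>
  proof -
    have "\<bar>\<rho> t * (v \<theta> - v \<eta>)\<bar> \<le> B * (\<Lambda> * \<bar>\<theta> - \<eta>\<bar>)"
      unfolding abs_mult using B0 B that lip(2) by (intro mult_mono) auto
    moreover have "\<bar>u \<theta> - u \<eta>\<bar> \<le> \<Lambda> * \<bar>\<theta> - \<eta>\<bar>" by (rule lip)
    moreover have "(u \<theta> + \<rho> t * v \<theta>) - (u \<eta> + \<rho> t * v \<eta>) = (u \<theta> - u \<eta>) + \<rho> t * (v \<theta> - v \<eta>)"
      by (simp add: algebra_simps)
    moreover have "\<Lambda> * (1 + B) * \<bar>\<theta> - \<eta>\<bar> = \<Lambda> * \<bar>\<theta> - \<eta>\<bar> + B * (\<Lambda> * \<bar>\<theta> - \<eta>\<bar>)"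
      by (simp add: algebra_simps)
    ultimately show ?thesis by linarith
  qed
  have f_cont: "co_countable 0 H (isCont (\<lambda>t. f m t (\<beta> t)))" if "continuous_on UNIV \<beta>" for m \<beta>
  proof (rule co_countable_mono[OF cont\<rho> order_refl order_refl])
    fix x assume "isCont \<rho> x"
    moreover have "isCont \<beta> x" using that by (simp add: continuous_on_eq_continuous_at)
    ultimately show "isCont (\<lambda>t. f m t (\<beta> t)) x"
      unfolding f_def
      by (intro continuous_intros isCont_o2[OF _ contu] isCont_o2[OF _ contv])
  qed
  have f_bound: "\<bar>f m t \<theta>\<bar> \<le> \<bar>m\<bar> * (1 + B)" if "t \<in> {0..H}" for m t \<theta>
    unfolding f_def abs_mult[of m] using F_bound[OF that] by (intro mult_left_mono) auto
  have "\<exists>\<alpha>. continuous_on UNIV \<alpha> \<and> (\<forall>x\<in>{0..H}. \<alpha> x = integral {0..x} (\<lambda>t. f m t (\<alpha> t)))" for m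
  proof (rule integral_equation_solvable[OF assms(1)])
    show "\<bar>f m t \<theta>\<bar> \<le> \<bar>m\<bar> * (1 + B)" if "t \<in> {0..H}" for t \<theta> by (rule f_bound[OF that])
    show "\<bar>f m t \<theta> - f m t \<eta>\<bar> \<le> \<bar>m\<bar> * (\<Lambda> * (1 + B)) * \<bar>\<theta> - \<eta>\<bar>" if "t \<in> {0..H}" for t \<theta> \<eta>
    proof -
      have "\<bar>f m t \<theta> - f m t \<eta>\<bar> = \<bar>m\<bar> * \<bar>(u \<theta> + \<rho> t * v \<theta>) - (u \<eta> + \<rho> t * v \<eta>)\<bar>"
        unfolding f_def by (simp add: abs_mult[symmetric] right_diff_distrib)
      also have "\<dots> \<le> \<bar>m\<bar> * (\<Lambda> * (1 + B) * \<bar>\<theta> - \<eta>\<bar>)"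
        by (intro mult_left_mono F_lip that) auto
      finally show ?thesis by (simp add: mult_ac)
    qed
  qed (rule f_cont)
  then obtain \<alpha> where \<alpha>: "\<And>m. continuous_on UNIV (\<alpha> m)"
    "\<And>m x. x \<in> {0..H} \<Longrightarrow> \<alpha> m x = integral {0..x} (\<lambda>t. f m t (\<alpha> m t))" by metis
  have cont\<alpha>: "continuous_on S (\<alpha> m)" for m S
    using \<alpha>(1) by (rule continuous_on_subset) auto
  have zero: "\<alpha> m 0 = 0" for m using \<alpha>(2)[of 0 m] assms(1) by simp
  have deriv: "co_countable 0 H (\<lambda>x. (\<alpha> m has_real_derivative f m x (\<alpha> m x)) (at x))" for m
  proof -
    have "co_countable 0 H (\<lambda>x. ((\<lambda>x. integral {0..x} (\<lambda>t. f m t (\<alpha> m t))) has_real_derivative f m x (\<alpha> m x)) (at x))"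
      by (rule indefinite_integral_co_countable(2)[OF f_bound f_cont[OF \<alpha>(1)]])
    then show ?thesis
    proof (rule co_countable_mono)
      fix x assume x: "x \<in> {0<..<H}" and
        "((\<lambda>x. integral {0..x} (\<lambda>t. f m t (\<alpha> m t))) has_real_derivative f m x (\<alpha> m x)) (at x)"
      from this(2) show "(\<alpha> m has_real_derivative f m x (\<alpha> m x)) (at x)"
        by (rule has_field_derivative_transform_within_open[OF _ open_greaterThanLessThan x])
          (rule \<alpha>(2)[symmetric], simp)
    qed auto
  qed
  have continuous_m: "continuous_on {0..M} (\<lambda>m. \<alpha> m H)" for M
    unfolding continuous_on_def
  proof
    fix m assume "m \<in> {0..M}"
    then have m: "m \<ge> 0" by simp
    define A where "A = 2 * m * (\<Lambda> * (1 + B)) + 1"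
    have est: "\<bar>\<alpha> m' H - \<alpha> m H\<bar> \<le> sqrt (exp (A * H)) * ((1 + B) * \<bar>m' - m\<bar>)" for m'
    proof -
      define k where "k = (1 + B) * \<bar>m' - m\<bar>"
      have k: "k \<ge> 0" using B by (simp add: k_def)
      \<comment> \<open>Here \<open>k\<close> bounds the effect of changing the parameter. Adding
        its square absorbs the cross term \<open>2 * \<bar>\<delta>\<bar> * k\<close>, and since
        \<open>G 0\<close> equals that square, Gronwall yields a bound linear in
        \<open>\<bar>m' - m\<bar>\<close>.\<close>
      define G where "G x = (\<alpha> m' x - \<alpha> m x)\<^sup>2 + k\<^sup>2" for x
      have "co_countable 0 H (\<lambda>x. \<exists>d\<le>A * G x. (G has_real_derivative d) (at x))"
      proof (rule co_countable_elim[OF deriv[of m'] deriv[of m]])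
        fix x assume x: "x \<in> {0<..<H}" and d: "(\<alpha> m' has_real_derivative f m' x (\<alpha> m' x)) (at x)"
          "(\<alpha> m has_real_derivative f m x (\<alpha> m x)) (at x)"
        define \<delta> where "\<delta> = \<alpha> m' x - \<alpha> m x"
        have "(G has_real_derivative 2 * \<delta> * (f m' x (\<alpha> m' x) - f m x (\<alpha> m x))) (at x)"
          unfolding G_def \<delta>_def using DERIV_power[OF DERIV_diff[OF d], of 2]
          by (auto intro!: derivative_eq_intros d)
        moreover have "2 * \<delta> * (f m' x (\<alpha> m' x) - f m x (\<alpha> m x)) \<le> A * G x"
        proof -
          let ?F = "\<lambda>\<theta>. u \<theta> + \<rho> x * v \<theta>"
          have x': "x \<in> {0..H}" using x by auto
          have "f m' x (\<alpha> m' x) - f m x (\<alpha> m x) = (m' - m) * ?F (\<alpha> m' x) + m * (?F (\<alpha> m' x) - ?F (\<alpha> m x))"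
            by (simp add: f_def algebra_simps)
          also have "\<bar>\<dots>\<bar> \<le> k + m * (\<Lambda> * (1 + B) * \<bar>\<delta>\<bar>)"
          proof (rule order_trans[OF abs_triangle_ineq add_mono])
            have "\<bar>m' - m\<bar> * \<bar>?F (\<alpha> m' x)\<bar> \<le> \<bar>m' - m\<bar> * (1 + B)"
              by (intro mult_left_mono F_bound x') auto
            then show "\<bar>(m' - m) * ?F (\<alpha> m' x)\<bar> \<le> k" by (simp add: abs_mult k_def mult.commute)
            have "m * \<bar>?F (\<alpha> m' x) - ?F (\<alpha> m x)\<bar> \<le> m * (\<Lambda> * (1 + B) * \<bar>\<delta>\<bar>)"
              unfolding \<delta>_def by (intro mult_left_mono F_lip x' m)
            then show "\<bar>m * (?F (\<alpha> m' x) - ?F (\<alpha> m x))\<bar> \<le> m * (\<Lambda> * (1 + B) * \<bar>\<delta>\<bar>)"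
              using m by (simp add: abs_mult)
          qed
          finally have le: "\<bar>f m' x (\<alpha> m' x) - f m x (\<alpha> m x)\<bar> \<le> k + m * (\<Lambda> * (1 + B) * \<bar>\<delta>\<bar>)" .
          have "2 * \<delta> * (f m' x (\<alpha> m' x) - f m x (\<alpha> m x)) \<le> 2 * \<bar>\<delta>\<bar> * \<bar>f m' x (\<alpha> m' x) - f m x (\<alpha> m x)\<bar>"
            by (metis abs_ge_self abs_mult abs_numeral)
          also have "\<dots> \<le> 2 * \<bar>\<delta>\<bar> * (k + m * (\<Lambda> * (1 + B) * \<bar>\<delta>\<bar>))"
            by (intro mult_left_mono le) auto
          also have "\<dots> = 2 * \<bar>\<delta>\<bar> * k + 2 * m * (\<Lambda> * (1 + B)) * (\<bar>\<delta>\<bar> * \<bar>\<delta>\<bar>)"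
            by (simp only: distrib_left mult_ac)
          also have "\<bar>\<delta>\<bar> * \<bar>\<delta>\<bar> = \<delta>\<^sup>2" by (simp add: power2_eq_square)
          also have "2 * \<bar>\<delta>\<bar> * k \<le> \<delta>\<^sup>2 + k\<^sup>2"
            using sum_squares_bound[of "\<bar>\<delta>\<bar>" k] by simp
          finally have "2 * \<delta> * (f m' x (\<alpha> m' x) - f m x (\<alpha> m x)) \<le>
              A * \<delta>\<^sup>2 + k\<^sup>2" by (simp add: A_def algebra_simps)
          also have "k\<^sup>2 \<le> A * k\<^sup>2"
            using m assms(3) B by (simp add: A_def mult_le_cancel_right1)
          finally show ?thesis by (simp add: G_def \<delta>_def distrib_left)
        qed
        ultimately show "\<exists>d\<le>A * G x. (G has_real_derivative d) (at x)" by blast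
      qed
      then obtain S where S: "countable S" "\<forall>x\<in>{0<..<H} - S. \<exists>d\<le>A * G x. (G has_real_derivative d) (at x)"
        by (auto simp: co_countable_def)
      have "G H \<le> exp (A * (H - 0)) * G 0"
      proof (rule gronwall_off_countable[OF _ S(1)])
        show "continuous_on {0..H} G" unfolding G_def by (intro continuous_intros cont\<alpha>)
      qed (use S(2) assms(1) in auto)
      then have "(\<alpha> m' H - \<alpha> m H)\<^sup>2 + k\<^sup>2 \<le> exp (A * H) * k\<^sup>2"
        by (simp add: G_def zero)
      then have "(\<alpha> m' H - \<alpha> m H)\<^sup>2 \<le> exp (A * H) * k\<^sup>2"
        using zero_le_power2[of k] by linarith
      then have "sqrt ((\<alpha> m' H - \<alpha> m H)\<^sup>2) \<le> sqrt (exp (A * H) * k\<^sup>2)" by (rule real_sqrt_le_mono)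
      then show ?thesis using k by (simp add: real_sqrt_mult k_def)
    qed
    have "((\<lambda>m'. \<alpha> m' H - \<alpha> m H) \<longlongrightarrow> 0) (at m within {0..M})"
    proof (rule Lim_null_comparison)
      show "eventually (\<lambda>m'. norm (\<alpha> m' H - \<alpha> m H) \<le> sqrt (exp (A * H)) * ((1 + B) * \<bar>m' - m\<bar>)) (at m within {0..M})"
        using est by simp
      have "((\<lambda>m'. sqrt (exp (A * H)) * ((1 + B) * \<bar>m' - m\<bar>)) \<longlongrightarrow> sqrt (exp (A * H)) * ((1 + B) * \<bar>m - m\<bar>)) (at m within {0..M})"
        by (intro tendsto_intros)
      then show "((\<lambda>m'. sqrt (exp (A * H)) * ((1 + B) * \<bar>m' - m\<bar>)) \<longlongrightarrow> 0) (at m within {0..M})" by simp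
    qed
    then show "((\<lambda>m'. \<alpha> m' H) \<longlongrightarrow> \<alpha> m H) (at m within {0..M})"
      using Lim_null by blast
  qed
  obtain c where c: "c > 0" "co_countable (H / 4) (H / 3) (\<lambda>x. \<rho> x \<ge> c)"
    using \<rho> by (auto simp: nice_density_def)
  define c1 where "c1 = min 1 c"
  have c1: "c1 > 0" "c1 \<le> 1" "c1 \<le> c" using c(1) by (auto simp: c1_def)
  \<comment> \<open>The lower bound on the density is used only between \<open>H / 4\<close> and
    \<open>H / 3\<close>, a length of \<open>H / 12\<close>: there the speed is at least
    \<open>m * c1 * (u + v)\<close>, and elsewhere the angle does not decrease.\<close>
  have growth: "\<alpha> m H \<ge> m * c1 * (H / 12)" if m: "m \<ge> 0" for m
  proof -
    have mono: "\<alpha> m a \<le> \<alpha> m b" if ab: "0 \<le> a" "a \<le> b" "b \<le> H" for a b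
    proof -
      have "co_countable a b (\<lambda>x. \<exists>d\<ge>0. (\<alpha> m has_real_derivative d) (at x))"
      proof (rule co_countable_mono[OF co_countable_conj[OF deriv[of m] pos]])
        fix x assume "(\<alpha> m has_real_derivative f m x (\<alpha> m x)) (at x) \<and> 0 < \<rho> x"
        moreover have "f m x (\<alpha> m x) \<ge> 0" if "0 < \<rho> x"
          unfolding f_def using m that uv(1,2)[of "\<alpha> m x"] by auto
        ultimately show "\<exists>d\<ge>0. (\<alpha> m has_real_derivative d) (at x)" by blast
      qed (use ab in auto)
      then obtain S where "countable S" "\<forall>x\<in>{a<..<b} - S. \<exists>d\<ge>0. (\<alpha> m has_real_derivative d) (at x)"
        by (auto simp: co_countable_def)
      then show ?thesis
        by (intro nonneg_deriv_off_countable_imp_le[OF ab(2) _ cont\<alpha>]) auto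
    qed
    let ?g = "\<lambda>x. \<alpha> m x - m * c1 * x"
    have "co_countable (H / 4) (H / 3) (\<lambda>x. \<exists>d\<ge>0. (?g has_real_derivative d) (at x))"
    proof (rule co_countable_elim[OF co_countable_mono[OF deriv[of m]] c(2)])
      fix x assume d: "(\<alpha> m has_real_derivative f m x (\<alpha> m x)) (at x)" and "c \<le> \<rho> x"
      have "c1 * 1 \<le> c1 * (u (\<alpha> m x) + v (\<alpha> m x))"
        using uv(3) c1 by (intro mult_left_mono) auto
      also have "\<dots> \<le> u (\<alpha> m x) + \<rho> x * v (\<alpha> m x)"
        using uv(1,2)[of "\<alpha> m x"] c1 \<open>c \<le> \<rho> x\<close> unfolding distrib_left
        by (intro add_mono mult_right_mono) (auto simp: mult_left_le_one_le)
      finally have "m * c1 \<le> f m x (\<alpha> m x)"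
        using m unfolding f_def by (intro mult_left_mono) auto
      then have "f m x (\<alpha> m x) - m * c1 \<ge> 0" by simp
      moreover have "(?g has_real_derivative f m x (\<alpha> m x) - m * c1) (at x)"
        using d by (auto intro!: derivative_eq_intros)
      ultimately show "\<exists>d\<ge>0. (?g has_real_derivative d) (at x)" by blast
    qed (use assms(1) in auto)
    then obtain S where "countable S" "\<forall>x\<in>{H / 4<..<H / 3} - S. \<exists>d\<ge>0. (?g has_real_derivative d) (at x)"
      by (auto simp: co_countable_def)
    then have "?g (H / 4) \<le> ?g (H / 3)"
      using assms(1) by (intro nonneg_deriv_off_countable_imp_le[of _ _ S ?g]) (auto intro!: continuous_intros cont\<alpha>)
    moreover have "\<alpha> m 0 \<le> \<alpha> m (H / 4)" "\<alpha> m (H / 3) \<le> \<alpha> m H"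
      using assms(1) by (auto intro!: mono)
    moreover have "m * c1 * (H / 3) - m * c1 * (H / 4) = m * c1 * (H / 12)"
      by (simp add: algebra_simps)
    ultimately show ?thesis using zero[of m] by linarith
  qed
  define M where "M = N / (c1 * (H / 12))"
  have M: "M > 0" using N c1 assms(1) by (simp add: M_def)
  have "\<alpha> 0 H \<le> N"
    using \<alpha>(2)[of H 0] assms(1) N by (simp add: f_def)
  moreover have "N \<le> \<alpha> M H"
    using growth[of M] M c1 assms(1) by (simp add: M_def)
  ultimately obtain m where m: "0 \<le> m" "\<alpha> m H = N"
    using IVT'[of "\<lambda>m. \<alpha> m H" 0 N M] M continuous_m by auto
  \<comment> \<open>For \<open>m = 0\<close> the angle stays at \<open>0\<close>, below
    \<open>N\<close>.\<close>
  have "m \<noteq> 0"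
    using \<alpha>(2)[of H 0] assms(1) N m by (auto simp: f_def)
  with m have "m > 0" by simp
  then show ?thesis
    using cont\<alpha> zero m(2) deriv[of m] by (auto simp: f_def intro!: exI[of _ m] exI[of _ "\<alpha> m"])
qed

text \<open>The pair \<open>(wave_y, wave_w)\<close> runs around the boundary of the square \<open>[-1, 1]\<^sup>2\<close>, with speed
  \<open>1\<close> on the edges \<open>w = 1\<close>, \<open>w = - 1\<close> and speed \<open>p - 1\<close> on the edges \<open>y = 1\<close>, \<open>y = - 1\<close>.\<close>

definition half_period :: "real \<Rightarrow> real" where
  "half_period p = 2 + 2 / (p - 1)"

definition unit_clamp :: "real \<Rightarrow> real" where
  "unit_clamp x = max (- 1) (min 1 x)"

text \<open>Meant for one turn only, \<theta> between \<open>0\<close> and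
  \<open>2 * half_period p\<close>: a tent over the first half turn, continued downwards, and in the
  last unit the branch that returns to \<open>0\<close>. Clamping produces the flat edges.\<close>

definition wave_y :: "real \<Rightarrow> real \<Rightarrow> real" where
  "wave_y p \<theta> = unit_clamp (max (min \<theta> (half_period p - \<theta>)) (\<theta> - 2 * half_period p))"

definition wave_w :: "real \<Rightarrow> real \<Rightarrow> real" where
  "wave_w p \<theta> = unit_clamp (max (1 - (p - 1) * (\<theta> - 1)) ((p - 1) * (\<theta> - half_period p - 1) - 1))"

text \<open>At a corner, where the curve has no derivative, the value is that of the next edge;
  there only its boundedness matters.\<close>

definition wave_y' :: "real \<Rightarrow> real \<Rightarrow> real" where
  "wave_y' p \<theta> = (if \<theta> < 1 then 1 else if \<theta> < half_period p - 1 then 0 else if \<theta> < half_period p + 1 then - 1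
     else if \<theta> < 2 * half_period p - 1 then 0 else 1)"

definition wave_w' :: "real \<Rightarrow> real \<Rightarrow> real" where
  "wave_w' p \<theta> = (if \<theta> < 1 then 0 else if \<theta> < half_period p - 1 then - (p - 1) else if \<theta> < half_period p + 1 then 0
     else if \<theta> < 2 * half_period p - 1 then p - 1 else 0)"

definition wave_corners :: "real \<Rightarrow> real set" where
  "wave_corners p = {1, half_period p - 1, half_period p + 1, 2 * half_period p - 1}"

lemma half_period_gt:
  assumes "p > 1"
  shows "half_period p > 2" "(p - 1) * (half_period p - 2) = 2"
proof -
  have "(p - 1) * (2 / (p - 1)) = 2"
    using assms nonzero_mult_div_cancel_left[of "p - 1" 2] by (simp only: times_divide_eq_right)
  then show "(p - 1) * (half_period p - 2) = 2" by (simp only: half_period_def add_diff_cancel_left')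
qed (use assms in \<open>simp add: half_period_def\<close>)

lemma wave_w_slope:
  assumes "p > 1"
  shows "\<theta> \<le> 1 \<Longrightarrow> (p - 1) * (\<theta> - 1) \<le> 0" "1 \<le> \<theta> \<Longrightarrow> 0 \<le> (p - 1) * (\<theta> - 1)"
    "\<theta> \<le> half_period p - 1 \<Longrightarrow> (p - 1) * (\<theta> - 1) \<le> 2" "half_period p - 1 \<le> \<theta> \<Longrightarrow> 2 \<le> (p - 1) * (\<theta> - 1)"
    and "(p - 1) * (\<theta> - half_period p - 1) = (p - 1) * ((\<theta> - half_period p) - 1)"
proof -
  show "(p - 1) * (\<theta> - 1) \<le> 0" if "\<theta> \<le> 1" using assms that by (simp add: mult_nonneg_nonpos)
  show "0 \<le> (p - 1) * (\<theta> - 1)" if "1 \<le> \<theta>" using assms that by simp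
  show "(p - 1) * (\<theta> - 1) \<le> 2" if "\<theta> \<le> half_period p - 1"
    using mult_left_mono[of "\<theta> - 1" "half_period p - 2" "p - 1"] half_period_gt[OF assms] that assms by simp
  show "2 \<le> (p - 1) * (\<theta> - 1)" if "half_period p - 1 \<le> \<theta>"
    using mult_left_mono[of "half_period p - 2" "\<theta> - 1" "p - 1"] half_period_gt[OF assms] that assms by simp
qed simp

lemma wave_values:
  assumes "p > 1"
  shows "\<theta> \<in> {0..1} \<Longrightarrow> wave_y p \<theta> = \<theta>" "\<theta> \<le> 1 \<Longrightarrow> wave_w p \<theta> = 1"
    "\<theta> \<in> {1..half_period p - 1} \<Longrightarrow> wave_y p \<theta> = 1"
    "\<theta> \<in> {1..half_period p - 1} \<Longrightarrow> wave_w p \<theta> = 1 - (p - 1) * (\<theta> - 1)"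
    "\<theta> \<in> {half_period p - 1..half_period p + 1} \<Longrightarrow> wave_y p \<theta> = half_period p - \<theta>"
    "\<theta> \<in> {half_period p - 1..half_period p + 1} \<Longrightarrow> wave_w p \<theta> = - 1"
    "\<theta> \<in> {half_period p + 1..2 * half_period p - 1} \<Longrightarrow> wave_y p \<theta> = - 1"
    "\<theta> \<in> {half_period p + 1..2 * half_period p - 1} \<Longrightarrow> wave_w p \<theta> = (p - 1) * (\<theta> - half_period p - 1) - 1"
    "\<theta> \<in> {2 * half_period p - 1..2 * half_period p} \<Longrightarrow> wave_y p \<theta> = \<theta> - 2 * half_period p"
    "2 * half_period p - 1 \<le> \<theta> \<Longrightarrow> wave_w p \<theta> = 1"
  using half_period_gt(1)[OF assms] wave_w_slope(1-4)[OF assms, of \<theta>]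
    wave_w_slope(1-4)[OF assms, of "\<theta> - half_period p"] wave_w_slope(5)[of p \<theta>]
  by (auto simp: wave_y_def wave_w_def unit_clamp_def min_def max_def)

lemma affine_on_interval_deriv:
  fixes f :: "real \<Rightarrow> real"
  assumes "\<And>x. x \<in> {l<..<r} \<Longrightarrow> f x = a + b * x" "x \<in> {l<..<r}"
  shows "(f has_real_derivative b) (at x)"
proof -
  have "((\<lambda>x. a + b * x) has_real_derivative b) (at x)"
    by (auto intro!: derivative_eq_intros)
  then show ?thesis
    by (rule has_field_derivative_transform_within_open[OF _ open_greaterThanLessThan assms(2)])
      (use assms(1) in auto)
qed

text \<open>The third claim is a Wronskian-type invariant. The speeds on the two kinds of edges are
  chosen so that it has the same value on all of them; it decouples the angle from the
  amplitude.\<close>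

lemma wave_regular_point:
  assumes "p > 1" and \<theta>: "\<theta> \<in> {0<..<2 * half_period p} - wave_corners p"
  shows "(wave_y p has_real_derivative wave_y' p \<theta>) (at \<theta>)"
    and "(wave_w p has_real_derivative wave_w' p \<theta>) (at \<theta>)"
    and "wave_y p \<theta> * wave_w' p \<theta> - (p - 1) * wave_w p \<theta> * wave_y' p \<theta> = - (p - 1)"
    and "isCont (wave_y' p) \<theta>" "isCont (wave_w' p) \<theta>"
proof -
  note hp = half_period_gt(1)[OF assms(1)]
  have main: "(wave_y p has_real_derivative wave_y' p \<theta>) (at \<theta>) \<and>
      (wave_w p has_real_derivative wave_w' p \<theta>) (at \<theta>) \<and>
      wave_y p \<theta> * wave_w' p \<theta> - (p - 1) * wave_w p \<theta> * wave_y' p \<theta> = - (p - 1) \<and>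
      isCont (wave_y' p) \<theta> \<and> isCont (wave_w' p) \<theta>"
    if \<theta>: "\<theta> \<in> {l<..<r}"
      and y: "\<And>x. x \<in> {l<..<r} \<Longrightarrow> wave_y p x = a + b * x" and w: "\<And>x. x \<in> {l<..<r} \<Longrightarrow> wave_w p x = c + d * x"
      and y': "\<And>x. x \<in> {l<..<r} \<Longrightarrow> wave_y' p x = b" and w': "\<And>x. x \<in> {l<..<r} \<Longrightarrow> wave_w' p x = d"
      and id: "wave_y p \<theta> * d - (p - 1) * wave_w p \<theta> * b = - (p - 1)" for l r a b c d
  proof -
    have "(wave_y' p has_real_derivative 0) (at \<theta>)" "(wave_w' p has_real_derivative 0) (at \<theta>)"
      using affine_on_interval_deriv[of l r "wave_y' p" b 0 \<theta>] affine_on_interval_deriv[of l r "wave_w' p" d 0 \<theta>]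
        \<theta> y' w' by simp_all
    then show ?thesis
      using affine_on_interval_deriv[OF y \<theta>] affine_on_interval_deriv[OF w \<theta>] y'[OF \<theta>] w'[OF \<theta>] id
      by (auto dest: DERIV_isCont)
  qed
  consider "\<theta> \<in> {0<..<1}" | "\<theta> \<in> {1<..<half_period p - 1}" | "\<theta> \<in> {half_period p - 1<..<half_period p + 1}"
    | "\<theta> \<in> {half_period p + 1<..<2 * half_period p - 1}" | "\<theta> \<in> {2 * half_period p - 1<..<2 * half_period p}"
    using \<theta> by (fastforce simp: wave_corners_def)
  then have "(wave_y p has_real_derivative wave_y' p \<theta>) (at \<theta>) \<and>
      (wave_w p has_real_derivative wave_w' p \<theta>) (at \<theta>) \<and>
      wave_y p \<theta> * wave_w' p \<theta> - (p - 1) * wave_w p \<theta> * wave_y' p \<theta> = - (p - 1) \<and>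
      isCont (wave_y' p) \<theta> \<and> isCont (wave_w' p) \<theta>"
  proof cases
    case 1
    show ?thesis
      by (rule main[OF 1, of 0 1 1 0])
        (use 1 hp in \<open>auto simp: wave_values[OF assms(1)] wave_y'_def wave_w'_def\<close>)
  next
    case 2
    show ?thesis
      by (rule main[OF 2, of 1 0 p "- (p - 1)"])
        (use 2 hp in \<open>auto simp: wave_values[OF assms(1)] wave_y'_def wave_w'_def algebra_simps\<close>)
  next
    case 3
    show ?thesis
      by (rule main[OF 3, of "half_period p" "- 1" "- 1" 0])
        (use 3 hp in \<open>auto simp: wave_values[OF assms(1)] wave_y'_def wave_w'_def\<close>)
  next
    case 4
    show ?thesis
      by (rule main[OF 4, of "- 1" 0 "- (p - 1) * (half_period p + 1) - 1" "p - 1"])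
        (use 4 hp in \<open>auto simp: wave_values[OF assms(1)] wave_y'_def wave_w'_def algebra_simps\<close>)
  next
    case 5
    show ?thesis
      by (rule main[OF 5, of "- 2 * half_period p" 1 1 0])
        (use 5 hp in \<open>auto simp: wave_values[OF assms(1)] wave_y'_def wave_w'_def\<close>)
  qed
  then show "(wave_y p has_real_derivative wave_y' p \<theta>) (at \<theta>)"
    and "(wave_w p has_real_derivative wave_w' p \<theta>) (at \<theta>)"
    and "wave_y p \<theta> * wave_w' p \<theta> - (p - 1) * wave_w p \<theta> * wave_y' p \<theta> = - (p - 1)"
    and "isCont (wave_y' p) \<theta>" "isCont (wave_w' p) \<theta>"
    by auto
qed

lemma wave_abs_le: "\<bar>wave_y p \<theta>\<bar> \<le> 1" "\<bar>wave_w p \<theta>\<bar> \<le> 1"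
  by (auto simp: wave_y_def wave_w_def unit_clamp_def)

lemma wave_max:
  assumes "p > 1"
  shows "\<bar>wave_y p \<theta>\<bar> = 1 \<or> \<bar>wave_w p \<theta>\<bar> = 1"
proof -
  consider "\<theta> \<le> 1" | "\<theta> \<in> {1..half_period p - 1}" | "\<theta> \<in> {half_period p - 1..half_period p + 1}"
    | "\<theta> \<in> {half_period p + 1..2 * half_period p - 1}" | "2 * half_period p - 1 \<le> \<theta>"
    by fastforce
  then show ?thesis
    by cases (simp_all add: wave_values[OF assms])
qed

lemma wave_lipschitz:
  assumes "p > 1"
  shows "\<bar>wave_y p \<theta> - wave_y p \<eta>\<bar> \<le> \<bar>\<theta> - \<eta>\<bar>" "\<bar>wave_w p \<theta> - wave_w p \<eta>\<bar> \<le> (p - 1) * \<bar>\<theta> - \<eta>\<bar>"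
proof -
  have clamp: "\<bar>unit_clamp a - unit_clamp b\<bar> \<le> \<bar>a - b\<bar>" for a b
    by (auto simp: unit_clamp_def min_def max_def)
  have mx: "\<bar>max a b - max c d\<bar> \<le> e" if "\<bar>a - c\<bar> \<le> e" "\<bar>b - d\<bar> \<le> e" for a b c d e :: real
    using that by (auto simp: max_def abs_le_iff)
  have mn: "\<bar>min a b - min c d\<bar> \<le> e" if "\<bar>a - c\<bar> \<le> e" "\<bar>b - d\<bar> \<le> e" for a b c d e :: real
    using that by (auto simp: min_def abs_le_iff)
  show "\<bar>wave_y p \<theta> - wave_y p \<eta>\<bar> \<le> \<bar>\<theta> - \<eta>\<bar>"
    unfolding wave_y_def by (intro order_trans[OF clamp] mx mn) auto
  have lin: "\<bar>(p - 1) * a - (p - 1) * b\<bar> = (p - 1) * \<bar>a - b\<bar>" for a b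
    using assms by (simp add: right_diff_distrib[symmetric] abs_mult)
  show "\<bar>wave_w p \<theta> - wave_w p \<eta>\<bar> \<le> (p - 1) * \<bar>\<theta> - \<eta>\<bar>"
    unfolding wave_w_def
  proof (intro order_trans[OF clamp] mx)
    show "\<bar>1 - (p - 1) * (\<theta> - 1) - (1 - (p - 1) * (\<eta> - 1))\<bar> \<le> (p - 1) * \<bar>\<theta> - \<eta>\<bar>"
      using lin[of "\<eta> - 1" "\<theta> - 1"] by (simp add: abs_minus_commute)
    show "\<bar>(p - 1) * (\<theta> - half_period p - 1) - 1 - ((p - 1) * (\<eta> - half_period p - 1) - 1)\<bar> \<le> (p - 1) * \<bar>\<theta> - \<eta>\<bar>"
      using lin[of "\<theta> - half_period p - 1" "\<eta> - half_period p - 1"] by simp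
  qed
qed

lemma abs_powr_lipschitz_unit:
  fixes a b r :: real
  assumes "r > 1" "\<bar>a\<bar> \<le> 1" "\<bar>b\<bar> \<le> 1"
  shows "\<bar>\<bar>a\<bar> powr r - \<bar>b\<bar> powr r\<bar> \<le> r * \<bar>a - b\<bar>"
proof (rule lipschitz_off_countable[of "{}" "- 1" 1 "\<lambda>x. \<bar>x\<bar> powr r"])
  show "continuous_on {- 1..1} (\<lambda>x::real. \<bar>x\<bar> powr r)"
    using assms(1) by (intro continuous_on_abs_powr continuous_intros)
  fix x :: real assume "x \<in> {- 1<..<1} - {}"
  then have "\<bar>signed_pow r x\<bar> \<le> 1 powr (r - 1)"
    unfolding abs_signed_pow using assms(1) by (intro powr_mono2) auto
  then have "\<bar>r * signed_pow r x\<bar> \<le> r" using assms(1) by (simp add: abs_mult)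
  then show "\<exists>d. \<bar>d\<bar> \<le> r \<and> ((\<lambda>x. \<bar>x\<bar> powr r) has_real_derivative d) (at x)"
    using has_real_derivative_abs_powr[OF assms(1)] by blast
qed (use assms in auto)

text \<open>Equal values at two points would make \<open>f\<close> constant between them, against
  the positive derivative at a nonexceptional point.\<close>

lemma strict_mono_of_pos_deriv:
  fixes f :: "real \<Rightarrow> real"
  assumes cont: "continuous_on {a..b} f"
    and deriv: "co_countable a b (\<lambda>x. \<exists>d>0. (f has_real_derivative d) (at x))"
    and xy: "a \<le> x" "x < y" "y \<le> b"
  shows "f x < f y"
proof (rule ccontr)
  assume "\<not> f x < f y"
  obtain S where S: "countable S" "\<forall>x\<in>{a<..<b} - S. \<exists>d>0. (f has_real_derivative d) (at x)"
    using deriv by (auto simp: co_countable_def)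
  have mono: "f u \<le> f v" if "a \<le> u" "u \<le> v" "v \<le> b" for u v
  proof (rule nonneg_deriv_off_countable_imp_le[OF that(2) S(1)])
    show "continuous_on {u..v} f" by (rule continuous_on_subset[OF cont]) (use that in auto)
    fix x assume "x \<in> {u<..<v} - S"
    then have "x \<in> {a<..<b} - S" using that by auto
    then obtain d where "d > 0" "(f has_real_derivative d) (at x)" using S(2) by blast
    then show "\<exists>d\<ge>0. (f has_real_derivative d) (at x)" by (auto intro: less_imp_le)
  qed
  have const: "f u = f x" if "u \<in> {x<..<y}" for u
    using mono[of x u] mono[of u y] that xy \<open>\<not> f x < f y\<close> by auto
  have "co_countable x y (\<lambda>x. \<exists>d>0. (f has_real_derivative d) (at x))"
    by (rule co_countable_mono[OF deriv xy(1,3)])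
  then obtain u where u: "u \<in> {x<..<y}" "\<exists>d>0. (f has_real_derivative d) (at u)"
    using xy(2) by (rule co_countable_ex)
  then obtain d where d: "d > 0" "(f has_real_derivative d) (at u)" by blast
  have "(f has_real_derivative 0) (at u)"
    by (rule has_field_derivative_transform_within_open[OF DERIV_const open_greaterThanLessThan u(1)])
      (use const in auto)
  from DERIV_unique[OF this d(2)] d(1) show False by simp
qed

text \<open>Pruefer ansatz \<open>y = s * wave_y p \<alpha>\<close>,
  \<open>\<phi> = (m * s) powr (p - 1) * wave_w p \<alpha>\<close>. The equation for the angle does
  not contain the amplitude, which then solves a linear equation and is an exponential of an
  integral; the eigenvalue is \<open>m powr p\<close>. The bound on \<open>N\<close> keeps the angle
  within the one turn that the wave describes.\<close>

lemma wave_solution: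
  assumes "p > 1" "H > 0" and \<rho>: "nice_density H \<rho>" and N: "0 < N" "N \<le> 2 * half_period p"
  shows "\<exists>\<mu>>0. \<exists>y \<phi> \<alpha>. regular_sol p (\<lambda>x. \<mu> * \<rho> x) 0 H y \<phi> \<and> continuous_on {0..H} \<alpha> \<and>
    \<alpha> 0 = 0 \<and> \<alpha> H = N \<and> (\<forall>x y. 0 \<le> x \<longrightarrow> x < y \<longrightarrow> y \<le> H \<longrightarrow> \<alpha> x < \<alpha> y) \<and>
    (\<forall>x\<in>{0..H}. \<exists>s>0. y x = s * wave_y p (\<alpha> x))"
proof -
  let ?q = "p / (p - 1)"
  note q = conjugate_exponent[OF assms(1)]
  let ?u = "\<lambda>\<theta>. \<bar>wave_w p \<theta>\<bar> powr ?q" and ?v = "\<lambda>\<theta>. \<bar>wave_y p \<theta>\<bar> powr p"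
  have unit: "\<bar>a\<bar> powr r \<in> {0..1}" if "\<bar>a\<bar> \<le> 1" "r > 0" for a r :: real
    using powr_mono2[of r "\<bar>a\<bar>" 1] that by simp
  have "\<exists>m>0. \<exists>\<alpha>. continuous_on {0..H} \<alpha> \<and> \<alpha> 0 = 0 \<and> \<alpha> H = N \<and>
    co_countable 0 H (\<lambda>x. (\<alpha> has_real_derivative m * (?u (\<alpha> x) + \<rho> x * ?v (\<alpha> x))) (at x))"
  proof (rule angle_exists[OF assms(2) \<rho> _ _ _ _ _ _ N(1), of p])
    show "1 \<le> ?u \<theta> + ?v \<theta>" for \<theta>
      using wave_max[OF assms(1), of \<theta>] by (auto simp: add_increasing add_increasing2)
    show "\<bar>?u \<theta> - ?u \<eta>\<bar> \<le> p * \<bar>\<theta> - \<eta>\<bar>" for \<theta> \<eta>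
    proof -
      have "\<bar>?u \<theta> - ?u \<eta>\<bar> \<le> ?q * \<bar>wave_w p \<theta> - wave_w p \<eta>\<bar>"
        by (intro abs_powr_lipschitz_unit q wave_abs_le)
      also have "\<dots> \<le> ?q * ((p - 1) * \<bar>\<theta> - \<eta>\<bar>)"
        using q(1) by (intro mult_left_mono wave_lipschitz assms) auto
      also have "\<dots> = p * \<bar>\<theta> - \<eta>\<bar>" using assms(1) by simp
      finally show ?thesis .
    qed
    show "\<bar>?v \<theta> - ?v \<eta>\<bar> \<le> p * \<bar>\<theta> - \<eta>\<bar>" for \<theta> \<eta>
    proof -
      have "\<bar>?v \<theta> - ?v \<eta>\<bar> \<le> p * \<bar>wave_y p \<theta> - wave_y p \<eta>\<bar>"
        by (intro abs_powr_lipschitz_unit assms wave_abs_le)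
      also have "\<dots> \<le> p * \<bar>\<theta> - \<eta>\<bar>"
        using assms(1) by (intro mult_left_mono wave_lipschitz) auto
      finally show ?thesis .
    qed
  qed (use assms(1) q(1) in \<open>auto intro!: unit wave_abs_le simp del: atLeastAtMost_iff\<close>)
  then obtain m \<alpha> where m: "m > 0" and \<alpha>: "continuous_on {0..H} \<alpha>" "\<alpha> 0 = 0" "\<alpha> H = N"
    and d\<alpha>: "co_countable 0 H (\<lambda>x. (\<alpha> has_real_derivative m * (?u (\<alpha> x) + \<rho> x * ?v (\<alpha> x))) (at x))"
    by blast
  have pos\<rho>: "co_countable 0 H (\<lambda>x. \<rho> x > 0)" and cont\<rho>: "co_countable 0 H (isCont \<rho>)"
    using \<rho> by (auto simp: nice_density_def)
  obtain B where B: "\<forall>x\<in>{0..H}. \<bar>\<rho> x\<bar> \<le> B" using \<rho> by (auto simp: nice_density_def)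
  have "co_countable 0 H (\<lambda>x. \<exists>d>0. (\<alpha> has_real_derivative d) (at x))"
  proof (rule co_countable_elim[OF d\<alpha> pos\<rho>])
    fix x assume d: "(\<alpha> has_real_derivative m * (?u (\<alpha> x) + \<rho> x * ?v (\<alpha> x))) (at x)" and r: "\<rho> x > 0"
    have "?u (\<alpha> x) + \<rho> x * ?v (\<alpha> x) > 0"
      using wave_max[OF assms(1), of "\<alpha> x"]
    proof
      assume "\<bar>wave_y p (\<alpha> x)\<bar> = 1"
      then show ?thesis using r by (simp add: add_nonneg_pos)
    next
      assume "\<bar>wave_w p (\<alpha> x)\<bar> = 1"
      then show ?thesis using r by (simp add: add_pos_nonneg)
    qed
    then have "m * (?u (\<alpha> x) + \<rho> x * ?v (\<alpha> x)) > 0" using m by simp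
    with d show "\<exists>d>0. (\<alpha> has_real_derivative d) (at x)" by blast
  qed
  note strict = strict_mono_of_pos_deriv[OF \<alpha>(1) this]
  have range: "\<alpha> x \<in> {0<..<2 * half_period p}" if "x \<in> {0<..<H}" for x
    using strict[of 0 x] strict[of x H] that \<alpha>(2,3) N by auto
  \<comment> \<open>The angle is injective and meets each corner at most once, so the corners cost
    finitely many exceptional points.\<close>
  have corner: "co_countable 0 H (\<lambda>x. \<alpha> x \<notin> wave_corners p)"
  proof -
    have "inj_on \<alpha> {0..H}"
      by (rule linorder_inj_onI) (use strict in force)+
    then have "finite (\<alpha> -` wave_corners p \<inter> {0..H})"
      by (rule finite_vimage_IntI[rotated]) (simp add: wave_corners_def)
    then show ?thesis
      unfolding co_countable_def by (intro exI[of _ "\<alpha> -` wave_corners p \<inter> {0..H}"]) (auto intro: countable_finite)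
  qed
  \<comment> \<open>The logarithmic growth rate of the amplitude, divided by \<open>m\<close>:
    obtained by inserting the ansatz into the first equation of the system.\<close>
  define \<gamma> where "\<gamma> x = - (signed_pow ?q (wave_w p (\<alpha> x)) * wave_w' p (\<alpha> x) / (p - 1) +
    \<rho> x * (signed_pow p (wave_y p (\<alpha> x)) * wave_y' p (\<alpha> x)))" for x
  have spow1: "\<bar>signed_pow r a\<bar> \<le> 1" if "\<bar>a\<bar> \<le> 1" "r > 1" for a r :: real
    unfolding abs_signed_pow using powr_mono2[of "r - 1" "\<bar>a\<bar>" 1] that by simp
  have \<gamma>_bound: "\<bar>\<gamma> x\<bar> \<le> 1 * (p - 1) / (p - 1) + B * (1 * 1)" if x: "x \<in> {0..H}" for x
  proof -
    have "\<bar>\<gamma> x\<bar> \<le> \<bar>signed_pow ?q (wave_w p (\<alpha> x))\<bar> * \<bar>wave_w' p (\<alpha> x)\<bar> / (p - 1) +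
        \<bar>\<rho> x\<bar> * (\<bar>signed_pow p (wave_y p (\<alpha> x))\<bar> * \<bar>wave_y' p (\<alpha> x)\<bar>)"
      unfolding \<gamma>_def abs_minus_cancel using assms(1)
      by (intro order_trans[OF abs_triangle_ineq]) (simp add: abs_mult abs_divide)
    also have "\<dots> \<le> 1 * (p - 1) / (p - 1) + B * (1 * 1)"
      using assms(1) q(1) B x
      by (intro add_mono divide_right_mono mult_mono spow1 wave_abs_le)
        (auto simp: wave_y'_def wave_w'_def)
    finally show ?thesis .
  qed
  have \<alpha>_cont: "isCont \<alpha> x" if "x \<in> {0<..<H}" for x
    using continuous_on_interior[OF \<alpha>(1)] that by simp
  have wave_cont: "continuous_on S (wave_y p)" "continuous_on S (wave_w p)" for S
    unfolding wave_y_def wave_w_def unit_clamp_def by (intro continuous_intros)+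
  have cont_comp: "isCont (\<lambda>x. signed_pow r (g (\<alpha> x))) x"
    if "x \<in> {0<..<H}" "r > 1" "continuous_on UNIV g" for r g x
  proof (rule isCont_o2[OF \<alpha>_cont[OF that(1)]])
    show "isCont (\<lambda>\<theta>. signed_pow r (g \<theta>)) (\<alpha> x)"
      using continuous_on_signed_pow[OF that(2,3)] by (simp add: continuous_on_eq_continuous_at)
  qed
  have "co_countable 0 H (isCont \<gamma>)"
  proof (rule co_countable_elim[OF cont\<rho> corner])
    fix x assume x: "x \<in> {0<..<H}" and r: "isCont \<rho> x" and c: "\<alpha> x \<notin> wave_corners p"
    have "\<alpha> x \<in> {0<..<2 * half_period p} - wave_corners p" using range[OF x] c by simp
    note wp = wave_regular_point[OF assms(1) this]
    show "isCont \<gamma> x"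
      unfolding \<gamma>_def using assms(1)
      by (intro continuous_intros r cont_comp x q(1) wave_cont isCont_o2[OF \<alpha>_cont[OF x] wp(4)]
          isCont_o2[OF \<alpha>_cont[OF x] wp(5)]) auto
  qed
  note \<gamma>_int = indefinite_integral_co_countable[OF \<gamma>_bound this]
  define s where "s x = exp (m * integral {0..x} \<gamma>)" for x
  have s_pos: "s x > 0" for x by (simp add: s_def)
  have cont_s: "continuous_on {0..H} s"
    unfolding s_def by (intro continuous_intros \<gamma>_int(1))
  have ds: "co_countable 0 H (\<lambda>x. (s has_real_derivative m * \<gamma> x * s x) (at x))"
  proof (rule co_countable_mono[OF \<gamma>_int(2)])
    fix x assume "((\<lambda>x. integral {0..x} \<gamma>) has_real_derivative \<gamma> x) (at x)"
    from DERIV_chain2[OF DERIV_exp DERIV_cmult[OF this, of m]]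
    show "(s has_real_derivative m * \<gamma> x * s x) (at x)"
      by (simp add: s_def[abs_def] mult_ac)
  qed auto
  define y where "y x = s x * wave_y p (\<alpha> x)" for x
  define \<phi> where "\<phi> x = (m * s x) powr (p - 1) * wave_w p (\<alpha> x)" for x
  have cont_wave: "continuous_on {0..H} (\<lambda>x. wave_y p (\<alpha> x))" "continuous_on {0..H} (\<lambda>x. wave_w p (\<alpha> x))"
    using continuous_on_compose2[OF wave_cont(1) \<alpha>(1)] continuous_on_compose2[OF wave_cont(2) \<alpha>(1)] by auto
  have cont_\<phi>: "continuous_on {0..H} \<phi>"
    unfolding \<phi>_def using m s_pos[THEN less_imp_neq] by (intro continuous_intros cont_s cont_wave) auto
  have cont_y: "continuous_on {0..H} y"
    unfolding y_def by (intro continuous_intros cont_s cont_wave)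
  have \<phi>_q: "signed_pow ?q (\<phi> x) = m * s x * signed_pow ?q (wave_w p (\<alpha> x))" for x
  proof -
    have "m * s x > 0" using m s_pos by simp
    then have "(m * s x) powr (p - 1) = signed_pow p (m * s x)" by (simp add: signed_pow_of_nonneg)
    then show ?thesis
      unfolding \<phi>_def signed_pow_mult using signed_pow_signed_pow[OF q(3), of "m * s x"]
      by (simp only: signed_pow_mult)
  qed
  have "co_countable 0 H (\<lambda>x. (y has_real_derivative signed_pow ?q (\<phi> x)) (at x) \<and>
      (\<phi> has_real_derivative - (p - 1) * (m powr p * \<rho> x) * signed_pow p (y x)) (at x))"
  proof (rule co_countable_elim[OF co_countable_conj[OF ds d\<alpha>] corner])
    fix x assume x: "x \<in> {0<..<H}" and c: "\<alpha> x \<notin> wave_corners p"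
      and d: "(s has_real_derivative m * \<gamma> x * s x) (at x) \<and>
        (\<alpha> has_real_derivative m * (?u (\<alpha> x) + \<rho> x * ?v (\<alpha> x))) (at x)"
    have "\<alpha> x \<in> {0<..<2 * half_period p} - wave_corners p" using range[OF x] c by simp
    note wp = wave_regular_point[OF assms(1) this]
    define Y w Y' w' a b where "Y = wave_y p (\<alpha> x)" and "w = wave_w p (\<alpha> x)"
      and "Y' = wave_y' p (\<alpha> x)" and "w' = wave_w' p (\<alpha> x)"
      and "a = signed_pow ?q (wave_w p (\<alpha> x))" and "b = signed_pow p (wave_y p (\<alpha> x))"
    have uv: "?u (\<alpha> x) = w * a" "?v (\<alpha> x) = Y * b"
      by (simp_all add: w_def a_def Y_def b_def mult_signed_pow)
    have id: "Y * w' - (p - 1) * w * Y' = - (p - 1)"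
      using wp(3) by (simp add: Y_def w_def Y'_def w'_def)
    have \<gamma>x: "\<gamma> x = - (a * w' / (p - 1) + \<rho> x * (b * Y'))"
      by (simp add: \<gamma>_def a_def w'_def b_def Y'_def)
    have g: "(p - 1) * \<gamma> x = - (a * w' + (p - 1) * (\<rho> x * (b * Y')))"
      using assms(1) by (simp add: \<gamma>x field_simps)
    have dY: "((\<lambda>x. wave_y p (\<alpha> x)) has_real_derivative Y' * (m * (w * a + \<rho> x * (Y * b)))) (at x)"
      using DERIV_chain2[OF wp(1) conjunct2[OF d]] unfolding uv by (simp add: Y'_def)
    have dw: "((\<lambda>x. wave_w p (\<alpha> x)) has_real_derivative w' * (m * (w * a + \<rho> x * (Y * b)))) (at x)"
      using DERIV_chain2[OF wp(2) conjunct2[OF d]] unfolding uv by (simp add: w'_def)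
    have "(y has_real_derivative m * \<gamma> x * s x * Y + Y' * (m * (w * a + \<rho> x * (Y * b))) * s x) (at x)"
      unfolding y_def Y_def by (rule DERIV_mult[OF conjunct1[OF d] dY[unfolded Y_def]])
    moreover have "m * \<gamma> x * s x * Y + Y' * (m * (w * a + \<rho> x * (Y * b))) * s x = signed_pow ?q (\<phi> x)"
    proof -
      \<comment> \<open>The terms with the density cancel and \<open>- a\<close> times the invariant
        of \<open>id\<close> remains. In the equation for \<phi> below it is the terms without the
        density that cancel, so one rate serves both equations.\<close>
      have "(p - 1) * (\<gamma> x * Y + Y' * (w * a + \<rho> x * (Y * b))) = - a * (Y * w' - (p - 1) * w * Y')"
        unfolding distrib_left mult.assoc[symmetric] g by (simp add: algebra_simps)
      also have "\<dots> = (p - 1) * a" unfolding id by (simp add: algebra_simps)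
      finally have "\<gamma> x * Y + Y' * (w * a + \<rho> x * (Y * b)) = a" using assms(1) by simp
      then have "m * s x * (\<gamma> x * Y + Y' * (w * a + \<rho> x * (Y * b))) = m * s x * a" by simp
      then show ?thesis unfolding \<phi>_q a_def[symmetric] by (simp add: algebra_simps)
    qed
    moreover have "(\<phi> has_real_derivative - (p - 1) * (m powr p * \<rho> x) * signed_pow p (y x)) (at x)"
    proof -
      have ms: "m * s x > 0" using m s_pos by simp
      have "((\<lambda>x. m * s x) has_real_derivative m * (m * \<gamma> x * s x)) (at x)"
        by (rule DERIV_cmult[OF conjunct1[OF d]])
      from DERIV_chain2[OF has_real_derivative_powr[OF ms, of "p - 1"] this]
      have "((\<lambda>x. (m * s x) powr (p - 1)) has_real_derivative
          (p - 1) * (m * s x) powr (p - 1 - 1) * (m * (m * \<gamma> x * s x))) (at x)" .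
      also have "(p - 1) * (m * s x) powr (p - 1 - 1) * (m * (m * \<gamma> x * s x)) =
          (p - 1) * \<gamma> x * m * ((m * s x) powr (p - 1 - 1) * (m * s x))"
        by (simp add: mult_ac)
      also have "(m * s x) powr (p - 1 - 1) * (m * s x) = (m * s x) powr (p - 1)"
        using powr_add[of "m * s x" "p - 1 - 1" 1] ms by simp
      finally have "((\<lambda>x. (m * s x) powr (p - 1)) has_real_derivative
          (p - 1) * \<gamma> x * m * (m * s x) powr (p - 1)) (at x)" .
      from DERIV_mult[OF this dw]
      have "(\<phi> has_real_derivative (p - 1) * \<gamma> x * m * (m * s x) powr (p - 1) * w +
          w' * (m * (w * a + \<rho> x * (Y * b))) * (m * s x) powr (p - 1)) (at x)"
        by (simp add: \<phi>_def[abs_def] w_def)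
      also have "(p - 1) * \<gamma> x * m * (m * s x) powr (p - 1) * w +
          w' * (m * (w * a + \<rho> x * (Y * b))) * (m * s x) powr (p - 1) =
          m * (m * s x) powr (p - 1) * ((p - 1) * \<gamma> x * w + w' * (w * a + \<rho> x * (Y * b)))"
        by (simp add: algebra_simps)
      also have "(p - 1) * \<gamma> x * w + w' * (w * a + \<rho> x * (Y * b)) = \<rho> x * b * (Y * w' - (p - 1) * w * Y')"
        unfolding g by (simp add: algebra_simps)
      also have "\<dots> = - (p - 1) * \<rho> x * b" unfolding id by (simp add: algebra_simps)
      also have "m * (m * s x) powr (p - 1) * (- (p - 1) * \<rho> x * b) =
          - (p - 1) * ((m * m powr (p - 1)) * \<rho> x) * (s x powr (p - 1) * b)"
        using m s_pos[of x] by (simp add: powr_mult mult_ac)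
      also have "m * m powr (p - 1) = m powr p"
        using powr_add[of m 1 "p - 1"] m by simp
      also have "s x powr (p - 1) * b = signed_pow p (y x)"
        using s_pos[of x] by (simp add: y_def signed_pow_mult signed_pow_of_nonneg b_def)
      finally show ?thesis .
    qed
    ultimately show "(y has_real_derivative signed_pow ?q (\<phi> x)) (at x) \<and>
      (\<phi> has_real_derivative - (p - 1) * (m powr p * \<rho> x) * signed_pow p (y x)) (at x)"
      by simp
  qed
  then obtain S where S: "countable S" "\<And>x. x \<in> {0<..<H} - S \<Longrightarrow>
      (y has_real_derivative signed_pow ?q (\<phi> x)) (at x) \<and>
      (\<phi> has_real_derivative - (p - 1) * (m powr p * \<rho> x) * signed_pow p (y x)) (at x)"
    unfolding co_countable_def by metis
  have "(y has_real_derivative signed_pow ?q (\<phi> x)) (at x within {0..H})" if "x \<in> {0..H}" for x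
    by (rule has_derivative_of_continuous_off_countable[OF S(1) cont_y _ _ that])
      (use S(2) q(1) cont_\<phi> in \<open>auto intro!: continuous_on_signed_pow\<close>)
  moreover have "co_countable 0 H (\<lambda>x. (\<phi> has_real_derivative - (p - 1) * (m powr p * \<rho> x) * signed_pow p (y x)) (at x))"
    unfolding co_countable_def using S by blast
  ultimately have "regular_sol p (\<lambda>x. m powr p * \<rho> x) 0 H y \<phi>"
    using cont_\<phi> by (simp add: regular_sol_def)
  moreover have "\<forall>x\<in>{0..H}. \<exists>s>0. y x = s * wave_y p (\<alpha> x)"
    using s_pos by (auto simp: y_def)
  moreover have "\<forall>x y. 0 \<le> x \<longrightarrow> x < y \<longrightarrow> y \<le> H \<longrightarrow> \<alpha> x < \<alpha> y" using strict by blast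
  moreover have "m powr p > 0" using m by simp
  ultimately show ?thesis using \<alpha> by blast
qed

section \<open>The first two eigenvalues\<close>

lemma wave_y_sign:
  assumes "p > 1"
  shows "\<theta> \<in> {0<..<half_period p} \<Longrightarrow> wave_y p \<theta> > 0"
    "\<theta> \<in> {half_period p<..<2 * half_period p} \<Longrightarrow> wave_y p \<theta> < 0"
    "wave_y p 0 = 0" "wave_y p (half_period p) = 0" "wave_y p (2 * half_period p) = 0"
proof -
  show "wave_y p \<theta> > 0" if \<theta>: "\<theta> \<in> {0<..<half_period p}"
  proof -
    consider "\<theta> \<in> {0..1}" | "\<theta> \<in> {1..half_period p - 1}" | "\<theta> \<in> {half_period p - 1..half_period p + 1}"
      using \<theta> by (cases "\<theta> \<le> 1"; cases "\<theta> \<le> half_period p - 1") auto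
    then show ?thesis using that by cases (simp_all add: wave_values[OF assms])
  qed
  show "wave_y p \<theta> < 0" if \<theta>: "\<theta> \<in> {half_period p<..<2 * half_period p}"
  proof -
    consider "\<theta> \<in> {half_period p - 1..half_period p + 1}" | "\<theta> \<in> {half_period p + 1..2 * half_period p - 1}"
      | "\<theta> \<in> {2 * half_period p - 1..2 * half_period p}"
      using \<theta> by (cases "\<theta> \<le> half_period p + 1"; cases "\<theta> \<le> 2 * half_period p - 1") auto
    then show ?thesis using that by cases (simp_all add: wave_values[OF assms])
  qed
qed (use half_period_gt(1)[OF assms] in \<open>simp_all add: wave_values[OF assms]\<close>)

text \<open>The total angle is half a turn, in whose interior \<open>wave_y\<close> is positive. For
  \<open>second_eigenfunction\<close> it is a full turn, and the node is where the angle passes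
  \<open>half_period p\<close>.\<close>

lemma first_eigenfunction:
  assumes "p > 1" "H > 0" "nice_density H \<rho>"
  shows "\<exists>\<mu>>0. \<exists>y \<phi>. regular_sol p (\<lambda>x. \<mu> * \<rho> x) 0 H y \<phi> \<and> y 0 = 0 \<and> y H = 0 \<and> (\<forall>x\<in>{0<..<H}. y x \<noteq> 0)"
proof -
  have hp: "0 < half_period p" "half_period p \<le> 2 * half_period p"
    using half_period_gt(1)[OF assms(1)] by auto
  obtain \<mu> y \<phi> \<alpha> where *: "\<mu> > 0" "regular_sol p (\<lambda>x. \<mu> * \<rho> x) 0 H y \<phi>"
    "\<alpha> 0 = 0" "\<alpha> H = half_period p" "\<forall>x y. 0 \<le> x \<longrightarrow> x < y \<longrightarrow> y \<le> H \<longrightarrow> \<alpha> x < \<alpha> y"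
    "\<forall>x\<in>{0..H}. \<exists>s>0. y x = s * wave_y p (\<alpha> x)"
    using wave_solution[OF assms hp] by blast
  have sol: "\<exists>s>0. y x = s * wave_y p (\<alpha> x)" if "x \<in> {0..H}" for x using *(6) that by blast
  have "y 0 = 0" "y H = 0"
    using sol[of 0] sol[of H] *(3,4) wave_y_sign(3,4)[OF assms(1)] assms(2) by auto
  moreover have "y x \<noteq> 0" if x: "x \<in> {0<..<H}" for x
  proof -
    have "\<alpha> 0 < \<alpha> x" "\<alpha> x < \<alpha> H" using *(5) x by auto
    then have "wave_y p (\<alpha> x) > 0" using *(3,4) by (intro wave_y_sign(1)[OF assms(1)]) simp
    then show ?thesis using sol[of x] x by auto
  qed
  ultimately show ?thesis using *(1,2) by blast
qed

lemma second_eigenfunction: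
  assumes "p > 1" "H > 0" "nice_density H \<rho>"
  shows "\<exists>\<mu>>0. \<exists>y \<phi> z. regular_sol p (\<lambda>x. \<mu> * \<rho> x) 0 H y \<phi> \<and> z \<in> {0<..<H} \<and> y 0 = 0 \<and> y z = 0 \<and> y H = 0 \<and>
    (\<forall>x\<in>{0<..<z} \<union> {z<..<H}. y x \<noteq> 0)"
proof -
  have hp: "0 < 2 * half_period p" "2 * half_period p \<le> 2 * half_period p"
    using half_period_gt(1)[OF assms(1)] by auto
  obtain \<mu> y \<phi> \<alpha> where *: "\<mu> > 0" "regular_sol p (\<lambda>x. \<mu> * \<rho> x) 0 H y \<phi>"
    "\<alpha> 0 = 0" "\<alpha> H = 2 * half_period p" "\<forall>x y. 0 \<le> x \<longrightarrow> x < y \<longrightarrow> y \<le> H \<longrightarrow> \<alpha> x < \<alpha> y"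
    "\<forall>x\<in>{0..H}. \<exists>s>0. y x = s * wave_y p (\<alpha> x)" "continuous_on {0..H} \<alpha>"
    using wave_solution[OF assms hp] by blast
  obtain z where z: "0 \<le> z" "z \<le> H" "\<alpha> z = half_period p"
    using IVT'[of \<alpha> 0 "half_period p" H] * hp assms(2) by auto
  have strict: "\<alpha> u < \<alpha> v" if "0 \<le> u" "u < v" "v \<le> H" for u v using *(5) that by blast
  from z have zH: "z \<in> {0<..<H}"
    using *(3,4) hp by (auto simp: order_less_le)
  have sol: "\<exists>s>0. y x = s * wave_y p (\<alpha> x)" if "x \<in> {0..H}" for x using *(6) that by blast
  have "y 0 = 0" "y z = 0" "y H = 0"
    using sol[of 0] sol[of z] sol[of H] *(3,4) z wave_y_sign(3-5)[OF assms(1)] assms(2) by auto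
  moreover have "y x \<noteq> 0" if "x \<in> {0<..<z} \<union> {z<..<H}" for x
  proof -
    have "wave_y p (\<alpha> x) \<noteq> 0"
    proof (cases "x < z")
      case True
      then have "\<alpha> 0 < \<alpha> x" "\<alpha> x < \<alpha> z" using that zH by (auto intro!: strict)
      then have "wave_y p (\<alpha> x) > 0" using *(3) z(3) by (intro wave_y_sign(1)[OF assms(1)]) simp
      then show ?thesis by simp
    next
      case False
      then have "\<alpha> z < \<alpha> x" "\<alpha> x < \<alpha> H" using that zH by (auto intro!: strict)
      then have "wave_y p (\<alpha> x) < 0" using *(4) z(3) by (intro wave_y_sign(2)[OF assms(1)]) simp
      then show ?thesis by simp
    qed
    moreover have "x \<in> {0..H}" using that zH by auto
    ultimately show ?thesis using sol[of x] by force
  qed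
  ultimately show ?thesis using *(1,2) zH by blast
qed

lemma nice_density_bound:
  assumes "nice_density H \<rho>"
  shows "\<exists>C. co_countable 0 H (\<lambda>x. \<bar>\<mu> * \<rho> x\<bar> \<le> C)"
proof -
  obtain B where B: "\<forall>x\<in>{0..H}. \<bar>\<rho> x\<bar> \<le> B" using assms by (auto simp: nice_density_def)
  have "co_countable 0 H (\<lambda>x. \<bar>\<mu> * \<rho> x\<bar> \<le> \<bar>\<mu>\<bar> * B)"
    using B by (intro co_countableI) (auto simp: abs_mult intro: mult_left_mono)
  then show ?thesis by blast
qed

lemma pi_hat_pos: "p > 1 \<Longrightarrow> pi_hat p > 0"
  unfolding pi_hat_def by (intro divide_pos_pos mult_pos_pos sin_gt_zero) (auto simp: field_simps)

text \<open>Unless its first positive zero is the right end point or \<open>z\<close>, an eigenfunction has a nodal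
  interval strictly inside a nodal interval of the second eigenfunction.\<close>

lemma eigenvalue_classification:
  assumes "p > 1" and \<rho>: "nice_density (pi_hat p) \<rho>"
    and W1: "nodal p (\<lambda>x. \<mu>1 * \<rho> x) 0 (pi_hat p) W1"
    and z: "z \<in> {0<..<pi_hat p}"
    and W2: "nodal p (\<lambda>x. \<mu>2 * \<rho> x) 0 z W2" and W2': "nodal p (\<lambda>x. \<mu>2 * \<rho> x) z (pi_hat p) W2'"
    and \<nu>: "is_eigenvalue p \<rho> \<nu>"
  shows "\<nu> = \<mu>1 \<or> \<nu> = \<mu>2 \<or> \<mu>2 < \<nu>"
proof -
  let ?H = "pi_hat p"
  note H = pi_hat_pos[OF assms(1)]
  obtain y x0 where y: "dirichlet_solution p \<rho> \<nu> y" "x0 \<in> {0..?H}" "y x0 \<noteq> 0"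
    using \<nu> by (auto simp: is_eigenvalue_def)
  then have y0: "y 0 = 0" "y ?H = 0" by (auto simp: dirichlet_solution_def)
  obtain \<phi> where sol: "regular_sol p (\<lambda>x. \<nu> * \<rho> x) 0 ?H y \<phi>"
    using dirichlet_solution_regular[OF assms(1) \<rho> y(1) H] by blast
  obtain C where C: "co_countable 0 ?H (\<lambda>x. \<bar>\<nu> * \<rho> x\<bar> \<le> C)"
    using nice_density_bound[OF \<rho>] by blast
  have nz: "\<phi> x \<noteq> 0" if "x \<in> {0..?H}" "y x = 0" for x
    using regular_sol_zero[OF assms(1) sol C that _ y(2)] y(3) by blast
  have pos: "co_countable c d (\<lambda>x. \<rho> x > 0)" if "0 \<le> c" "d \<le> ?H" for c d
    using \<rho> co_countable_mono[of 0 ?H "\<lambda>x. \<rho> x > 0" c d] that by (simp add: nice_density_def)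
  have nod: "nodal p (\<lambda>x. \<nu> * \<rho> x) c d (\<lambda>x. \<phi> x / signed_pow p (y x))"
    if "0 \<le> c" "c < d" "d \<le> ?H" "y c = 0" "y d = 0" "\<forall>x\<in>{c<..<d}. y x \<noteq> 0" for c d
    using regular_sol_nodal[OF assms(1) sol C that(1-5)] that(6) by blast
  obtain d1 where d1: "d1 \<in> {0<..?H}" "y d1 = 0" "\<forall>x\<in>{0<..<d1}. y x \<noteq> 0"
    using regular_sol_next_zero[OF sol, of 0] y0 nz[of 0] H by auto
  have N1: "nodal p (\<lambda>x. \<nu> * \<rho> x) 0 d1 (\<lambda>x. \<phi> x / signed_pow p (y x))"
    using nod[of 0 d1] d1 y0 by auto
  show ?thesis
  proof (cases "d1 = ?H")
    case True
    then show ?thesis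
      using nodal_same_interval[OF assms(1) N1[unfolded True] W1 H pos] by simp
  next
    case False
    then have d1H: "d1 < ?H" using d1 by simp
    obtain d2 where d2: "d2 \<in> {d1<..?H}" "y d2 = 0" "\<forall>x\<in>{d1<..<d2}. y x \<noteq> 0"
      using regular_sol_next_zero[OF sol, of d1] y0 nz[of d1] d1 d1H by auto
    have N2: "nodal p (\<lambda>x. \<nu> * \<rho> x) d1 d2 (\<lambda>x. \<phi> x / signed_pow p (y x))"
      using nod[of d1 d2] d1 d2 by auto
    show ?thesis
    proof (cases d1 z rule: linorder_cases)
      case less
      then have "\<mu>2 < \<nu>"
        using nodal_subinterval_less[OF assms(1) W2 N1 _ _ _ _ pos[of 0 d1]] d1 by auto
      then show ?thesis by simp
    next
      case equal
      then have "\<nu> = \<mu>2"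
        using nodal_same_interval[OF assms(1) N1 W2[folded equal] _ pos[of 0 d1]] d1 by auto
      then show ?thesis by simp
    next
      case greater
      have "\<mu>2 < \<nu>"
        using nodal_subinterval_less[OF assms(1) W2' N2 _ _ _ _ pos[of d1 d2]] d1 d2 greater by auto
      then show ?thesis by simp
    qed
  qed
qed

text \<open>The classification determines the eigenvalues below each of the two numbers, none and
  exactly one; \<open>eigenvalue\<close> counts from \<open>1\<close>, whence the
  \<open>Suc\<close>. Anything above \<open>\<mu>2\<close> has at least two eigenvalues below
  it.\<close>

lemma eigenvalue_one_two:
  assumes m1: "is_eigenvalue p \<rho> \<mu>1" and m2: "is_eigenvalue p \<rho> \<mu>2" and "\<mu>1 < \<mu>2"
    and classified: "\<And>\<nu>. is_eigenvalue p \<rho> \<nu> \<Longrightarrow> \<nu> = \<mu>1 \<or> \<nu> = \<mu>2 \<or> \<mu>2 < \<nu>"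
  shows "eigenvalue p \<rho> 1 = \<mu>1" "eigenvalue p \<rho> 2 = \<mu>2"
proof -
  have s1: "{\<nu>. is_eigenvalue p \<rho> \<nu> \<and> \<nu> < \<mu>1} = {}" and s2: "{\<nu>. is_eigenvalue p \<rho> \<nu> \<and> \<nu> < \<mu>2} = {\<mu>1}"
    using classified assms(1-3) by force+
  show "eigenvalue p \<rho> 1 = \<mu>1"
    unfolding eigenvalue_def
  proof (rule the_equality)
    show "is_eigenvalue p \<rho> \<mu>1 \<and> finite {\<nu>. is_eigenvalue p \<rho> \<nu> \<and> \<nu> < \<mu>1} \<and>
        Suc (card {\<nu>. is_eigenvalue p \<rho> \<nu> \<and> \<nu> < \<mu>1}) = 1"
      unfolding s1 using m1 by simp
    fix \<mu> assume *: "is_eigenvalue p \<rho> \<mu> \<and> finite {\<nu>. is_eigenvalue p \<rho> \<nu> \<and> \<nu> < \<mu>} \<and>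
        Suc (card {\<nu>. is_eigenvalue p \<rho> \<nu> \<and> \<nu> < \<mu>}) = 1"
    then have "card {\<nu>. is_eigenvalue p \<rho> \<nu> \<and> \<nu> < \<mu>} = 0" by simp
    then have "{\<nu>. is_eigenvalue p \<rho> \<nu> \<and> \<nu> < \<mu>} = {}" using * card_0_eq by blast
    then have "\<not> \<mu>1 < \<mu>" using m1 by blast
    then show "\<mu> = \<mu>1" using classified[of \<mu>] * assms(3) by auto
  qed
  show "eigenvalue p \<rho> 2 = \<mu>2"
    unfolding eigenvalue_def
  proof (rule the_equality)
    show "is_eigenvalue p \<rho> \<mu>2 \<and> finite {\<nu>. is_eigenvalue p \<rho> \<nu> \<and> \<nu> < \<mu>2} \<and>
        Suc (card {\<nu>. is_eigenvalue p \<rho> \<nu> \<and> \<nu> < \<mu>2}) = 2"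
      unfolding s2 using m2 by simp
    fix \<mu> assume *: "is_eigenvalue p \<rho> \<mu> \<and> finite {\<nu>. is_eigenvalue p \<rho> \<nu> \<and> \<nu> < \<mu>} \<and>
        Suc (card {\<nu>. is_eigenvalue p \<rho> \<nu> \<and> \<nu> < \<mu>}) = 2"
    have "\<mu> \<noteq> \<mu>1"
    proof
      assume "\<mu> = \<mu>1"
      then have "{\<nu>. is_eigenvalue p \<rho> \<nu> \<and> \<nu> < \<mu>} = {}" using s1 by simp
      then have "card {\<nu>. is_eigenvalue p \<rho> \<nu> \<and> \<nu> < \<mu>} = 0" by (simp only: card.empty)
      with conjunct2[OF conjunct2[OF *]] show False by linarith
    qed
    moreover have "\<not> \<mu>2 < \<mu>"
    proof
      assume "\<mu>2 < \<mu>"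
      then have "{\<mu>1, \<mu>2} \<subseteq> {\<nu>. is_eigenvalue p \<rho> \<nu> \<and> \<nu> < \<mu>}" using assms(1-3) by auto
      then have "card {\<mu>1, \<mu>2} \<le> card {\<nu>. is_eigenvalue p \<rho> \<nu> \<and> \<nu> < \<mu>}"
        using * by (intro card_mono) auto
      then show False using * assms(3) by simp
    qed
    ultimately show "\<mu> = \<mu>2" using classified[of \<mu>] * by auto
  qed
qed

text \<open>The interface to the ratio estimates: it replaces the definite description in
  \<open>eigenvalue\<close> by Riccati functions on nodal intervals.\<close>

lemma eigenvalue_nodal_data:
  assumes "p > 1" and \<rho>: "nice_density (pi_hat p) \<rho>"
  shows "\<exists>z W1 W2 W2'. z \<in> {0<..<pi_hat p} \<and> 0 < eigenvalue p \<rho> 1 \<and> 0 < eigenvalue p \<rho> 2 \<and>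
    nodal p (\<lambda>x. eigenvalue p \<rho> 1 * \<rho> x) 0 (pi_hat p) W1 \<and>
    nodal p (\<lambda>x. eigenvalue p \<rho> 2 * \<rho> x) 0 z W2 \<and> nodal p (\<lambda>x. eigenvalue p \<rho> 2 * \<rho> x) z (pi_hat p) W2'"
proof -
  let ?H = "pi_hat p"
  note H = pi_hat_pos[OF assms(1)]
  obtain \<mu>1 y1 \<phi>1 where 1: "\<mu>1 > 0" "regular_sol p (\<lambda>x. \<mu>1 * \<rho> x) 0 ?H y1 \<phi>1" "y1 0 = 0" "y1 ?H = 0"
    "\<forall>x\<in>{0<..<?H}. y1 x \<noteq> 0"
    using first_eigenfunction[OF assms(1) H \<rho>] by blast
  obtain \<mu>2 y2 \<phi>2 z where 2: "\<mu>2 > 0" "regular_sol p (\<lambda>x. \<mu>2 * \<rho> x) 0 ?H y2 \<phi>2" "z \<in> {0<..<?H}"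
    "y2 0 = 0" "y2 z = 0" "y2 ?H = 0" "\<forall>x\<in>{0<..<z} \<union> {z<..<?H}. y2 x \<noteq> 0"
    using second_eigenfunction[OF assms(1) H \<rho>] by blast
  obtain C1 C2 where C: "co_countable 0 ?H (\<lambda>x. \<bar>\<mu>1 * \<rho> x\<bar> \<le> C1)" "co_countable 0 ?H (\<lambda>x. \<bar>\<mu>2 * \<rho> x\<bar> \<le> C2)"
    using nice_density_bound[OF \<rho>] by blast
  obtain W1 where W1: "nodal p (\<lambda>x. \<mu>1 * \<rho> x) 0 ?H W1"
    using regular_sol_nodal[OF assms(1) 1(2) C(1) order_refl H order_refl 1(3,4)] 1(5) by blast
  obtain W2 where W2: "nodal p (\<lambda>x. \<mu>2 * \<rho> x) 0 z W2"
    using regular_sol_nodal[OF assms(1) 2(2) C(2) order_refl _ _ 2(4,5)] 2(3,7) by auto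
  obtain W2' where W2': "nodal p (\<lambda>x. \<mu>2 * \<rho> x) z ?H W2'"
    using regular_sol_nodal[OF assms(1) 2(2) C(2) _ _ order_refl 2(5,6)] 2(3,7) by auto
  have "co_countable 0 ?H (\<lambda>x. \<rho> x > 0)" using \<rho> by (simp add: nice_density_def)
  then have "co_countable 0 z (\<lambda>x. \<rho> x > 0)"
    by (rule co_countable_mono) (use 2(3) in auto)
  then have lt: "\<mu>1 < \<mu>2"
    using nodal_subinterval_less[OF assms(1) W1 W2] 2(3) by auto
  have "?H / 2 \<in> {0..?H}" "y1 (?H / 2) \<noteq> 0" using 1(5) H by auto
  then have ev1: "is_eigenvalue p \<rho> \<mu>1"
    using regular_sol_dirichlet_solution[OF assms 1(2-4)] unfolding is_eigenvalue_def by blast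
  have "z / 2 \<in> {0..?H}" "y2 (z / 2) \<noteq> 0" using 2(3,7) by auto
  then have ev2: "is_eigenvalue p \<rho> \<mu>2"
    using regular_sol_dirichlet_solution[OF assms 2(2,4,6)] unfolding is_eigenvalue_def by blast
  from eigenvalue_one_two[OF ev1 ev2 lt eigenvalue_classification[OF assms W1 2(3) W2 W2']]
  show ?thesis using 1(1) 2(1,3) W1 W2 W2' by auto
qed

section \<open>Monotone densities\<close>

lemma AE_interval_ex:
  fixes a b u v :: real
  assumes "AE x\<in>{a<..<b} in lebesgue. P x" "a \<le> u" "u < v" "v \<le> b"
  shows "\<exists>t\<in>{u<..<v}. P t"
proof (rule ccontr)
  assume *: "\<not> (\<exists>t\<in>{u<..<v}. P t)"
  obtain N where N: "{x \<in> space lebesgue. \<not> (x \<in> {a<..<b} \<longrightarrow> P x)} \<subseteq> N"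
      "emeasure lebesgue N = 0" "N \<in> sets lebesgue"
    using assms(1) by (rule AE_E)
  have "{u<..<v} \<subseteq> N" using * N(1) assms(2,4) by (force simp: subset_eq)
  then have "emeasure lebesgue {u<..<v} \<le> emeasure lebesgue N"
    using N(3) by (rule emeasure_mono)
  then show False using N(2) assms(3) by simp
qed

definition monotone_between :: "real \<Rightarrow> real \<Rightarrow> (real \<Rightarrow> real) \<Rightarrow> bool" where
  "monotone_between a b f \<longleftrightarrow> mono_on {a..b} f \<or> antimono_on {a..b} f"

lemma monotone_between_min_max:
  assumes "monotone_between a b f" "a \<le> s" "s \<le> x" "x \<le> t" "t \<le> b"
  shows "min (f s) (f t) \<le> f x" "f x \<le> max (f s) (f t)"
  using assms unfolding monotone_between_def monotone_on_def by (auto simp: min_le_iff_disj le_max_iff_disj)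

lemma monotone_between_isCont:
  assumes "monotone_between a b f"
  shows "co_countable a b (isCont f)"
proof -
  have mono: "co_countable a b (isCont g)" if "mono_on {a..b} g" for g :: "real \<Rightarrow> real"
  proof -
    have "mono_on {a<..<b} g"
      using that by (rule monotone_on_subset) auto
    then have "countable {x \<in> {a<..<b}. \<not> isCont g x}"
      by (intro mono_on_ctble_discont_open) auto
    then show ?thesis unfolding co_countable_def by blast
  qed
  show ?thesis
  proof (cases "mono_on {a..b} f")
    case False
    then have "mono_on {a..b} (\<lambda>x. - f x)"
      using assms by (auto simp: monotone_between_def monotone_on_def)
    then have "co_countable a b (isCont (\<lambda>x. - f x))" by (rule mono)
    then show ?thesis
      by (rule co_countable_mono) (auto dest: continuous_minus)
  qed (rule mono)
qed

text \<open>Points of the full-measure set exist on both sides of \<open>x\<close>, and monotonicity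
  places \<open>f x\<close> between the two values; so an almost everywhere property becomes a
  pointwise one in the interior.\<close>

lemma monotone_between_AE_pos:
  assumes f: "monotone_between a b f" and ae: "AE x\<in>{a<..<b} in lebesgue. f x > 0" and x: "x \<in> {a<..<b}"
  shows "f x > 0"
proof -
  obtain s where s: "s \<in> {a<..<x}" "f s > 0"
    using AE_interval_ex[OF ae, of a x] x by auto
  obtain t where t: "t \<in> {x<..<b}" "f t > 0"
    using AE_interval_ex[OF ae, of x b] x by auto
  show ?thesis
    using monotone_between_min_max(1)[OF f, of s x t] s t by (auto simp: min_def split: if_splits)
qed

lemma monotone_between_AE_const:
  assumes f: "monotone_between a b f" and ae: "AE x\<in>{a<..<b} in lebesgue. f x = c" and x: "x \<in> {a<..<b}"
  shows "f x = c"
proof -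
  obtain s where s: "s \<in> {a<..<x}" "f s = c"
    using AE_interval_ex[OF ae, of a x] x by auto
  obtain t where t: "t \<in> {x<..<b}" "f t = c"
    using AE_interval_ex[OF ae, of x b] x by auto
  show ?thesis
    using monotone_between_min_max[OF f, of s x t] s t by auto
qed

lemma AE_subinterval:
  assumes "AE x\<in>{a<..<b::real} in lebesgue. P x" "a \<le> c" "d \<le> b"
  shows "AE x\<in>{c<..<d} in lebesgue. P x"
  using assms(1) by eventually_elim (use assms(2,3) in auto)

lemma nice_density_monotone_halves:
  assumes H: "H > 0" and f: "monotone_between 0 (H / 2) \<rho>" "monotone_between (H / 2) H \<rho>"
    and ae: "AE x\<in>{0<..<H} in lebesgue. \<rho> x > 0"
  shows "nice_density H \<rho>"
proof -
  have pos1: "\<rho> x > 0" if "x \<in> {0<..<H / 2}" for x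
    by (rule monotone_between_AE_pos[OF f(1) AE_subinterval[OF ae] that]) (use H in auto)
  have pos2: "\<rho> x > 0" if "x \<in> {H / 2<..<H}" for x
    by (rule monotone_between_AE_pos[OF f(2) AE_subinterval[OF ae] that]) (use H in auto)
  define B where "B = \<bar>\<rho> 0\<bar> + \<bar>\<rho> (H / 2)\<bar> + \<bar>\<rho> H\<bar>"
  have "\<bar>\<rho> x\<bar> \<le> B" if "x \<in> {0..H}" for x
  proof (cases "x \<le> H / 2")
    case True
    then show ?thesis
      using monotone_between_min_max[OF f(1), of 0 x "H / 2"] that H
      by (auto simp: B_def min_def max_def split: if_splits)
  next
    case False
    then show ?thesis
      using monotone_between_min_max[OF f(2), of "H / 2" x H] that H
      by (auto simp: B_def min_def max_def split: if_splits)
  qed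
  moreover have "co_countable 0 H (isCont \<rho>)"
    by (rule co_countable_split[OF monotone_between_isCont[OF f(1)] monotone_between_isCont[OF f(2)]])
  moreover have "co_countable 0 H (\<lambda>x. \<rho> x > 0)"
    by (rule co_countable_split[of 0 "H / 2"]; rule co_countableI) (use pos1 pos2 in auto)
  \<comment> \<open>This interval lies inside the left half, where the density is monotone in one
    direction or the other and so bounded below by its end values.\<close>
  moreover have "co_countable (H / 4) (H / 3) (\<lambda>x. min (\<rho> (H / 4)) (\<rho> (H / 3)) \<le> \<rho> x)"
    by (rule co_countableI, rule monotone_between_min_max(1)[OF f(1)]) (use H in auto)
  moreover have "min (\<rho> (H / 4)) (\<rho> (H / 3)) > 0" using pos1[of "H / 4"] pos1[of "H / 3"] H by auto
  ultimately show ?thesis unfolding nice_density_def by blast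
qed

lemma co_countable_of_ae_constant:
  assumes H: "pi_hat p > 0"
    and f: "monotone_between 0 (pi_hat p / 2) \<rho>" "monotone_between (pi_hat p / 2) (pi_hat p) \<rho>"
    and "ae_constant p \<rho>"
  shows "\<exists>c. co_countable 0 (pi_hat p) (\<lambda>x. \<rho> x = c)"
proof -
  obtain c where ae: "AE x\<in>{0<..<pi_hat p} in lebesgue. \<rho> x = c"
    using assms(4) by (auto simp: ae_constant_def)
  have "co_countable 0 (pi_hat p / 2) (\<lambda>x. \<rho> x = c)"
    by (rule co_countableI, rule monotone_between_AE_const[OF f(1) AE_subinterval[OF ae]]) (use H in auto)
  moreover have "co_countable (pi_hat p / 2) (pi_hat p) (\<lambda>x. \<rho> x = c)"
    by (rule co_countableI, rule monotone_between_AE_const[OF f(2) AE_subinterval[OF ae]]) (use H in auto)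
  ultimately have "co_countable 0 (pi_hat p) (\<lambda>x. \<rho> x = c)"
    by (rule co_countable_split)
  then show ?thesis by blast
qed

lemma nodal_cong:
  assumes "nodal p Q c d W" "co_countable c d (\<lambda>x. Q x = Q' x)"
  shows "nodal p Q' c d W"
proof -
  have "riccati p Q c d W" using assms(1) by (simp add: nodal_def)
  then have "riccati p Q' c d W"
    unfolding riccati_def by (auto intro: co_countable_elim[OF _ assms(2)])
  then show ?thesis using assms(1) by (simp add: nodal_def)
qed

text \<open>Supplies the constant \<open>K\<close> of the scaling lemmas, from the existence theorem
  with \<open>H = 1\<close> and density \<open>1\<close>.\<close>

lemma nodal_const_unit:
  assumes "p > 1"
  shows "\<exists>K>0. \<exists>Y. nodal p (\<lambda>_. K) 0 1 Y"
proof -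
  have nice: "nice_density 1 (\<lambda>_. 1)"
    unfolding nice_density_def by (auto intro!: co_countableI exI[of _ 1])
  obtain \<mu> y \<phi> where 1: "\<mu> > 0" "regular_sol p (\<lambda>x. \<mu> * 1) 0 1 y \<phi>" "y 0 = 0" "y 1 = 0"
    "\<forall>x\<in>{0<..<1}. y x \<noteq> 0"
    using first_eigenfunction[OF assms zero_less_one nice] by blast
  have "co_countable 0 1 (\<lambda>x. \<bar>\<mu> * 1\<bar> \<le> \<mu>)" using 1(1) by (intro co_countableI) auto
  from regular_sol_nodal[OF assms 1(2) this order_refl zero_less_one order_refl 1(3,4)] 1(1,5)
  show ?thesis by auto
qed

text \<open>A constant is both a barrier and a symmetric well, so whichever way the ratio compares
  with \<open>2 powr p\<close>, one of the two rigidity results turns it into equality.\<close>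

lemma constant_density_ratio:
  assumes "p > 1" and \<rho>: "nice_density (pi_hat p) \<rho>" and c: "co_countable 0 (pi_hat p) (\<lambda>x. \<rho> x = c)"
  shows "eigenvalue p \<rho> 2 = 2 powr p * eigenvalue p \<rho> 1"
proof -
  let ?H = "pi_hat p" and ?m1 = "eigenvalue p \<rho> 1" and ?m2 = "eigenvalue p \<rho> 2"
  note H = pi_hat_pos[OF assms(1)]
  obtain K Y where K: "K > 0" "nodal p (\<lambda>_. K) 0 1 Y" using nodal_const_unit[OF assms(1)] by blast
  obtain z W1 W2 W2' where z: "z \<in> {0<..<?H}" and m: "0 < ?m1" "0 < ?m2" and
    W: "nodal p (\<lambda>x. ?m1 * \<rho> x) 0 ?H W1" "nodal p (\<lambda>x. ?m2 * \<rho> x) 0 z W2" "nodal p (\<lambda>x. ?m2 * \<rho> x) z ?H W2'"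
    using eigenvalue_nodal_data[OF assms(1,2)] by blast
  have "co_countable 0 ?H (\<lambda>x. \<rho> x > 0)" using \<rho> by (simp add: nice_density_def)
  then obtain x where "\<rho> x > 0 \<and> \<rho> x = c"
    by (rule co_countable_ex[OF co_countable_conj[OF _ c] H])
  then have pos: "co_countable 0 ?H (\<lambda>x. c > 0)" by (intro co_countableI) auto
  have W': "nodal p (\<lambda>x. ?m1 * c) 0 ?H W1" "nodal p (\<lambda>x. ?m2 * c) 0 z W2" "nodal p (\<lambda>x. ?m2 * c) z ?H W2'"
    by (rule nodal_cong[OF W(1)], rule co_countable_mono[OF c], simp, simp, simp)
      (rule nodal_cong[OF W(2)], rule co_countable_mono[OF c], use z in simp, use z in simp, simp,
       rule nodal_cong[OF W(3)], rule co_countable_mono[OF c], use z in simp, use z in simp, simp)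
  show ?thesis
  proof (cases "?m2 \<le> 2 powr p * ?m1")
    case True
    show ?thesis
      using barrier_ratio[OF assms(1) K z m(1) W' pos _ _ True] by blast
  next
    case False
    then show ?thesis
      using well_ratio[OF assms(1) K z m(1) W' pos _ _ less_imp_le] by (simp add: not_le)
  qed
qed

section \<open>Barriers and wells\<close>

lemma single_barrier_monotone:
  assumes "single_barrier p a \<rho>"
  shows "mono_on {0..a} \<rho>" "antimono_on {a..pi_hat p} \<rho>"
  using assms by (auto simp: single_barrier_def single_well_def monotone_on_def)

lemma barrier_eigenvalue_ratio:
  assumes "p > 1" "is_density p \<rho>" "single_barrier p (pi_hat p / 2) \<rho>"
  shows "eigenvalue p \<rho> 2 / eigenvalue p \<rho> 1 \<ge> 2 powr p"
    and "eigenvalue p \<rho> 2 / eigenvalue p \<rho> 1 = 2 powr p \<longleftrightarrow> ae_constant p \<rho>"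
proof -
  let ?H = "pi_hat p" and ?m1 = "eigenvalue p \<rho> 1" and ?m2 = "eigenvalue p \<rho> 2"
  note H = pi_hat_pos[OF assms(1)]
  note mono = single_barrier_monotone[OF assms(3)]
  have mb: "monotone_between 0 (?H / 2) \<rho>" "monotone_between (?H / 2) ?H \<rho>"
    using mono by (auto simp: monotone_between_def)
  have ae: "AE x\<in>{0<..<?H} in lebesgue. \<rho> x > 0" using assms(2) by (simp add: is_density_def)
  have nice: "nice_density ?H \<rho>" by (rule nice_density_monotone_halves[OF H mb ae])
  then have pos: "co_countable 0 ?H (\<lambda>x. \<rho> x > 0)" by (simp add: nice_density_def)
  obtain K Y where K: "K > 0" "nodal p (\<lambda>_. K) 0 1 Y" using nodal_const_unit[OF assms(1)] by blast
  obtain z W1 W2 W2' where z: "z \<in> {0<..<?H}" and m: "0 < ?m1" "0 < ?m2" and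
    W: "nodal p (\<lambda>x. ?m1 * \<rho> x) 0 ?H W1" "nodal p (\<lambda>x. ?m2 * \<rho> x) 0 z W2" "nodal p (\<lambda>x. ?m2 * \<rho> x) z ?H W2'"
    using eigenvalue_nodal_data[OF assms(1) nice] by blast
  have inc: "\<rho> x \<le> \<rho> y" if "0 < x" "x \<le> y" "y < ?H / 2" for x y
    using mono(1) that by (auto simp: monotone_on_def)
  have dec: "\<rho> y \<le> \<rho> x" if "?H / 2 < x" "x \<le> y" "y < ?H" for x y
    using mono(2) that by (auto simp: monotone_on_def)
  have rigid: "?m2 = 2 powr p * ?m1 \<and> (\<exists>c. co_countable 0 ?H (\<lambda>x. \<rho> x = c))" if "?m2 \<le> 2 powr p * ?m1"
    using barrier_ratio[OF assms(1) K z m(1) W pos inc dec that] by blast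
  \<comment> \<open>A strictly smaller ratio would satisfy the premise of \<open>rigid\<close>,
    which returns equality.\<close>
  then have "2 powr p * ?m1 \<le> ?m2" by linarith
  then show "?m2 / ?m1 \<ge> 2 powr p" using m(1) by (simp add: le_divide_eq)
  show "?m2 / ?m1 = 2 powr p \<longleftrightarrow> ae_constant p \<rho>"
  proof
    assume "?m2 / ?m1 = 2 powr p"
    then have "?m2 \<le> 2 powr p * ?m1" using m(1) by (simp add: field_simps)
    then obtain c where "co_countable 0 ?H (\<lambda>x. \<rho> x = c)" using rigid by blast
    then show "ae_constant p \<rho>" unfolding ae_constant_def by (intro exI[of _ c] co_countable_AE)
  next
    assume "ae_constant p \<rho>"
    then obtain c where "co_countable 0 ?H (\<lambda>x. \<rho> x = c)"
      using co_countable_of_ae_constant[OF H mb] by blast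
    then show "?m2 / ?m1 = 2 powr p"
      using constant_density_ratio[OF assms(1) nice] m(1) by simp
  qed
qed

lemma well_eigenvalue_ratio:
  assumes "p > 1" "is_density p \<rho>" "symmetric p \<rho>" "single_well p (pi_hat p / 2) \<rho>"
  shows "eigenvalue p \<rho> 2 / eigenvalue p \<rho> 1 \<le> 2 powr p"
    and "eigenvalue p \<rho> 2 / eigenvalue p \<rho> 1 = 2 powr p \<longleftrightarrow> ae_constant p \<rho>"
proof -
  let ?H = "pi_hat p" and ?m1 = "eigenvalue p \<rho> 1" and ?m2 = "eigenvalue p \<rho> 2"
  note H = pi_hat_pos[OF assms(1)]
  have mono: "antimono_on {0..?H / 2} \<rho>" "mono_on {?H / 2..?H} \<rho>"
    using assms(4) by (auto simp: single_well_def)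
  have mb: "monotone_between 0 (?H / 2) \<rho>" "monotone_between (?H / 2) ?H \<rho>"
    using mono by (auto simp: monotone_between_def)
  have ae: "AE x\<in>{0<..<?H} in lebesgue. \<rho> x > 0" using assms(2) by (simp add: is_density_def)
  have nice: "nice_density ?H \<rho>" by (rule nice_density_monotone_halves[OF H mb ae])
  then have pos: "co_countable 0 ?H (\<lambda>x. \<rho> x > 0)" by (simp add: nice_density_def)
  obtain K Y where K: "K > 0" "nodal p (\<lambda>_. K) 0 1 Y" using nodal_const_unit[OF assms(1)] by blast
  obtain z W1 W2 W2' where z: "z \<in> {0<..<?H}" and m: "0 < ?m1" "0 < ?m2" and
    W: "nodal p (\<lambda>x. ?m1 * \<rho> x) 0 ?H W1" "nodal p (\<lambda>x. ?m2 * \<rho> x) 0 z W2" "nodal p (\<lambda>x. ?m2 * \<rho> x) z ?H W2'"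
    using eigenvalue_nodal_data[OF assms(1) nice] by blast
  have dec: "\<rho> y \<le> \<rho> x" if "0 < x" "x \<le> y" "y < ?H / 2" for x y
    using mono(1) that by (auto simp: monotone_on_def)
  have sym: "\<rho> (?H - x) = \<rho> x" if "x \<in> {0..?H}" for x
    using assms(3)[unfolded symmetric_def, rule_format, OF that] by (rule HOL.sym)
  have rigid: "?m2 = 2 powr p * ?m1 \<and> (\<exists>c. co_countable 0 ?H (\<lambda>x. \<rho> x = c))" if "2 powr p * ?m1 \<le> ?m2"
    using well_ratio[OF assms(1) K z m(1) W pos dec sym that] by blast
  then have "?m2 \<le> 2 powr p * ?m1" by linarith
  then show "?m2 / ?m1 \<le> 2 powr p" using m(1) by (simp add: divide_le_eq)
  show "?m2 / ?m1 = 2 powr p \<longleftrightarrow> ae_constant p \<rho>"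
  proof
    assume "?m2 / ?m1 = 2 powr p"
    then have "2 powr p * ?m1 \<le> ?m2" using m(1) by (simp add: field_simps)
    then obtain c where "co_countable 0 ?H (\<lambda>x. \<rho> x = c)" using rigid by blast
    then show "ae_constant p \<rho>" unfolding ae_constant_def by (intro exI[of _ c] co_countable_AE)
  next
    assume "ae_constant p \<rho>"
    then obtain c where "co_countable 0 ?H (\<lambda>x. \<rho> x = c)"
      using co_countable_of_ae_constant[OF H mb] by blast
    then show "?m2 / ?m1 = 2 powr p"
      using constant_density_ratio[OF assms(1) nice] m(1) by simp
  qed
qed

section \<open>Step densities as counterexamples\<close>

lemma step_density_nice:
  assumes "H > 0" "b \<in> {0<..<H}" "l \<ge> 1" "r \<ge> (1::real)"
  shows "nice_density H (\<lambda>x. if x < b then l else r)"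
proof -
  let ?\<rho> = "\<lambda>x. if x < b then l else r"
  have "isCont ?\<rho> x" if "x \<noteq> b" for x
  proof (cases "x < b")
    case True
    then have "eventually (\<lambda>x. x \<in> {..<b}) (nhds x)"
      by (intro eventually_nhds_in_open) auto
    then have "eventually (\<lambda>x. l = ?\<rho> x) (nhds x)"
      by eventually_elim simp
    then show ?thesis using isCont_cong[of "\<lambda>_. l" ?\<rho> x] by simp
  next
    case False
    then have "eventually (\<lambda>x. x \<in> {b<..}) (nhds x)"
      using that by (intro eventually_nhds_in_open) auto
    then have "eventually (\<lambda>x. r = ?\<rho> x) (nhds x)"
      by eventually_elim simp
    then show ?thesis using isCont_cong[of "\<lambda>_. r" ?\<rho> x] by simp
  qed
  then have "co_countable 0 H (isCont ?\<rho>)"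
    unfolding co_countable_def by (intro exI[of _ "{b}"]) auto
  moreover have "\<forall>x\<in>{0..H}. \<bar>?\<rho> x\<bar> \<le> max l r" using assms by auto
  moreover have "co_countable 0 H (\<lambda>x. ?\<rho> x > 0)" "co_countable (H / 4) (H / 3) (\<lambda>x. ?\<rho> x \<ge> 1)"
    using assms by (auto intro!: co_countableI)
  ultimately show ?thesis unfolding nice_density_def by (meson zero_less_one)
qed

lemma nice_density_is_density:
  assumes "nice_density (pi_hat p) \<rho>"
  shows "is_density p \<rho>"
proof -
  obtain B where B: "\<forall>x\<in>{0..pi_hat p}. \<bar>\<rho> x\<bar> \<le> B" and cont: "co_countable 0 (pi_hat p) (isCont \<rho>)"
    and pos: "co_countable 0 (pi_hat p) (\<lambda>x. \<rho> x > 0)"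
    using assms by (auto simp: nice_density_def)
  have "\<rho> absolutely_integrable_on {0..pi_hat p}"
    using integrable_of_co_countable_isCont[OF _ cont] B by blast
  then have "\<rho> absolutely_integrable_on {0<..<pi_hat p}"
    using absolutely_integrable_on_open_interval[where f = \<rho> and a = 0 and b = "pi_hat p"] by simp
  then show ?thesis using co_countable_AE[OF pos] by (simp add: is_density_def)
qed

text \<open>A step density with its high plateau at the end nearer to \<open>a\<close> and reaching
  beyond \<open>a\<close>, but not as far as the midpoint, is a barrier with transition point
  \<open>a\<close>. For \<open>a\<close> in the right half the mirror image is used, and
  \<open>step_ratio\<close> is applied after reflection.\<close>

lemma off_center_barrier_counterexample:
  assumes "p > 1" "a \<in> {0..pi_hat p}" "a \<noteq> pi_hat p / 2"
  shows "\<exists>\<rho>. is_density p \<rho> \<and> single_barrier p a \<rho> \<and> eigenvalue p \<rho> 2 / eigenvalue p \<rho> 1 < 2 powr p"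
proof -
  let ?H = "pi_hat p"
  note H = pi_hat_pos[OF assms(1)]
  obtain K Y where K: "K > 0" "nodal p (\<lambda>_. K) 0 1 Y" using nodal_const_unit[OF assms(1)] by blast
  define a' where "a' = min a (?H - a)"
  \<comment> \<open>Strictly between the transition point, reflected into the left half if
    necessary, and the midpoint: the first keeps \<open>a\<close> on the plateau, the second leaves
    room for \<open>M\<close>.\<close>
  define b where "b = (a' + ?H / 2) / 2"
  have a': "0 \<le> a'" "a' < ?H / 2" using assms(2,3) by (auto simp: a'_def min_def)
  then have b: "0 < b" "b < ?H" "a' < b" "b < ?H / 2" using H by (auto simp: b_def)
  \<comment> \<open>The mean of the two bounds that \<open>step_ratio\<close> puts on the height;
    they are distinct because \<open>b\<close> is less than half of \<open>?H\<close>.\<close>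
  define M where "M = (1 + ((?H - b) / b) powr p) / 2"
  have "1 powr p < ((?H - b) / b) powr p"
    using b assms(1) by (intro powr_less_mono2) (auto simp: field_simps)
  then have M: "1 < M" "M < ((?H - b) / b) powr p" by (auto simp: M_def)
  have M2: "M * b powr p < (?H - b) powr p"
    using M(2) b by (simp add: powr_divide less_divide_eq)
  show ?thesis
  proof (cases "a < ?H / 2")
    case True
    define \<rho> where "\<rho> = (\<lambda>x. if x < b then M else 1)"
    have nice: "nice_density ?H \<rho>"
      unfolding \<rho>_def by (rule step_density_nice) (use H b M in auto)
    have "a < b" using True b(3) by (auto simp: a'_def)
    then have barrier: "single_barrier p a \<rho>"
      using assms(2) M(1) by (auto simp: single_barrier_def single_well_def monotone_on_def \<rho>_def)
    obtain z W1 W2 W2' where z: "z \<in> {0<..<?H}" and m: "0 < eigenvalue p \<rho> 1" "0 < eigenvalue p \<rho> 2" and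
      W: "nodal p (\<lambda>x. eigenvalue p \<rho> 1 * \<rho> x) 0 ?H W1" "nodal p (\<lambda>x. eigenvalue p \<rho> 2 * \<rho> x) 0 z W2"
        "nodal p (\<lambda>x. eigenvalue p \<rho> 2 * \<rho> x) z ?H W2'"
      using eigenvalue_nodal_data[OF assms(1) nice] by blast
    have "eigenvalue p \<rho> 2 < 2 powr p * eigenvalue p \<rho> 1"
      by (rule step_ratio[OF assms(1) K z m W b(1,2) M(1) M2]) (auto simp: \<rho>_def)
    then show ?thesis
      using nice_density_is_density[OF nice] barrier m(1) by (auto simp: divide_less_eq)
  next
    case False
    define \<rho> where "\<rho> = (\<lambda>x. if x < ?H - b then 1 else M)"
    have nice: "nice_density ?H \<rho>"
      unfolding \<rho>_def by (rule step_density_nice) (use H b M in auto)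
    have "?H - b < a" using False b(3) assms(3) by (auto simp: a'_def)
    then have barrier: "single_barrier p a \<rho>"
      using assms(2) M(1) by (auto simp: single_barrier_def single_well_def monotone_on_def \<rho>_def)
    obtain z W1 W2 W2' where z: "z \<in> {0<..<?H}" and m: "0 < eigenvalue p \<rho> 1" "0 < eigenvalue p \<rho> 2" and
      W: "nodal p (\<lambda>x. eigenvalue p \<rho> 1 * \<rho> x) 0 ?H W1" "nodal p (\<lambda>x. eigenvalue p \<rho> 2 * \<rho> x) 0 z W2"
        "nodal p (\<lambda>x. eigenvalue p \<rho> 2 * \<rho> x) z ?H W2'"
      using eigenvalue_nodal_data[OF assms(1) nice] by blast
    have R: "nodal p (\<lambda>x. eigenvalue p \<rho> 1 * \<rho> (?H - x)) 0 ?H (\<lambda>x. - W1 (?H - x))"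
      "nodal p (\<lambda>x. eigenvalue p \<rho> 2 * \<rho> (?H - x)) 0 (?H - z) (\<lambda>x. - W2' (?H - x))"
      "nodal p (\<lambda>x. eigenvalue p \<rho> 2 * \<rho> (?H - x)) (?H - z) ?H (\<lambda>x. - W2 (?H - x))"
      using nodal_reflect[OF W(1), of ?H] nodal_reflect[OF W(2), of ?H] nodal_reflect[OF W(3), of ?H]
      by simp_all
    have z': "?H - z \<in> {0<..<?H}" using z by auto
    have "eigenvalue p \<rho> 2 < 2 powr p * eigenvalue p \<rho> 1"
      by (rule step_ratio[OF assms(1) K z' m R b(1,2) M(1) M2]) (auto simp: \<rho>_def)
    then show ?thesis
      using nice_density_is_density[OF nice] barrier m(1) by (auto simp: divide_less_eq)
  qed
qed

theorem theorem1p2: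
  fixes p :: real
  assumes "p > 1"
  shows
    "(\<forall>\<rho>. is_density p \<rho> \<and> single_barrier p (pi_hat p / 2) \<rho> \<longrightarrow>
        eigenvalue p \<rho> 2 / eigenvalue p \<rho> 1 \<ge> 2 powr p \<and>
        (eigenvalue p \<rho> 2 / eigenvalue p \<rho> 1 = 2 powr p \<longleftrightarrow> ae_constant p \<rho>)) \<and>
     (\<forall>a\<in>{0..pi_hat p}. a \<noteq> pi_hat p / 2 \<longrightarrow>
        (\<exists>\<rho>. is_density p \<rho> \<and> single_barrier p a \<rho> \<and>
             eigenvalue p \<rho> 2 / eigenvalue p \<rho> 1 < 2 powr p)) \<and>
     (\<forall>\<rho>. is_density p \<rho> \<and> symmetric p \<rho> \<and> single_well p (pi_hat p / 2) \<rho> \<longrightarrow>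
        eigenvalue p \<rho> 2 / eigenvalue p \<rho> 1 \<le> 2 powr p \<and>
        (eigenvalue p \<rho> 2 / eigenvalue p \<rho> 1 = 2 powr p \<longleftrightarrow> ae_constant p \<rho>))"
  using barrier_eigenvalue_ratio[OF assms] off_center_barrier_counterexample[OF assms]
    well_eigenvalue_ratio[OF assms] by blast

end
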